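(* Let $\mathcal M(\mathfrak s)$ be an $\mathfrak m$-critical closed RW spacetime of Class I, with cosmological constant $\Lambda$, angular parameter $\vartheta\in(-\pi/3,0)$, and negative internal parameter $\mathcal H$. Let $(\widetilde{\mathcal M}_{\mathcal H,\vartheta},\ell_{\mathcal H,\vartheta})$ denote its conformal model. Put $$f_1(\vartheta,\mathcal H)=\frac1{3\mathcal H^2}\left(1-\cos\vartheta-\sqrt3\sin\vartheta\right)^2,$$ $$f_2(\vartheta,\mathcal H)=\frac2{9\mathcal H^2}\sin^2\!\left(\frac\vartheta2\right)\left(7+\cos\vartheta-2\cos2\vartheta-5\sqrt3\sin\vartheta\right),$$ $$f_3(\vartheta,\mathcal H)=-\frac1{6\mathcal H^2}(1-2\cos\vartheta)(1+2\cos\vartheta)^2,$$ and let $\vartheta_I\approx-0.7706314502$ be the root in the interval $(-\pi/3,0)$ of the equation $$-10+22\cos x+11\cos2x+4\cos3x+10\sqrt3\sin x-5\sqrt3\sin2x=0 .$$ Then $$\Lambda\le f_1(\vartheta,\mathcal H),\qquad \widetilde{\mathcal M}_{\mathcal H,\vartheta}=\mathbb R\times\mathbb S^3,$$ and $\ell_{\mathcal H,\vartheta}$ is the cyclic nondegenerate Lorentz metric $$\ell_{\mathcal H,\vartheta}=\frac{9\mathcal H^2}{(12\widetilde\wp_\vartheta-1)^2}\,(-d\tau^2+g).$$ The weak energy condition is automatically satisfied. The dominant energy condition is satisfied if and only if $\Lambda\le f_2(\vartheta,\mathcal H)$. The strong energy condition is satisfied if and only if $\vartheta\in(-\pi/3,\vartheta_I]$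 and $f_3(\vartheta,\mathcal H)\le\Lambda\le f_2(\vartheta,\mathcal H)$.
   Context: RW spacetimes. Let $g$ be the standard Riemannian metric of the unit sphere $\mathbb S^3\subset\mathbb R^4$. A closed RW spacetime is $\mathcal M(\mathfrak s)=\mathrm I_{\mathfrak s}\times\mathbb S^3$, with $\mathrm I_{\mathfrak s}\subset\mathbb R$ an open interval, $\mathfrak s$ a nonnegative scale function (smooth where positive), the (possibly degenerate) Lorentz metric $\ell_{\mathfrak s}=-dt^2+\mathfrak s^2(t)g$, a cosmological constant $\Lambda\in\mathbb R$ and perfect fluid stress-energy tensor $\mathrm T=\mathfrak m\,dt^2+\mathfrak p\,\mathfrak s^2g$, satisfying the Einstein equation, equivalent to $$\mathfrak m=\frac{3}{8\pi}\left(\frac{\dot{\mathfrak s}^2}{\mathfrak s^2}+\frac1{\mathfrak s^2}-\frac{\Lambda}{3}\right),\qquad \mathfrak p=-\frac1{4\pi\mathfrak s}\left(\ddot{\mathfrak s}+\frac1{2\mathfrak s}(\dot{\mathfrak s}^2+1)-\frac\Lambda2\mathfrak s\right)$$ (dot $=d/dt$; equations are understood where $\mathfrak s>0$). Part of the definition is that the energy density is nonnegative: $\mathfrak m$ takes values in $[0,+\infty)\cup\{+\infty\}$, while the pressure $\mathfrak p$ takes values in $\mathbb R\cup\{\pm\infty\}$. Conformal model. $\mathfrak s$ may vanish at some points, but the conformal time $\tau_{\mathfrak s}(t)=\int_{t_0}^t du/\mathfrak s(u)$ is assumed continuous and strictly increasing, with differentiable inverse on the open interval $\mathrm J_{\mathfrak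 s}=\tau_{\mathfrak s}(\mathrm I_{\mathfrak s})$. The conformal scale function is $\mathrm S=\mathfrak s\circ\tau_{\mathfrak s}^{-1}:\mathrm J_{\mathfrak s}\to\mathbb R$, a nonnegative differentiable function. Domains are maximal: $\mathrm J_{\mathfrak s}$ is the maximal domain of definition of $\mathrm S$ as a nonnegative differentiable function. The conformal model is $\widetilde{\mathcal M}=\mathrm J_{\mathfrak s}\times\mathbb S^3$ with the quadratic form $\mathrm S^2(-d\tau^2+g)$; it is cyclic if $\mathrm J_{\mathfrak s}=\mathbb R$ and $\mathrm S$ is periodic. The origin of $\tau$ is arbitrary, and the additive constant of integration in $\tau$ is normalized to zero (the formula for the metric is up to a translation of $\tau$). Critical spacetimes. $\mathcal M(\mathfrak s)$ is $\mathfrak m$-critical if $\mathfrak s$ is a critical point of $\int_{[t_0,t_1]\times\mathbb S^3}\mathfrak m\,dV_{\ell_{\mathfrak s}}$ with respect to variations preserving the volume (keeping $\int_{t_0}^{t_1}\mathfrak s^3dt$ constant). It is assumed throughout that $\mathfrak s$ is nonconstant; criticality is then expressed by $\mathfrak s\left(\dot{\mathfrak s}^2+\frac{\mathfrak a}{3}\mathfrak s^2-1\right)=\mathcal H$ with constants $\mathfrak a,\mathcal H$ (the internal parameters), or in conformal time by $\mathrm S'^2+\frac{\mathfrak a}{3}\mathrm S^4-\mathrm S^2-\mathcal H\mathrm S=0$; it is also assumed that $\mathcal H\ne0$. Energy conditions (required at all points where $\mathfrak m,\mathfrak p$ are finite): weak: $-\mathfrak m\le\mathfrak p$; dominant: $-\mathfrak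 m\le\mathfrak p\le\mathfrak m$; strong: $-\mathfrak m/3\le\mathfrak p\le\mathfrak m$. Class I. Put $g_2=\frac1{12}$, $g_3=\frac1{48}(\mathfrak a\mathcal H^2-\frac29)$ and $\Delta=16(g_2^3-27g_3^2)=\frac1{48}\mathfrak a\mathcal H^2(4-9\mathfrak a\mathcal H^2)$. The spacetime is of Class I if $\Delta>0$. In that case the roots $e_1>e_2>e_3$ of $4x^3-g_2x-g_3$ are written $e_1=\frac1{4\sqrt3}\left(\frac1{\sqrt3}\cos\vartheta-\sin\vartheta\right)$, $e_2=\frac1{4\sqrt3}\left(\frac1{\sqrt3}\cos\vartheta+\sin\vartheta\right)$, $e_3=-(e_1+e_2)$ with $\vartheta\in(-\pi/3,0)$, the angular parameter; then $g_3=-\frac{\cos3\vartheta}{216}$ and $\mathfrak a=\frac2{9\mathcal H^2}(1-\cos3\vartheta)$. Let $\wp_\vartheta$ be the Weierstrass $\wp$-function with invariants $g_2=\frac1{12}$ and $g_3=-\frac{\cos3\vartheta}{216}$, and let $\omega_\vartheta>0$ and $\omega'_\vartheta$ be its real and purely imaginary primitive half-periods. Put $\widetilde\wp_\vartheta(\tau)=\wp_\vartheta(\tau+\omega'_\vartheta)$ for $\tau\in\mathbb R$ (a real-valued function). *)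

theory Defs
  imports "HOL-Analysis.Analysis"
begin

definition smooth_real_on :: "real set \<Rightarrow> (real \<Rightarrow> real) \<Rightarrow> bool" where
  "smooth_real_on A f \<longleftrightarrow> (\<forall>n. \<forall>t\<in>A. ((deriv ^^ n) f) differentiable (at t))"

text \<open>For an open set U of parameter-time pairs, this is infinite differentiability of
  \<open>(\<epsilon>, t) \<mapsto> \<sigma> \<epsilon> t\<close>: the witness \<open>D i j\<close> is the partial derivative of order i in the parameter
  and order j in the time.\<close>

definition smooth_family_on :: "(real \<times> real) set \<Rightarrow> (real \<Rightarrow> real \<Rightarrow> real) \<Rightarrow> bool" where
  "smooth_family_on U \<sigma> \<longleftrightarrow>
     (\<exists>D :: nat \<Rightarrow> nat \<Rightarrow> real \<Rightarrow> real \<Rightarrow> real.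
        (\<forall>(e, t)\<in>U. D 0 0 e t = \<sigma> e t) \<and>
        (\<forall>i j. continuous_on U (\<lambda>(e, t). D i j e t) \<and>
           (\<forall>(e, t)\<in>U.
              ((\<lambda>x. D i j x t) has_real_derivative D (Suc i) j e t) (at e) \<and>
              ((\<lambda>y. D i j e y) has_real_derivative D i (Suc j) e t) (at t))))"

text \<open>Energy density and pressure of the perfect fluid, as given by the Einstein equation with
  cosmological constant \<open>\<Lambda>\<close> for the metric \<open>-dt\<^sup>2 + s\<^sup>2 g\<close>. The real-valued formulas are meaningful
  only where s is positive. Where s vanishes the density is infinite; therefore every condition
  below on finite values of density and pressure is imposed exactly at the points with s positive.\<close>

definition energy_density :: "real \<Rightarrow> (real \<Rightarrow> real) \<Rightarrow> real \<Rightarrow> real" where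
  "energy_density \<Lambda> s t =
     3 / (8 * pi) * ((deriv s t)\<^sup>2 / (s t)\<^sup>2 + 1 / (s t)\<^sup>2 - \<Lambda> / 3)"

definition pressure :: "real \<Rightarrow> (real \<Rightarrow> real) \<Rightarrow> real \<Rightarrow> real" where
  "pressure \<Lambda> s t =
     - (1 / (4 * pi * s t)) *
       (deriv (deriv s) t + 1 / (2 * s t) * ((deriv s t)\<^sup>2 + 1) - \<Lambda> / 2 * s t)"

definition conformal_time :: "(real \<Rightarrow> real) \<Rightarrow> real \<Rightarrow> real \<Rightarrow> real" where
  "conformal_time s t0 t = (LBINT u=t0..t. 1 / s u)"

definition conformal_domain :: "real set \<Rightarrow> (real \<Rightarrow> real) \<Rightarrow> real \<Rightarrow> real set" where
  "conformal_domain I s t0 = conformal_time s t0 ` I"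

definition conformal_scale :: "real set \<Rightarrow> (real \<Rightarrow> real) \<Rightarrow> real \<Rightarrow> real \<Rightarrow> real" where
  "conformal_scale I s t0 = s \<circ> the_inv_into I (conformal_time s t0)"

definition open_interval :: "real set \<Rightarrow> bool" where
  "open_interval I \<longleftrightarrow> open I \<and> is_interval I \<and> I \<noteq> {}"

definition maximal_domain :: "real set \<Rightarrow> (real \<Rightarrow> real) \<Rightarrow> bool" where
  "maximal_domain J S \<longleftrightarrow>
     \<not> (\<exists>J' S'. open_interval J' \<and> J \<subset> J' \<and>
          (\<forall>y\<in>J'. 0 \<le> S' y \<and> S' differentiable (at y)) \<and> (\<forall>y\<in>J. S' y = S y))"

text \<open>Division by zero yields zero, so the integrand \<open>1 / s\<close> does not see the zeros of s.
  Finiteness of the integral in its intended sense (value \<open>\<infinity>\<close> at the zeros) is integrability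
  together with positivity of s almost everywhere.\<close>

definition closed_RW_spacetime :: "real set \<Rightarrow> (real \<Rightarrow> real) \<Rightarrow> real \<Rightarrow> bool" where
  "closed_RW_spacetime I s \<Lambda> \<longleftrightarrow>
     open_interval I \<and>
     (\<forall>t\<in>I. 0 \<le> s t) \<and>
     smooth_real_on {t\<in>I. 0 < s t} s \<and>
     (AE t in lborel. t \<in> I \<longrightarrow> 0 < s t) \<and>
     (\<forall>t0\<in>I.
        (\<forall>t\<in>I. interval_lebesgue_integrable lborel (ereal t0) (ereal t) (\<lambda>u. 1 / s u)) \<and>
        continuous_on I (conformal_time s t0) \<and>
        strict_mono_on I (conformal_time s t0) \<and>
        (\<forall>y\<in>conformal_domain I s t0.
           the_inv_into I (conformal_time s t0) differentiable (at y) \<and>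
           conformal_scale I s t0 differentiable (at y)) \<and>
        maximal_domain (conformal_domain I s t0) (conformal_scale I s t0)) \<and>
     (\<forall>t\<in>I. 0 < s t \<longrightarrow> 0 \<le> energy_density \<Lambda> s t)"

definition conformal_manifold :: "real set \<Rightarrow> (real \<times> (real ^ 4)) set" where
  "conformal_manifold J = J \<times> sphere 0 1"

definition tangent_space :: "real \<times> (real ^ 4) \<Rightarrow> (real \<times> (real ^ 4)) set" where
  "tangent_space p = {(\<alpha>, v). v \<bullet> snd p = 0}"

text \<open>\<open>-d\<tau>\<^sup>2 + g\<close> with g the round metric of the unit 3-sphere, which on tangent vectors is the inner
  product of the ambient space.\<close>

definition product_metric :: "real \<times> (real ^ 4) \<Rightarrow> real \<times> (real ^ 4) \<Rightarrow> real" where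
  "product_metric X Y = - (fst X * fst Y) + snd X \<bullet> snd Y"

definition conformal_metric ::
  "(real \<Rightarrow> real) \<Rightarrow> real \<times> (real ^ 4) \<Rightarrow> real \<times> (real ^ 4) \<Rightarrow> real \<times> (real ^ 4) \<Rightarrow> real" where
  "conformal_metric S p X Y = (S (fst p))\<^sup>2 * product_metric X Y"

definition lorentz_form :: "'v::real_vector set \<Rightarrow> ('v \<Rightarrow> 'v \<Rightarrow> real) \<Rightarrow> bool" where
  "lorentz_form V b \<longleftrightarrow>
     (\<forall>u\<in>V. \<forall>v\<in>V. b u v = b v u) \<and>
     (\<forall>u\<in>V. \<forall>v\<in>V. \<forall>w\<in>V. \<forall>x y. b (x *\<^sub>R u + y *\<^sub>R v) w = x * b u w + y * b v w) \<and>
     (\<forall>v\<in>V. (\<forall>w\<in>V. b v w = 0) \<longrightarrow> v = 0) \<and>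
     (\<exists>v\<in>V. b v v < 0 \<and> (\<forall>w\<in>V. b v w = 0 \<and> w \<noteq> 0 \<longrightarrow> 0 < b w w))"

text \<open>Smoothness of the tensor field \<open>S\<^sup>2 (-d\<tau>\<^sup>2 + g)\<close> is smoothness of its conformal factor, as
  \<open>-d\<tau>\<^sup>2 + g\<close> is smooth and nowhere zero.\<close>

definition nondegenerate_lorentz_metric :: "real set \<Rightarrow> (real \<Rightarrow> real) \<Rightarrow> bool" where
  "nondegenerate_lorentz_metric J S \<longleftrightarrow>
     smooth_real_on J (\<lambda>\<tau>. (S \<tau>)\<^sup>2) \<and>
     (\<forall>p\<in>conformal_manifold J. lorentz_form (tangent_space p) (conformal_metric S p))"

definition cyclic :: "real set \<Rightarrow> (real \<Rightarrow> real) \<Rightarrow> bool" where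
  "cyclic J S \<longleftrightarrow> J = UNIV \<and> (\<exists>T>0. \<forall>\<tau>. S (\<tau> + T) = S \<tau>)"

text \<open>The volume element of the metric is \<open>s\<^sup>3 dt\<close> times that of the unit 3-sphere, whose volume is
  \<open>2 \<pi>\<^sup>2\<close>.\<close>

definition energy_functional :: "real \<Rightarrow> real \<Rightarrow> real \<Rightarrow> (real \<Rightarrow> real) \<Rightarrow> real" where
  "energy_functional \<Lambda> t0 t1 s =
     2 * pi\<^sup>2 * integral {t0..t1} (\<lambda>t. energy_density \<Lambda> s t * (s t) ^ 3)"

definition volume_preserving_variation ::
  "(real \<Rightarrow> real) \<Rightarrow> real \<Rightarrow> real \<Rightarrow> real \<Rightarrow> (real \<Rightarrow> real \<Rightarrow> real) \<Rightarrow> bool" where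
  "volume_preserving_variation s t0 t1 \<delta> \<sigma> \<longleftrightarrow>
     0 < \<delta> \<and>
     (\<exists>K. open_interval K \<and> {t0..t1} \<subseteq> K \<and> smooth_family_on ({-\<delta><..<\<delta>} \<times> K) \<sigma> \<and>
        (\<forall>t\<in>K. \<sigma> 0 t = s t)) \<and>
     (\<forall>e\<in>{-\<delta><..<\<delta>}.
        \<sigma> e t0 = s t0 \<and> \<sigma> e t1 = s t1 \<and> (\<forall>t\<in>{t0..t1}. 0 < \<sigma> e t) \<and>
        integral {t0..t1} (\<lambda>t. (\<sigma> e t) ^ 3) = integral {t0..t1} (\<lambda>t. (s t) ^ 3))"

definition m_critical :: "real set \<Rightarrow> (real \<Rightarrow> real) \<Rightarrow> real \<Rightarrow> bool" where
  "m_critical I s \<Lambda> \<longleftrightarrow>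
     (\<forall>t0 t1 \<delta> \<sigma>. t0 < t1 \<and> {t0..t1} \<subseteq> {t\<in>I. 0 < s t} \<and>
        volume_preserving_variation s t0 t1 \<delta> \<sigma> \<longrightarrow>
        ((\<lambda>e. energy_functional \<Lambda> t0 t1 (\<sigma> e)) has_real_derivative 0) (at 0))"

definition nonconstant_on :: "real set \<Rightarrow> (real \<Rightarrow> real) \<Rightarrow> bool" where
  "nonconstant_on I s \<longleftrightarrow> \<not> (\<exists>c. \<forall>t\<in>I. s t = c)"

text \<open>The first integral of the Euler-Lagrange equation. For nonconstant s it determines both
  constants.\<close>

definition internal_parameters :: "real set \<Rightarrow> (real \<Rightarrow> real) \<Rightarrow> real \<Rightarrow> real \<Rightarrow> bool" where
  "internal_parameters I s a H \<longleftrightarrow>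
     (\<forall>t\<in>I. 0 < s t \<longrightarrow> s t * ((deriv s t)\<^sup>2 + a / 3 * (s t)\<^sup>2 - 1) = H)"

definition weak_energy_condition :: "real set \<Rightarrow> (real \<Rightarrow> real) \<Rightarrow> real \<Rightarrow> bool" where
  "weak_energy_condition I s \<Lambda> \<longleftrightarrow>
     (\<forall>t\<in>I. 0 < s t \<longrightarrow> - energy_density \<Lambda> s t \<le> pressure \<Lambda> s t)"

definition dominant_energy_condition :: "real set \<Rightarrow> (real \<Rightarrow> real) \<Rightarrow> real \<Rightarrow> bool" where
  "dominant_energy_condition I s \<Lambda> \<longleftrightarrow>
     (\<forall>t\<in>I. 0 < s t \<longrightarrow> - energy_density \<Lambda> s t \<le> pressure \<Lambda> s t \<and>
        pressure \<Lambda> s t \<le> energy_density \<Lambda> s t)"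

definition strong_energy_condition :: "real set \<Rightarrow> (real \<Rightarrow> real) \<Rightarrow> real \<Rightarrow> bool" where
  "strong_energy_condition I s \<Lambda> \<longleftrightarrow>
     (\<forall>t\<in>I. 0 < s t \<longrightarrow> - energy_density \<Lambda> s t / 3 \<le> pressure \<Lambda> s t \<and>
        pressure \<Lambda> s t \<le> energy_density \<Lambda> s t)"

definition g2_inv :: real where
  "g2_inv = 1 / 12"

definition g3_inv :: "real \<Rightarrow> real \<Rightarrow> real" where
  "g3_inv a H = 1 / 48 * (a * H\<^sup>2 - 2 / 9)"

definition class_I :: "real \<Rightarrow> real \<Rightarrow> bool" where
  "class_I a H \<longleftrightarrow> 16 * (g2_inv ^ 3 - 27 * (g3_inv a H)\<^sup>2) > 0"

definition e1 :: "real \<Rightarrow> real" where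
  "e1 \<theta> = 1 / (4 * sqrt 3) * (1 / sqrt 3 * cos \<theta> - sin \<theta>)"

definition e2 :: "real \<Rightarrow> real" where
  "e2 \<theta> = 1 / (4 * sqrt 3) * (1 / sqrt 3 * cos \<theta> + sin \<theta>)"

definition e3 :: "real \<Rightarrow> real" where
  "e3 \<theta> = - (e1 \<theta> + e2 \<theta>)"

definition angular_parameter :: "real \<Rightarrow> real \<Rightarrow> real \<Rightarrow> bool" where
  "angular_parameter a H \<theta> \<longleftrightarrow>
     - pi / 3 < \<theta> \<and> \<theta> < 0 \<and> e1 \<theta> > e2 \<theta> \<and> e2 \<theta> > e3 \<theta> \<and>
     {x. 4 * x ^ 3 - g2_inv * x - g3_inv a H = 0} = {e1 \<theta>, e2 \<theta>, e3 \<theta>}"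

definition period_lattice :: "complex \<Rightarrow> complex \<Rightarrow> complex set" where
  "period_lattice w w' = {of_int m * (2 * w) + of_int n * (2 * w') | m n. True}"

definition lattice_g2 :: "complex set \<Rightarrow> complex" where
  "lattice_g2 L = 60 * (\<Sum>\<^sub>\<infinity>l\<in>L - {0}. 1 / l ^ 4)"

definition lattice_g3 :: "complex set \<Rightarrow> complex" where
  "lattice_g3 L = 140 * (\<Sum>\<^sub>\<infinity>l\<in>L - {0}. 1 / l ^ 6)"

definition weierstrass_p :: "complex set \<Rightarrow> complex \<Rightarrow> complex" where
  "weierstrass_p L z = 1 / z\<^sup>2 + (\<Sum>\<^sub>\<infinity>l\<in>L - {0}. 1 / (z - l)\<^sup>2 - 1 / l\<^sup>2)"

text \<open>The discriminant of the prescribed invariants is positive, so the period lattice is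
  rectangular and has a real and a purely imaginary generator \<open>2 w\<close>, \<open>2 w'\<close>. As the lattice is
  determined by its invariants, this relation determines both half-periods.\<close>

definition half_periods :: "real \<Rightarrow> real \<Rightarrow> complex \<Rightarrow> bool" where
  "half_periods \<theta> w w' \<longleftrightarrow>
     0 < w \<and> Re w' = 0 \<and> 0 < Im w' \<and>
     lattice_g2 (period_lattice (of_real w) w') = of_real (1 / 12) \<and>
     lattice_g3 (period_lattice (of_real w) w') = of_real (- cos (3 * \<theta>) / 216)"

text \<open>The Weierstrass function is real on the horizontal line through \<open>w'\<close>, so taking the real part
  only changes the type.\<close>

definition wp_shifted :: "real \<Rightarrow> complex \<Rightarrow> real \<Rightarrow> real" where
  "wp_shifted w w' \<tau> = Re (weierstrass_p (period_lattice (of_real w) w') (of_real \<tau> + w'))"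

definition f1 :: "real \<Rightarrow> real \<Rightarrow> real" where
  "f1 \<theta> H = 1 / (3 * H\<^sup>2) * (1 - cos \<theta> - sqrt 3 * sin \<theta>)\<^sup>2"

definition f2 :: "real \<Rightarrow> real \<Rightarrow> real" where
  "f2 \<theta> H = 2 / (9 * H\<^sup>2) * (sin (\<theta> / 2))\<^sup>2 *
     (7 + cos \<theta> - 2 * cos (2 * \<theta>) - 5 * sqrt 3 * sin \<theta>)"

definition f3 :: "real \<Rightarrow> real \<Rightarrow> real" where
  "f3 \<theta> H = - (1 / (6 * H\<^sup>2)) * (1 - 2 * cos \<theta>) * (1 + 2 * cos \<theta>)\<^sup>2"

definition theta_I_equation :: "real \<Rightarrow> bool" where
  "theta_I_equation x \<longleftrightarrow>
     - 10 + 22 * cos x + 11 * cos (2 * x) + 4 * cos (3 * x)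
       + 10 * sqrt 3 * sin x - 5 * sqrt 3 * sin (2 * x) = 0"

definition theta_I :: real where
  "theta_I = (THE x. x \<in> {- pi / 3<..<0} \<and> theta_I_equation x)"

end

theory Submission
  imports Defs "HOL-Complex_Analysis.Complex_Analysis"
begin

text \<open>In conformal time, \<open>U = 1/12 + H/(4 S)\<close> turns the first integral into the Weierstrass equation
  \<open>U'\<^sup>2 = 4 U\<^sup>3 - U/12 - g\<^sub>3\<close> with roots \<open>e3 < e2 < e1\<close>. The scale function stays in a compact
  interval of positive numbers, so it can be prolonged past any finite end of its domain, and maximality
  forces the domain to be the whole line. A solution with values at most \<open>e2\<close> oscillates between \<open>e3\<close> and \<open>e2\<close>:
  it has critical points, it is symmetric about each of them, hence it is periodic, and any two such
  solutions are translates of each other. One of them is the Weierstrass function on the line through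
  \<open>w'\<close>, which gives the metric. Finally, density and pressure are polynomials in
  \<open>1 - 12 U = - 3 H / s\<close>, which sweeps out the interval from \<open>1 - 12 e2\<close> to \<open>1 - 12 e3\<close>; by monotonicity
  each energy condition is decided at an endpoint of this interval. The two bounds on the cosmological
  constant in the strong condition are compatible exactly up to the angle \<open>\<theta>\<^sub>I\<close>, because their
  difference is strictly decreasing in \<open>\<theta>\<close>.\<close>

text \<open>The first integral alone does not determine the motion: at a turning point it also
  admits solutions that come to rest and stay there. Uniqueness, and with it symmetry and
  periodicity, therefore rests on the second-order equation, and every solution is carried along
  with its velocity and with both equations. No elliptic integral is evaluated, and no value of the
  Weierstrass function at a half-period is computed. Its differential equation follows from
  Liouville's theorem and the expansion at the origin. Its real period alone shows that on the line
  through \<open>w'\<close> it stays in the band between \<open>e3\<close> and \<open>e2\<close>,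
  because a solution that is at least \<open>e1\<close> everywhere cannot be periodic.\<close>

section \<open>The bounds as functions of the angular parameter\<close>

text \<open>The values of \<open>1 - 12 U\<close> at \<open>U = e2\<close> and \<open>U = e3\<close>.\<close>

definition y_lo :: "real \<Rightarrow> real" where
  "y_lo \<theta> = 1 - cos \<theta> - sqrt 3 * sin \<theta>"

definition y_hi :: "real \<Rightarrow> real" where
  "y_hi \<theta> = 1 + 2 * cos \<theta>"

text \<open>Equals \<open>9 H\<^sup>2 (f2 - f3)\<close>, and minus one half of the left-hand side of the equation for \<open>\<theta>\<^sub>I\<close>,
  when \<open>u\<close> and \<open>v\<close> are the two extreme values above.\<close>

definition bound_gap :: "real \<Rightarrow> real \<Rightarrow> real" where
  "bound_gap u v = (u\<^sup>2 + u ^ 3 / 2) - (3 / 2 * v ^ 3 - 3 * v\<^sup>2)"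

text \<open>The critical points of \<open>3 / 2 * v ^ 3 - 3 * v\<^sup>2\<close> are 0 and 4/3, so it
  increases beyond 4/3; the part in \<open>u\<close> increases for nonnegative
  \<open>u\<close>.\<close>

lemma bound_gap_strict_mono:
  assumes "0 \<le> u" "u \<le> u'" "4 / 3 < v'" "v' < v"
  shows "bound_gap u v < bound_gap u' v'"
proof -
  have "u\<^sup>2 \<le> u'\<^sup>2" "u ^ 3 \<le> u' ^ 3"
    using assms by (auto intro: power_mono)
  moreover have "3 / 2 * v' ^ 3 - 3 * v'\<^sup>2 < 3 / 2 * v ^ 3 - 3 * v\<^sup>2"
  proof -
    \<comment> \<open>Positivity of the difference quotient of \<open>v ^ 3 - 2 * v\<^sup>2\<close>.
      It follows from \<open>v\<^sup>2 + v * v' + v'\<^sup>2 \<ge> 3 / 4 * (v + v')\<^sup>2\<close>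
      and \<open>v + v' > 8 / 3\<close>.\<close>
    have 0: "2 * (v + v') < v\<^sup>2 + v * v' + v'\<^sup>2"
    proof -
      have "0 < (v - v')\<^sup>2" using assms by simp
      hence "3 / 4 * (v + v')\<^sup>2 < v\<^sup>2 + v * v' + v'\<^sup>2"
        by (simp add: power2_eq_square algebra_simps)
      moreover have "8 / 3 * (v + v') < (v + v') * (v + v')"
        using assms by (intro mult_strict_right_mono) auto
      ultimately show ?thesis by (simp add: power2_eq_square)
    qed
    have "0 < (v - v') * (v\<^sup>2 + v * v' + v'\<^sup>2 - 2 * (v + v'))"
      using 0 assms by simp
    also have "\<dots> = (v ^ 3 - 2 * v\<^sup>2) - (v' ^ 3 - 2 * v'\<^sup>2)"
      by (simp add: power2_eq_square power3_eq_cube algebra_simps)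
    finally show ?thesis by simp
  qed
  ultimately show ?thesis
    unfolding bound_gap_def by linarith
qed

section \<open>Trigonometric form of the three roots\<close>

lemma y_lo_cos: "y_lo \<theta> = 1 - 2 * cos (\<theta> - pi / 3)"
  by (simp add: y_lo_def cos_diff cos_60 sin_60 algebra_simps)

lemma e1_cos: "e1 \<theta> = cos (\<theta> + pi / 3) / 6"
  and e2_y_lo: "e2 \<theta> = (1 - y_lo \<theta>) / 12"
  and e3_y_hi: "e3 \<theta> = (1 - y_hi \<theta>) / 12"
proof -
  have s3: "sqrt 3 * sqrt 3 = 3" by simp
  have inv: "1 / (4 * sqrt 3) = sqrt 3 / 12" "1 / sqrt 3 = sqrt 3 / 3"
    using s3 by (simp_all add: field_simps)
  have *: "e1 \<theta> = cos \<theta> / 12 - sqrt 3 * sin \<theta> / 12" "e2 \<theta> = cos \<theta> / 12 + sqrt 3 * sin \<theta> / 12"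
    unfolding e1_def e2_def inv by (simp_all add: distrib_left right_diff_distrib s3)
  show "e1 \<theta> = cos (\<theta> + pi / 3) / 6"
    unfolding * by (simp add: cos_add cos_60 sin_60 diff_divide_distrib)
  show "e2 \<theta> = (1 - y_lo \<theta>) / 12" "e3 \<theta> = (1 - y_hi \<theta>) / 12"
    unfolding e3_def * by (simp_all add: y_lo_def y_hi_def add_divide_distrib)
qed

text \<open>The triple-angle formula in the variable \<open>1 - 2 * cos x\<close>. The substitutions
  \<open>x = \<theta> - pi / 3\<close> and \<open>x = \<theta> + pi\<close>, which produce
  \<open>y_lo\<close> and \<open>y_hi\<close>, both bring \<open>3 * x + pi\<close> to
  \<open>3 * \<theta>\<close> up to multiples of \<open>2 * pi\<close>, so both values solve the
  same cubic.\<close>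

lemma cubic_cos: "(1 - 2 * cos x) ^ 3 - 3 * (1 - 2 * cos x)\<^sup>2 + 2 - 2 * cos (3 * x + pi) = 0"
  using cos_treble_cos[of x] by (simp add: power2_eq_square power3_eq_cube algebra_simps)

lemma cubic_y_lo: "3 * (y_lo \<theta>)\<^sup>2 - (y_lo \<theta>) ^ 3 = 2 * (1 - cos (3 * \<theta>))"
proof -
  have "cos (3 * (\<theta> - pi / 3) + pi) = cos (3 * \<theta>)" by (simp add: algebra_simps)
  with cubic_cos[of "\<theta> - pi / 3"] show ?thesis by (simp add: y_lo_cos)
qed

lemma cubic_y_hi: "3 * (y_hi \<theta>)\<^sup>2 - (y_hi \<theta>) ^ 3 = 2 * (1 - cos (3 * \<theta>))"
proof -
  have "3 * (\<theta> + pi) + pi = 3 * \<theta> + 2 * pi + 2 * pi" by simp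
  hence "cos (\<theta> + pi) = - cos \<theta>" "cos (3 * (\<theta> + pi) + pi) = cos (3 * \<theta>)"
    by (simp_all only: cos_periodic cos_periodic_pi)
  with cubic_cos[of "\<theta> + pi"] show ?thesis by (simp add: y_hi_def)
qed

lemma cubic_e1: "4 * e1 \<theta> ^ 3 - e1 \<theta> / 12 = - cos (3 * \<theta>) / 216"
proof -
  have "cos (3 * (\<theta> + pi / 3)) = - cos (3 * \<theta>)" by (simp add: algebra_simps)
  with cos_treble_cos[of "\<theta> + pi / 3"] show ?thesis
    by (simp add: e1_cos power3_eq_cube field_simps)
qed

context
  fixes \<theta> :: real
  assumes \<theta>: "- pi / 3 < \<theta>" "\<theta> < 0"
begin

lemma cos_range: "1 / 2 < cos \<theta>" "cos \<theta> < 1"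
proof -
  have "cos (pi / 3) < cos (- \<theta>)" using \<theta> by (intro cos_monotone_0_pi) auto
  thus "1 / 2 < cos \<theta>" by (simp add: cos_60)
  have "cos (- \<theta>) < cos 0" using \<theta> by (intro cos_monotone_0_pi) auto
  thus "cos \<theta> < 1" by simp
qed

lemma y_hi_range: "2 < y_hi \<theta>" "y_hi \<theta> < 3"
  using cos_range by (auto simp: y_hi_def)

lemma y_lo_range: "0 < y_lo \<theta>" "y_lo \<theta> < 2"
proof -
  have eq: "cos (\<theta> - pi / 3) = cos (pi / 3 - \<theta>)"
    by (metis cos_minus minus_diff_eq)
  have "cos (pi / 3 - \<theta>) < cos (pi / 3)" using \<theta> by (intro cos_monotone_0_pi) auto
  thus "0 < y_lo \<theta>" by (simp add: y_lo_cos eq cos_60)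
  have "cos (pi - pi / 3) < cos (pi / 3 - \<theta>)" using \<theta> by (intro cos_monotone_0_pi) auto
  hence "- cos (pi / 3) < cos (pi / 3 - \<theta>)" by (simp only: cos_pi_minus)
  thus "y_lo \<theta> < 2" by (simp add: y_lo_cos eq cos_60)
qed

text \<open>The number 1/12 is the value of \<open>U\<close> at infinite scale factor. For negative
  \<open>H\<close> it bounds \<open>U\<close> from above, so this inequality keeps \<open>U\<close>
  off the branch beyond \<open>e1\<close>.\<close>

lemma e1_gt: "1 / 12 < e1 \<theta>"
proof -
  have "cos (pi / 3) < cos (\<theta> + pi / 3)" using \<theta> by (intro cos_monotone_0_pi) auto
  thus ?thesis by (simp add: e1_cos cos_60)
qed

end

text \<open>As the angle grows towards 0, \<open>y_lo\<close> falls and \<open>y_hi\<close> rises,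
  and the gap responds to the two in opposite directions.\<close>

lemma bound_gap_strict_antimono:
  assumes "- pi / 3 \<le> \<theta>" "\<theta> < \<theta>'" "\<theta>' \<le> 0"
  shows "bound_gap (y_lo \<theta>') (y_hi \<theta>') < bound_gap (y_lo \<theta>) (y_hi \<theta>)"
proof (rule bound_gap_strict_mono)
  have eq: "cos (x - pi / 3) = cos (pi / 3 - x)" for x
    by (metis cos_minus minus_diff_eq)
  have "cos (pi / 3 - \<theta>') \<le> cos (pi / 3)" using assms by (intro cos_monotone_0_pi_le) auto
  thus "0 \<le> y_lo \<theta>'" by (simp add: y_lo_cos eq cos_60)
  have "cos (pi / 3 - \<theta>) \<le> cos (pi / 3 - \<theta>')" using assms by (intro cos_monotone_0_pi_le) auto
  thus "y_lo \<theta>' \<le> y_lo \<theta>" by (simp add: y_lo_cos eq)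
  have "cos (pi / 3) \<le> cos (- \<theta>)" using assms by (intro cos_monotone_0_pi_le) auto
  thus "4 / 3 < y_hi \<theta>" by (simp add: y_hi_def cos_60)
  have "cos (- \<theta>) < cos (- \<theta>')" using assms by (intro cos_monotone_0_pi) auto
  thus "y_hi \<theta> < y_hi \<theta>'" by (simp add: y_hi_def)
qed

lemma theta_I_equation_iff: "theta_I_equation \<theta> \<longleftrightarrow> bound_gap (y_lo \<theta>) (y_hi \<theta>) = 0"
proof -
  define c w where "c = cos \<theta>" "w = sqrt 3 * sin \<theta>"
  have w: "w\<^sup>2 - 3 + 3 * c\<^sup>2 = 0"
    by (simp add: c_w_def power_mult_distrib sin_squared_eq)
  \<comment> \<open>The two sides agree only modulo the Pythagorean relation
    \<open>w\<^sup>2 - 3 + 3 * c\<^sup>2 = 0\<close>; the last summand displays the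
    cofactor.\<close>
  have "- 10 + 22 * c + 11 * (2 * c\<^sup>2 - 1) + 4 * (4 * c ^ 3 - 3 * c) + 10 * w - 10 * w * c
      = - 2 * bound_gap (1 - c - w) (1 + 2 * c) + (5 - 3 * c - w) * (w\<^sup>2 - 3 + 3 * c\<^sup>2)"
    by (simp add: bound_gap_def power2_eq_square power3_eq_cube field_simps)
  moreover have "theta_I_equation \<theta> \<longleftrightarrow>
      - 10 + 22 * c + 11 * (2 * c\<^sup>2 - 1) + 4 * (4 * c ^ 3 - 3 * c) + 10 * w - 10 * w * c = 0"
    unfolding theta_I_equation_def cos_double_cos cos_treble_cos sin_double
    by (simp add: c_w_def algebra_simps)
  ultimately show ?thesis
    unfolding w by (simp add: c_w_def y_lo_def y_hi_def)
qed

lemma f1_y_lo: "f1 \<theta> H = (y_lo \<theta>)\<^sup>2 / (3 * H\<^sup>2)"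
  by (simp add: f1_def y_lo_def)

lemma f2_y_lo: "f2 \<theta> H = ((y_lo \<theta>)\<^sup>2 + (y_lo \<theta>) ^ 3 / 2) / (9 * H\<^sup>2)"
proof -
  define c w where "c = cos \<theta>" "w = sqrt 3 * sin \<theta>"
  have w: "w\<^sup>2 - 3 + 3 * c\<^sup>2 = 0"
    by (simp add: c_w_def power_mult_distrib sin_squared_eq)
  have half: "2 * (sin (\<theta> / 2))\<^sup>2 = 1 - c"
    using cos_double_sin[of "\<theta> / 2"] by (simp add: c_w_def)
  \<comment> \<open>Again an identity modulo the Pythagorean relation, with its cofactor made
    explicit.\<close>
  have "(1 - c) * (7 + c - 2 * (2 * c\<^sup>2 - 1) - 5 * w)
      = (1 - c - w)\<^sup>2 + (1 - c - w) ^ 3 / 2 - (5 - 3 * c - w) / 2 * (w\<^sup>2 - 3 + 3 * c\<^sup>2)"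
    by (simp add: power2_eq_square power3_eq_cube field_simps)
  moreover have "f2 \<theta> H = 2 * (sin (\<theta> / 2))\<^sup>2 * (7 + c - 2 * (2 * c\<^sup>2 - 1) - 5 * w) / (9 * H\<^sup>2)"
    by (simp add: f2_def c_w_def cos_double_cos)
  ultimately show ?thesis
    unfolding y_lo_def half w by (simp add: c_w_def)
qed

lemma f3_y_hi: "f3 \<theta> H = (3 / 2 * (y_hi \<theta>) ^ 3 - 3 * (y_hi \<theta>)\<^sup>2) / (9 * H\<^sup>2)"
proof (cases "H = 0")
  case False
  thus ?thesis
    by (simp add: f3_def y_hi_def field_simps power2_eq_square power3_eq_cube)
qed (simp add: f3_def)

lemma f3_le_f2_iff:
  assumes "H \<noteq> 0"
  shows "f3 \<theta> H \<le> f2 \<theta> H \<longleftrightarrow> 0 \<le> bound_gap (y_lo \<theta>) (y_hi \<theta>)"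
  using assms by (simp add: f3_y_hi f2_y_lo bound_gap_def divide_le_cancel)

section \<open>Numerical localisation of the threshold angle\<close>

lemma sqrt_3_bounds: "1.7320508075688 < sqrt 3" "sqrt 3 < 1.7320508075689"
  by (rule real_less_rsqrt real_less_lsqrt; simp add: power2_eq_square)+

text \<open>At the endpoints used below, order 14 leaves an error under \<open>1 / 10 ^ 12\<close>,
  while the cosines to be told apart there differ by more than \<open>1 / 10 ^ 10\<close>.\<close>

lemma cos_approx:
  fixes x :: real
  shows "\<bar>cos x - (1 - x ^ 2 / 2 + x ^ 4 / 24 - x ^ 6 / 720 + x ^ 8 / 40320 - x ^ 10 / 3628800 + x ^ 12 / 479001600)\<bar> \<le> \<bar>x\<bar> ^ 14 / 87178291200"
proof -
  obtain t where t: "cos x = (\<Sum>m<14. cos_coeff m * x ^ m) + (cos (t + 1 / 2 * real 14 * pi) / fact 14) * x ^ 14"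
    using Maclaurin_cos_expansion by blast
  have "(\<Sum>m<14. cos_coeff m * x ^ m) = 1 - x ^ 2 / 2 + x ^ 4 / 24 - x ^ 6 / 720 + x ^ 8 / 40320 - x ^ 10 / 3628800 + x ^ 12 / 479001600"
    by (simp add: lessThan_nat_numeral cos_coeff_def fact_numeral)
  hence "\<bar>cos x - (1 - x ^ 2 / 2 + x ^ 4 / 24 - x ^ 6 / 720 + x ^ 8 / 40320 - x ^ 10 / 3628800 + x ^ 12 / 479001600)\<bar>
      = \<bar>cos (t + 1 / 2 * real 14 * pi)\<bar> / fact 14 * \<bar>x\<bar> ^ 14"
    using t by (simp add: abs_mult power_abs)
  also have "\<dots> \<le> 1 / fact 14 * \<bar>x\<bar> ^ 14"
    by (intro mult_right_mono divide_right_mono) auto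
  also have "\<dots> = \<bar>x\<bar> ^ 14 / 87178291200"
    by (simp add: fact_numeral)
  finally show ?thesis .
qed

lemma sin_approx:
  fixes x :: real
  shows "\<bar>sin x - (x - x ^ 3 / 6 + x ^ 5 / 120 - x ^ 7 / 5040 + x ^ 9 / 362880 - x ^ 11 / 39916800)\<bar> \<le> \<bar>x\<bar> ^ 13 / 6227020800"
proof -
  obtain t where t: "sin x = (\<Sum>m<13. sin_coeff m * x ^ m) + (sin (t + 1 / 2 * real 13 * pi) / fact 13) * x ^ 13"
    using Maclaurin_sin_expansion by blast
  have "(\<Sum>m<13. sin_coeff m * x ^ m) = x - x ^ 3 / 6 + x ^ 5 / 120 - x ^ 7 / 5040 + x ^ 9 / 362880 - x ^ 11 / 39916800"
    by (simp add: lessThan_nat_numeral sin_coeff_def fact_numeral)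
  hence "\<bar>sin x - (x - x ^ 3 / 6 + x ^ 5 / 120 - x ^ 7 / 5040 + x ^ 9 / 362880 - x ^ 11 / 39916800)\<bar>
      = \<bar>sin (t + 1 / 2 * real 13 * pi)\<bar> / fact 13 * \<bar>x\<bar> ^ 13"
    using t by (simp add: abs_mult power_abs)
  also have "\<dots> \<le> 1 / fact 13 * \<bar>x\<bar> ^ 13"
    by (intro mult_right_mono divide_right_mono) auto
  also have "\<dots> = \<bar>x\<bar> ^ 13 / 6227020800"
    by (simp add: fact_numeral)
  finally show ?thesis .
qed

text \<open>The powers are rounded to fourteen digits so that the arithmetic involves only short numerals.\<close>

lemma cos_sin_left:
  "0.7174709517 < cos (0.7706314503::real)" "cos (0.7706314503::real) < 0.71747095172"
  "0.69658842470 < sin (0.7706314503::real)" "sin (0.7706314503::real) < 0.69658842473"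
proof -
  obtain x :: real where x: "x = 0.7706314503" by blast
  have step: "x ^ Suc k = 0.7706314503 * x ^ k" for k
    by (simp add: x)
  have p1: "0.7706314503 \<le> x ^ 1" "x ^ 1 \<le> 0.7706314503"
    by (simp_all add: x)
  have p2: "0.59387283219148 \<le> x ^ 2" "x ^ 2 \<le> 0.59387283219149"
    by (simp_all add: x power2_eq_square)
  have p3: "0.45765708196548 \<le> x ^ 3" "x ^ 3 \<le> 0.45765708196550"
    using p2 step[of 2] by simp_all
  have p4: "0.35268494081512 \<le> x ^ 4" "x ^ 4 \<le> 0.35268494081514"
    using p3 step[of 3] by simp_all
  have p5: "0.27179010743932 \<le> x ^ 5" "x ^ 5 \<le> 0.27179010743935"
    using p4 step[of 4] by simp_all
  have p6: "0.20945000467315 \<le> x ^ 6" "x ^ 6 \<le> 0.20945000467318"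
    using p5 step[of 5] by simp_all
  have p7: "0.16140876086661 \<le> x ^ 7" "x ^ 7 \<le> 0.16140876086664"
    using p6 step[of 6] by simp_all
  have p8: "0.12438666747776 \<le> x ^ 8" "x ^ 8 \<le> 0.12438666747779"
    using p7 step[of 7] by simp_all
  have p9: "0.09585627795637 \<le> x ^ 9" "x ^ 9 \<le> 0.09585627795640"
    using p8 step[of 8] by simp_all
  have p10: "0.07386986250187 \<le> x ^ 10" "x ^ 10 \<le> 0.07386986250191"
    using p9 step[of 9] by simp_all
  have p11: "0.05692643927327 \<le> x ^ 11" "x ^ 11 \<le> 0.05692643927331"
    using p10 step[of 10] by simp_all
  have p12: "0.04386930445757 \<le> x ^ 12" "x ^ 12 \<le> 0.04386930445761"
    using p11 step[of 11] by simp_all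
  have p13: "0.03380706571778 \<le> x ^ 13" "x ^ 13 \<le> 0.03380706571783"
    using p12 step[of 12] by simp_all
  have p14: "0.02605278808448 \<le> x ^ 14" "x ^ 14 \<le> 0.02605278808452"
    using p13 step[of 13] by simp_all
  have "0 \<le> x" by (simp add: x)
  hence r: "\<bar>x\<bar> ^ 13 = x ^ 13" "\<bar>x\<bar> ^ 14 = x ^ 14"
    by (simp_all add: abs_of_nonneg)
  have "0.7174709517 < cos x \<and> cos x < 0.71747095172"
    using cos_approx[of x] unfolding abs_le_iff r
    using p2 p4 p6 p8 p10 p12 p14 by (intro conjI; elim conjE; simp)
  moreover have "0.69658842470 < sin x \<and> sin x < 0.69658842473"
    using sin_approx[of x] unfolding abs_le_iff r
    using p1 p3 p5 p7 p9 p11 p13 by (intro conjI; elim conjE; simp)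
  ultimately show
    "0.7174709517 < cos (0.7706314503::real)" "cos (0.7706314503::real) < 0.71747095172"
    "0.69658842470 < sin (0.7706314503::real)" "sin (0.7706314503::real) < 0.69658842473"
    by (simp_all add: x)
qed

lemma cos_sin_right:
  "0.71747095183 < cos (0.7706314501::real)" "cos (0.7706314501::real) < 0.71747095186"
  "0.69658842456 < sin (0.7706314501::real)" "sin (0.7706314501::real) < 0.69658842459"
proof -
  obtain x :: real where x: "x = 0.7706314501" by blast
  have step: "x ^ Suc k = 0.7706314501 * x ^ k" for k
    by (simp add: x)
  have p1: "0.7706314501 \<le> x ^ 1" "x ^ 1 \<le> 0.7706314501"
    by (simp_all add: x)
  have p2: "0.59387283188322 \<le> x ^ 2" "x ^ 2 \<le> 0.59387283188323"
    by (simp_all add: x power2_eq_square)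
  have p3: "0.45765708160915 \<le> x ^ 3" "x ^ 3 \<le> 0.45765708160917"
    using p2 step[of 2] by simp_all
  have p4: "0.35268494044899 \<le> x ^ 4" "x ^ 4 \<le> 0.35268494044901"
    using p3 step[of 3] by simp_all
  have p5: "0.27179010708663 \<le> x ^ 5" "x ^ 5 \<le> 0.27179010708666"
    using p4 step[of 4] by simp_all
  have p6: "0.20945000434700 \<le> x ^ 6" "x ^ 6 \<le> 0.20945000434703"
    using p5 step[of 5] by simp_all
  have p7: "0.16140876057337 \<le> x ^ 7" "x ^ 7 \<le> 0.16140876057341"
    using p6 step[of 6] by simp_all
  have p8: "0.12438666721949 \<le> x ^ 8" "x ^ 8 \<le> 0.12438666721954"
    using p7 step[of 7] by simp_all
  have p9: "0.09585627773246 \<le> x ^ 9" "x ^ 9 \<le> 0.09585627773251"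
    using p8 step[of 8] by simp_all
  have p10: "0.07386986231015 \<le> x ^ 10" "x ^ 10 \<le> 0.07386986231020"
    using p9 step[of 9] by simp_all
  have p11: "0.05692643911075 \<le> x ^ 11" "x ^ 11 \<le> 0.05692643911080"
    using p10 step[of 10] by simp_all
  have p12: "0.04386930432094 \<le> x ^ 12" "x ^ 12 \<le> 0.04386930432099"
    using p11 step[of 11] by simp_all
  have p13: "0.03380706560372 \<le> x ^ 13" "x ^ 13 \<le> 0.03380706560377"
    using p12 step[of 12] by simp_all
  have p14: "0.02605278798982 \<le> x ^ 14" "x ^ 14 \<le> 0.02605278798986"
    using p13 step[of 13] by simp_all
  have "0 \<le> x" by (simp add: x)
  hence r: "\<bar>x\<bar> ^ 13 = x ^ 13" "\<bar>x\<bar> ^ 14 = x ^ 14"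
    by (simp_all add: abs_of_nonneg)
  have "0.71747095183 < cos x \<and> cos x < 0.71747095186"
    using cos_approx[of x] unfolding abs_le_iff r
    using p2 p4 p6 p8 p10 p12 p14 by (intro conjI; elim conjE; simp)
  moreover have "0.69658842456 < sin x \<and> sin x < 0.69658842459"
    using sin_approx[of x] unfolding abs_le_iff r
    using p1 p3 p5 p7 p9 p11 p13 by (intro conjI; elim conjE; simp)
  ultimately show
    "0.71747095183 < cos (0.7706314501::real)" "cos (0.7706314501::real) < 0.71747095186"
    "0.69658842456 < sin (0.7706314501::real)" "sin (0.7706314501::real) < 0.69658842459"
    by (simp_all add: x)
qed

text \<open>The two points are the announced approximation shifted by \<open>1 / 10 ^ 10\<close> to
  either side, so a sign change between them proves the approximation.\<close>

lemma theta_I_bracket: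
  "bound_gap (y_lo (- 0.7706314503)) (y_hi (- 0.7706314503)) > 0"
  "bound_gap (y_lo (- 0.7706314501)) (y_hi (- 0.7706314501)) < 0"
proof -
  note cs = cos_sin_left
  have "1.7320508075688 * 0.69658842470 < sqrt 3 * sin (0.7706314503::real)"
    using cs sqrt_3_bounds by (intro mult_strict_mono) auto
  hence lo: "1.48905559175 < y_lo (- 0.7706314503)" "y_hi (- 0.7706314503) < 2.43494190344"
    using cs by (simp_all add: y_lo_def y_hi_def)
  \<comment> \<open>By monotonicity in both arguments the trigonometric values may be replaced by
    decimals, which leaves rational arithmetic.\<close>
  have "0 < bound_gap 1.48905559175 2.43494190344"
    by (simp add: bound_gap_def power2_eq_square power3_eq_cube)
  also have "\<dots> < bound_gap (y_lo (- 0.7706314503)) (y_hi (- 0.7706314503))"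
    using lo cs by (intro bound_gap_strict_mono) (auto simp: y_hi_def)
  finally show "bound_gap (y_lo (- 0.7706314503)) (y_hi (- 0.7706314503)) > 0" .
next
  note cs = cos_sin_right
  have "sqrt 3 * sin (0.7706314501::real) < 1.7320508075689 * 0.69658842459"
    using cs sqrt_3_bounds by (intro mult_strict_mono) auto
  hence hi: "y_lo (- 0.7706314501) < 1.48905559153" "2.43494190366 < y_hi (- 0.7706314501)"
    using cs by (simp_all add: y_lo_def y_hi_def)
  have "0 < sqrt 3 * sin (0.7706314501::real)"
    using cs by (intro mult_pos_pos) auto
  hence "0 < y_lo (- 0.7706314501)"
    using cos_le_one[of "0.7706314501"] unfolding y_lo_def sin_minus cos_minus by linarith
  have "bound_gap (y_lo (- 0.7706314501)) (y_hi (- 0.7706314501)) < bound_gap 1.48905559153 2.43494190366"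
    using hi \<open>0 < y_lo _\<close> by (intro bound_gap_strict_mono) auto
  also have "\<dots> < 0"
    by (simp add: bound_gap_def power2_eq_square power3_eq_cube)
  finally show "bound_gap (y_lo (- 0.7706314501)) (y_hi (- 0.7706314501)) < 0" .
qed

lemma
  shows theta_I_ex1: "\<exists>!x. x \<in> {- pi / 3<..<0} \<and> theta_I_equation x"
    and theta_I_approx: "\<bar>theta_I - (- 0.7706314502)\<bar> < 1 / 10 ^ 10"
    and theta_I_gap: "\<lbrakk>- pi / 3 < \<theta>; \<theta> < 0\<rbrakk> \<Longrightarrow> 0 \<le> bound_gap (y_lo \<theta>) (y_hi \<theta>) \<longleftrightarrow> \<theta> \<le> theta_I"
proof -
  let ?g = "\<lambda>x. bound_gap (y_lo x) (y_hi x)"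
  have pi: "- pi / 3 < - 0.7706314503"
    using pi_gt3 by simp
  have "continuous_on {- 0.7706314503..- 0.7706314501} ?g"
    unfolding bound_gap_def y_lo_def y_hi_def by (intro continuous_intros) auto
  then obtain r where r: "- 0.7706314503 \<le> r" "r \<le> - 0.7706314501" "?g r = 0"
    using IVT2'[of ?g "- 0.7706314501" 0 "- 0.7706314503"] theta_I_bracket by force
  have r': "- 0.7706314503 < r" "r < - 0.7706314501"
    using r theta_I_bracket by (metis less_eq_real_def less_irrefl)+
  have r_dom: "- pi / 3 < r" "r < 0"
    using r' pi by auto
  \<comment> \<open>Strict decrease settles the sign on both sides of \<open>r\<close>; uniqueness,
    the value of \<open>theta_I\<close> and the sign criterion all follow from this.\<close>
  have sgn: "0 < ?g x \<longleftrightarrow> x < r" "0 = ?g x \<longleftrightarrow> x = r" if "- pi / 3 < x" "x < 0" for x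
    using bound_gap_strict_antimono[of x r] bound_gap_strict_antimono[of r x] r r_dom that
    by (cases x r rule: linorder_cases; force)+
  show ex1: "\<exists>!x. x \<in> {- pi / 3<..<0} \<and> theta_I_equation x"
    unfolding theta_I_equation_iff using r r_dom sgn(2) by (intro ex1I[of _ r]) auto
  have th: "theta_I = r"
    unfolding theta_I_def theta_I_equation_iff
    using r r_dom sgn(2) by (intro the_equality) auto
  show "\<bar>theta_I - (- 0.7706314502)\<bar> < 1 / 10 ^ 10"
    using r' unfolding th abs_less_iff by simp
  show "0 \<le> ?g \<theta> \<longleftrightarrow> \<theta> \<le> theta_I" if "- pi / 3 < \<theta>" "\<theta> < 0"
    using sgn[OF that] unfolding th by (auto simp: le_less)
qed

section \<open>Bounded solutions of the cubic equation\<close>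

text \<open>The mean value theorem on \<open>{t..t + 1}\<close> gives points tending to infinity at
  which the derivative equals \<open>f (t + 1) - f t\<close>, and this difference tends to
  0.\<close>

lemma limit_of_derivative_zero:
  fixes f f' :: "real \<Rightarrow> real"
  assumes deriv: "\<And>t. T \<le> t \<Longrightarrow> (f has_real_derivative f' t) (at t)"
    and f: "(f \<longlongrightarrow> L) at_top" and f': "(f' \<longlongrightarrow> c) at_top"
  shows "c = 0"
proof -
  have "\<exists>\<xi>>t. f (t + 1) - f t = f' \<xi>" if "T \<le> t" for t
    using MVT2[of t "t + 1" f f'] deriv that by fastforce
  then obtain \<xi> where \<xi>: "\<And>t. T \<le> t \<Longrightarrow> t < \<xi> t" "\<And>t. T \<le> t \<Longrightarrow> f (t + 1) - f t = f' (\<xi> t)"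
    by metis
  have "filterlim \<xi> at_top at_top"
    by (rule filterlim_at_top_mono[OF filterlim_ident])
       (use \<xi>(1) in \<open>auto intro!: eventually_at_top_linorderI[of T] less_imp_le\<close>)
  from filterlim_compose[OF f' this] have "((\<lambda>t. f' (\<xi> t)) \<longlongrightarrow> c) at_top" .
  moreover have "filterlim (\<lambda>t::real. t + 1) at_top at_top"
    by (rule filterlim_at_top_mono[OF filterlim_ident]) auto
  hence "((\<lambda>t. f (t + 1) - f t) \<longlongrightarrow> L - L) at_top"
    by (intro tendsto_diff f filterlim_compose[OF f])
  hence "((\<lambda>t. f' (\<xi> t)) \<longlongrightarrow> L - L) at_top"
    by (rule Lim_transform_eventually) (use \<xi>(2) in \<open>auto intro!: eventually_at_top_linorderI[of T]\<close>)
  ultimately show ?thesis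
    using tendsto_unique[OF trivial_limit_at_top_linorder] by fastforce
qed

lemma bounded_increasing_converges:
  fixes f f' :: "real \<Rightarrow> real"
  assumes deriv: "\<And>t. T \<le> t \<Longrightarrow> (f has_real_derivative f' t) (at t)"
    and pos: "\<And>t. T \<le> t \<Longrightarrow> 0 \<le> f' t" and bound: "\<And>t. f t \<le> B"
  obtains L where "(f \<longlongrightarrow> L) at_top"
proof -
  have mono: "f x \<le> f y" if "T \<le> x" "x \<le> y" for x y
    using that deriv pos by (intro DERIV_nonneg_imp_nondecreasing[of x y f]) (meson order_trans)+
  let ?L = "Sup (f ` {T..})"
  have bdd: "bdd_above (f ` {T..})"
    using bound by (auto simp: bdd_above_def)
  have "(f \<longlongrightarrow> ?L) at_top"
  proof (rule increasing_tendsto)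
    show "\<forall>\<^sub>F t in at_top. f t \<le> ?L"
      using bdd by (auto intro!: eventually_at_top_linorderI[of T] cSup_upper)
    fix x assume "x < ?L"
    then obtain s where "T \<le> s" "x < f s"
      using less_cSup_iff[OF _ bdd] by auto
    thus "\<forall>\<^sub>F t in at_top. x < f t"
      using mono by (auto intro!: eventually_at_top_linorderI[of s] intro: less_le_trans)
  qed
  thus thesis by (rule that)
qed

text \<open>A Gronwall argument for the squared distance in the phase plane. The Lipschitz bound is
  asked for only along the two solutions, since the intended \<open>F\<close> is quadratic and not
  globally Lipschitz.\<close>

lemma second_order_unique:
  fixes X X1 Y Y1 F :: "real \<Rightarrow> real"
  assumes X: "\<And>t. (X has_real_derivative X1 t) (at t)" "\<And>t. (X1 has_real_derivative F (X t)) (at t)"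
    and Y: "\<And>t. (Y has_real_derivative Y1 t) (at t)" "\<And>t. (Y1 has_real_derivative F (Y t)) (at t)"
    and lip: "\<And>t. \<bar>F (X t) - F (Y t)\<bar> \<le> K * \<bar>X t - Y t\<bar>"
    and init: "X a = Y a" "X1 a = Y1 a" and K: "0 \<le> K"
  shows "X t = Y t"
proof -
  define E where "E = (\<lambda>t. (X t - Y t)\<^sup>2 + (X1 t - Y1 t)\<^sup>2)"
  define E' where "E' = (\<lambda>t. 2 * (X t - Y t) * (X1 t - Y1 t) + 2 * (X1 t - Y1 t) * (F (X t) - F (Y t)))"
  have E: "(E has_real_derivative E' t) (at t)" for t
    unfolding E_def E'_def by (auto intro!: derivative_eq_intros X Y simp: algebra_simps)
  have E'_bound: "\<bar>E' t\<bar> \<le> (1 + K) * E t" for t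
  proof -
    define u v where "u = \<bar>X t - Y t\<bar>" "v = \<bar>X1 t - Y1 t\<bar>"
    have "\<bar>(X1 t - Y1 t) * (F (X t) - F (Y t))\<bar> \<le> v * (K * u)"
      unfolding abs_mult u_v_def by (intro mult_left_mono lip) auto
    moreover have "\<bar>(X t - Y t) * (X1 t - Y1 t)\<bar> = u * v"
      by (simp add: abs_mult u_v_def)
    ultimately have "\<bar>E' t\<bar> \<le> 2 * (u * v) + 2 * (v * (K * u))"
      unfolding E'_def mult.assoc by linarith
    also have "\<dots> = (1 + K) * (2 * u * v)" by (simp add: algebra_simps)
    also have "\<dots> \<le> (1 + K) * (u\<^sup>2 + v\<^sup>2)"
      using K sum_squares_bound[of u v] by (intro mult_left_mono) auto
    finally show ?thesis by (simp add: E_def u_v_def)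
  qed
  have E_nonneg: "0 \<le> E t" for t by (simp add: E_def)
  have E_a: "E a = 0" using init by (simp add: E_def)
  \<comment> \<open>With weight \<open>exp (- (1 + K) * t)\<close> to the right of \<open>a\<close>
    and \<open>exp ((1 + K) * t)\<close> to the left, the weighted \<open>E\<close> cannot grow away
    from \<open>a\<close>, where it is 0.\<close>
  have deriv: "((\<lambda>t. E t * exp (c * t)) has_real_derivative (E' t + c * E t) * exp (c * t)) (at t)" for c t
    by (auto intro!: derivative_eq_intros E simp: algebra_simps)
  have "E t = 0"
  proof (cases "a \<le> t")
    case True
    have "E t * exp (- (1 + K) * t) \<le> E a * exp (- (1 + K) * a)"
    proof (rule DERIV_nonpos_imp_nonincreasing[OF True])
      fix x
      have "(E' x + - (1 + K) * E x) * exp (- (1 + K) * x) \<le> 0"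
        using abs_le_D1[OF E'_bound[of x]] by (intro mult_nonpos_nonneg) (simp_all add: algebra_simps)
      thus "\<exists>y. ((\<lambda>t. E t * exp (- (1 + K) * t)) has_real_derivative y) (at x) \<and> y \<le> 0"
        using deriv by blast
    qed
    thus ?thesis using E_nonneg[of t] by (simp add: E_a mult_le_0_iff)
  next
    case False
    hence "t \<le> a" by simp
    have "E t * exp ((1 + K) * t) \<le> E a * exp ((1 + K) * a)"
    proof (rule DERIV_nonneg_imp_nondecreasing[OF \<open>t \<le> a\<close>])
      fix x
      have "0 \<le> (E' x + (1 + K) * E x) * exp ((1 + K) * x)"
        using abs_le_D2[OF E'_bound[of x]] by (intro mult_nonneg_nonneg) (simp_all add: algebra_simps)
      thus "\<exists>y. ((\<lambda>t. E t * exp ((1 + K) * t)) has_real_derivative y) (at x) \<and> 0 \<le> y"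
        using deriv by blast
    qed
    thus ?thesis using E_nonneg[of t] by (simp add: E_a mult_le_0_iff)
  qed
  thus ?thesis by (simp add: E_def sum_power2_eq_zero_iff)
qed

lemma periodic_int:
  fixes X :: "real \<Rightarrow> 'a"
  assumes "\<And>t. X (t + T) = X t"
  shows "X (t + of_int n * T) = X t"
proof -
  have nat: "X (t + of_nat n * T) = X t" for t n
  proof (induction n)
    case (Suc n)
    have "X (t + of_nat n * T + T) = X (t + of_nat n * T)" by (rule assms)
    thus ?case using Suc by (simp add: algebra_simps)
  qed simp
  show ?thesis
  proof (cases "0 \<le> n")
    case True
    thus ?thesis using nat[of t "nat n"] by (simp add: of_nat_nat)
  next
    case False
    thus ?thesis using nat[of "t + of_int n * T" "nat (- n)"] by (simp add: of_nat_nat)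
  qed
qed

lemma periodic_attains_extrema:
  fixes X :: "real \<Rightarrow> real"
  assumes cont: "continuous_on UNIV X" and "0 < T" and per: "\<And>t. X (t + T) = X t"
  obtains m M where "\<And>t. X m \<le> X t" "\<And>t. X t \<le> X M"
proof -
  have reduce: "\<exists>s\<in>{0..T}. X t = X s" for t
  proof -
    have "X (t + of_int (- \<lfloor>t / T\<rfloor>) * T) = X t" by (rule periodic_int[of X T, OF per])
    moreover have "t + of_int (- \<lfloor>t / T\<rfloor>) * T \<in> {0..T}"
      using floor_divide_lower[OF \<open>0 < T\<close>, of t] floor_divide_upper[OF \<open>0 < T\<close>, of t]
      by (simp add: algebra_simps)
    ultimately show ?thesis by metis
  qed
  have "continuous_on {0..T} X" using cont continuous_on_subset by blast
  moreover have "{0..T} \<noteq> {}" using \<open>0 < T\<close> by simp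
  ultimately obtain m M where "\<forall>s\<in>{0..T}. X m \<le> X s" "\<forall>s\<in>{0..T}. X s \<le> X M"
    using continuous_attains_inf[of "{0..T}" X] continuous_attains_sup[of "{0..T}" X] by auto
  thus thesis
    using that[of m M] reduce by metis
qed

section \<open>Phase-line analysis of the Weierstrass equation\<close>

locale cubic_ode =
  fixes r1 r2 r3 g2 g3 :: real
  assumes roots_less: "r3 < r2" "r2 < r1"
    and factor: "\<And>v. 4 * v ^ 3 - g2 * v - g3 = 4 * (v - r1) * (v - r2) * (v - r3)"
begin

text \<open>The expression is half the derivative of the cubic, so it cannot vanish at a simple
  root; along a solution it is the acceleration.\<close>

lemma simple_roots: "v \<in> {r1, r2, r3} \<Longrightarrow> 6 * v\<^sup>2 - g2 / 2 \<noteq> 0"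
proof -
  assume v: "v \<in> {r1, r2, r3}"
  \<comment> \<open>Values at 0, 1 and -1 suffice to compare coefficients: the roots sum to zero,
    and \<open>g2\<close> is minus four times their second symmetric function.\<close>
  have sums: "r1 + r2 + r3 = 0" "g2 = - 4 * (r1 * r2 + r1 * r3 + r2 * r3)"
    using factor[of 0] factor[of 1] factor[of "-1"] by (simp_all add: algebra_simps)
  hence r3: "r3 = - r1 - r2" by simp
  have g2: "g2 = 4 * (r1\<^sup>2 + r1 * r2 + r2\<^sup>2)"
    unfolding sums(2) r3 by (simp add: power2_eq_square algebra_simps)
  have "6 * r1\<^sup>2 - g2 / 2 = 2 * ((r1 - r2) * (r1 - r3))" "6 * r2\<^sup>2 - g2 / 2 = 2 * ((r2 - r1) * (r2 - r3))"
    "6 * r3\<^sup>2 - g2 / 2 = 2 * ((r3 - r1) * (r3 - r2))"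
    unfolding g2 r3 by (simp_all add: power2_eq_square algebra_simps)
  thus ?thesis using v roots_less by auto
qed

lemma cubic_zero: "4 * v ^ 3 - g2 * v - g3 = 0 \<longleftrightarrow> v \<in> {r1, r2, r3}"
  unfolding factor by auto

lemma cubic_nonneg:
  assumes "0 \<le> 4 * v ^ 3 - g2 * v - g3"
  shows "r3 \<le> v \<and> v \<le> r2 \<or> r1 \<le> v"
proof (rule ccontr)
  assume "\<not> ?thesis"
  hence "v < r3 \<or> r2 < v \<and> v < r1" by auto
  hence "(v - r1) * (v - r2) * (v - r3) < 0"
    using roots_less by (auto simp: mult_less_0_iff zero_less_mult_iff)
  thus False using assms unfolding factor by simp
qed

text \<open>The velocity is a separate argument so that initial data can be matched. The second
  equation does not follow from the third at turning points, and the third fixes \<open>g3\<close>,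
  which does not occur in the second.\<close>

definition solution :: "(real \<Rightarrow> real) \<Rightarrow> (real \<Rightarrow> real) \<Rightarrow> bool" where
  "solution X X1 \<longleftrightarrow> (\<forall>t. (X has_real_derivative X1 t) (at t) \<and>
     (X1 has_real_derivative 6 * (X t)\<^sup>2 - g2 / 2) (at t) \<and>
     (X1 t)\<^sup>2 = 4 * X t ^ 3 - g2 * X t - g3)"

lemma solutionD:
  assumes "solution X X1"
  shows "(X has_real_derivative X1 t) (at t)" "(X1 has_real_derivative 6 * (X t)\<^sup>2 - g2 / 2) (at t)"
    "(X1 t)\<^sup>2 = 4 * X t ^ 3 - g2 * X t - g3"
  using assms by (auto simp: solution_def)

lemma solution_continuous: "solution X X1 \<Longrightarrow> continuous_on A X" "solution X X1 \<Longrightarrow> continuous_on A X1"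
  using solutionD(1,2) by (meson DERIV_isCont continuous_at_imp_continuous_on)+

lemma solution_critical: "solution X X1 \<Longrightarrow> X1 t = 0 \<Longrightarrow> X t \<in> {r1, r2, r3}"
  using solutionD(3)[of X X1 t] cubic_zero by simp

lemma solution_range: "solution X X1 \<Longrightarrow> r3 \<le> X t \<and> X t \<le> r2 \<or> r1 \<le> X t"
  using solutionD(3)[of X X1 t] cubic_nonneg[of "X t"] by (metis zero_le_power2)

text \<open>A constant solution would sit at a root of the cubic, where the acceleration is not
  zero.\<close>

lemma solution_not_constant:
  assumes "solution X X1" "\<And>t. X t = v"
  shows False
proof -
  have "X = (\<lambda>t. v)" using assms(2) by auto
  hence "X1 t = 0" for t
    using solutionD(1)[OF assms(1), of t] DERIV_const DERIV_unique by blast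
  moreover from this have "X1 = (\<lambda>t. 0)" by auto
  hence "6 * (X 0)\<^sup>2 - g2 / 2 = 0"
    using solutionD(2)[OF assms(1), of 0] DERIV_const DERIV_unique by blast
  ultimately show False
    using simple_roots solution_critical[OF assms(1)] by blast
qed

lemma solution_shift:
  assumes "solution X X1"
  shows "solution (\<lambda>t. X (t + c)) (\<lambda>t. X1 (t + c))"
  unfolding solution_def
proof (intro allI conjI)
  fix t
  show "((\<lambda>t. X (t + c)) has_real_derivative X1 (t + c)) (at t)"
    "((\<lambda>t. X1 (t + c)) has_real_derivative 6 * (X (t + c))\<^sup>2 - g2 / 2) (at t)"
    "(X1 (t + c))\<^sup>2 = 4 * X (t + c) ^ 3 - g2 * X (t + c) - g3"
    using solutionD[OF assms, of "t + c"] by (simp_all add: DERIV_shift)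
qed

lemma solution_reflect: "solution X X1 \<Longrightarrow> solution (\<lambda>t. X (c - t)) (\<lambda>t. - X1 (c - t))"
proof -
  assume sol: "solution X X1"
  have "((\<lambda>t. X (c - t)) has_real_derivative X1 (c - t) * (- 1)) (at t)"
    "((\<lambda>t. X1 (c - t)) has_real_derivative (6 * (X (c - t))\<^sup>2 - g2 / 2) * (- 1)) (at t)" for t
    by (rule DERIV_chain2[OF solutionD(1)[OF sol]] DERIV_chain2[OF solutionD(2)[OF sol]];
        auto intro!: derivative_eq_intros)+
  from this(1) DERIV_minus[OF this(2)] show ?thesis
    using solutionD(3)[OF sol] by (simp add: solution_def)
qed

text \<open>The bound by \<open>r2\<close> confines both solutions to \<open>{r3..r2}\<close>, and
  on this interval the quadratic right-hand side is Lipschitz.\<close>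

lemma solution_unique:
  assumes sol: "solution X X1" "solution Y Y1" and bound: "\<And>t. X t \<le> r2" "\<And>t. Y t \<le> r2"
    and init: "X a = Y a" "X1 a = Y1 a"
  shows "X t = Y t"
proof -
  define M where "M = max \<bar>r2\<bar> \<bar>r3\<bar>"
  have lip: "\<bar>6 * (X t)\<^sup>2 - g2 / 2 - (6 * (Y t)\<^sup>2 - g2 / 2)\<bar> \<le> 12 * M * \<bar>X t - Y t\<bar>" for t
  proof -
    have "r3 \<le> X t" "r3 \<le> Y t"
      using solution_range[OF sol(1), of t] solution_range[OF sol(2), of t] roots_less by linarith+
    hence "\<bar>X t\<bar> \<le> M" "\<bar>Y t\<bar> \<le> M"
      using bound[of t] by (auto simp: M_def)
    hence "\<bar>X t + Y t\<bar> * \<bar>X t - Y t\<bar> \<le> 2 * M * \<bar>X t - Y t\<bar>"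
      by (intro mult_right_mono) auto
    moreover have "6 * (X t)\<^sup>2 - g2 / 2 - (6 * (Y t)\<^sup>2 - g2 / 2) = 6 * ((X t + Y t) * (X t - Y t))"
      by (simp add: power2_eq_square algebra_simps)
    ultimately show ?thesis by (simp add: abs_mult mult_ac)
  qed
  have "0 \<le> 12 * M" by (simp add: M_def)
  from second_order_unique[OF solutionD(1,2)[OF sol(1)] solutionD(1,2)[OF sol(2)] lip init this]
  show ?thesis .
qed

text \<open>If the velocity had no zero from \<open>T\<close> on, it would keep its sign and
  \<open>X\<close> would converge monotonically to some \<open>L\<close>. By the first integral the
  velocity would converge too, so velocity and acceleration would both tend to 0 and
  \<open>L\<close> would be a multiple root.\<close>

lemma critical_points_unbounded:
  assumes sol: "solution X X1" and bound: "\<And>t. X t \<le> r2"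
  obtains p where "T \<le> p" "X1 p = 0"
proof (rule ccontr)
  assume "\<not> thesis"
  with that have ne: "X1 t \<noteq> 0" if "T \<le> t" for t using \<open>T \<le> t\<close> by blast
  have sign: "(\<forall>t\<ge>T. 0 < X1 t) \<or> (\<forall>t\<ge>T. X1 t < 0)"
  proof (rule ccontr)
    assume "\<not> ?thesis"
    then obtain s t where st: "T \<le> s" "X1 s \<le> 0" "T \<le> t" "0 \<le> X1 t" by (auto simp: not_less)
    have "connected (X1 ` {T..})"
      by (intro connected_continuous_image solution_continuous[OF sol]) auto
    hence "0 \<in> X1 ` {T..}"
      using st by (meson atLeast_iff connectedD_interval image_eqI)
    thus False using ne by auto
  qed
  have lower: "r3 \<le> X t" for t
    using solution_range[OF sol, of t] roots_less by linarith
  obtain L where L: "(X \<longlongrightarrow> L) at_top"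
  proof (cases "\<forall>t\<ge>T. 0 < X1 t")
    case True
    thus thesis
      using bounded_increasing_converges[of T X X1 r2] solutionD(1)[OF sol] bound that by (metis less_imp_le)
  next
    case False
    hence neg: "\<forall>t\<ge>T. X1 t < 0" using sign by blast
    obtain L where "((\<lambda>t. - X t) \<longlongrightarrow> L) at_top"
    proof (rule bounded_increasing_converges[of T "\<lambda>t. - X t" "\<lambda>t. - X1 t" "- r3"])
      show "((\<lambda>t. - X t) has_real_derivative - X1 t) (at t)" for t
        by (rule DERIV_minus[OF solutionD(1)[OF sol]])
    qed (use neg lower in \<open>auto intro: less_imp_le\<close>)
    from tendsto_minus[OF this] show thesis by (intro that[of "- L"]) simp
  qed
  \<comment> \<open>\<open>\<sigma>\<close> is the constant sign of the velocity. It selects the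
    branch of the square root in the first integral and thereby gives \<open>X1\<close> a
    limit.\<close>
  obtain \<sigma> :: real where \<sigma>: "\<bar>\<sigma>\<bar> = 1" "\<forall>t\<ge>T. X1 t = \<sigma> * \<bar>X1 t\<bar>"
  proof (cases "\<forall>t\<ge>T. 0 < X1 t")
    case True
    thus thesis by (intro that[of 1]) auto
  next
    case False
    hence "\<forall>t\<ge>T. X1 t < 0" using sign by blast
    thus thesis by (intro that[of "- 1"]) auto
  qed
  let ?P = "\<lambda>v. 4 * v ^ 3 - g2 * v - g3"
  have "((\<lambda>t. \<sigma> * sqrt (?P (X t))) \<longlongrightarrow> \<sigma> * sqrt (?P L)) at_top"
    by (intro tendsto_intros L)
  moreover have "sqrt (?P (X t)) = \<bar>X1 t\<bar>" for t
    using solutionD(3)[OF sol, of t] by (metis real_sqrt_abs)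
  ultimately have "((\<lambda>t. \<sigma> * \<bar>X1 t\<bar>) \<longlongrightarrow> \<sigma> * sqrt (?P L)) at_top" by simp
  hence X1: "(X1 \<longlongrightarrow> \<sigma> * sqrt (?P L)) at_top"
    by (rule Lim_transform_eventually) (use \<sigma>(2) in \<open>auto intro!: eventually_at_top_linorderI[of T]\<close>)
  hence 0: "\<sigma> * sqrt (?P L) = 0"
    by (rule limit_of_derivative_zero[OF solutionD(1)[OF sol] L])
  hence "?P L = 0" using \<sigma>(1) by auto
  have "((\<lambda>t. 6 * (X t)\<^sup>2 - g2 / 2) \<longlongrightarrow> 6 * L\<^sup>2 - g2 / 2) at_top"
    by (intro tendsto_intros L)
  hence "6 * L\<^sup>2 - g2 / 2 = 0"
    by (rule limit_of_derivative_zero[OF solutionD(2)[OF sol] X1])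
  thus False
    using simple_roots cubic_zero \<open>?P L = 0\<close> by blast
qed

text \<open>Reflections in two critical points \<open>p\<close> and \<open>q\<close> both preserve
  the solution, and they compose to the translation by \<open>2 * (q - p)\<close>.\<close>

lemma solution_periodic:
  assumes sol: "solution X X1" and bound: "\<And>t. X t \<le> r2"
  obtains T where "0 < T" "\<And>t. X (t + T) = X t"
proof -
  have reflect: "X (2 * p - t) = X t" if "X1 p = 0" for p t
  proof (rule solution_unique[OF solution_reflect[OF sol] sol])
    show "X (2 * p - p) = X p" "- X1 (2 * p - p) = X1 p" using that by simp_all
  qed (rule bound)+
  obtain p where p: "X1 p = 0" using critical_points_unbounded[OF sol bound] by metis
  \<comment> \<open>The offset 1 keeps the second critical point away from the first, so that the
    period is positive.\<close>
  obtain q where q: "p + 1 \<le> q" "X1 q = 0" using critical_points_unbounded[OF sol bound] by metis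
  show thesis
  proof (rule that[of "2 * (q - p)"])
    show "0 < 2 * (q - p)" using q by simp
    show "X (t + 2 * (q - p)) = X t" for t
      using reflect[OF q(2), of "2 * p - t"] reflect[OF p, of t] by (simp add: algebra_simps)
  qed
qed

lemma extremum_critical:
  assumes "solution X X1"
  shows "(\<And>t. X t \<le> X m) \<Longrightarrow> X1 m = 0" "(\<And>t. X m \<le> X t) \<Longrightarrow> X1 m = 0"
  using DERIV_local_max[OF solutionD(1)[OF assms], of 1 m] DERIV_local_min[OF solutionD(1)[OF assms], of 1 m]
  by auto

text \<open>This finds the band of the Weierstrass function without evaluating it. A periodic
  solution attains its maximum, and the maximum is a root; were it \<open>r1\<close>, the forbidden
  gap between \<open>r2\<close> and \<open>r1\<close> would make the solution constant.\<close>

lemma periodic_solution_bounded: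
  assumes sol: "solution X X1" and per: "0 < T" "\<And>t. X (t + T) = X t"
  shows "X t \<le> r2"
proof -
  obtain M where M: "\<And>t. X t \<le> X M"
    using periodic_attains_extrema[OF solution_continuous(1)[OF sol] per] by metis
  have "X M \<in> {r1, r2, r3}"
    by (rule solution_critical[OF sol extremum_critical(1)[OF sol M]])
  moreover have "X M \<noteq> r1"
  proof
    assume top: "X M = r1"
    have "X s = r1" for s
    proof (rule ccontr)
      assume "X s \<noteq> r1"
      hence "X s \<le> r2" using solution_range[OF sol, of s] M[of s] top by auto
      have "connected (range X)"
        by (intro connected_continuous_image solution_continuous[OF sol]) auto
      moreover have "X s \<le> (r1 + r2) / 2" "(r1 + r2) / 2 \<le> X M"
        using \<open>X s \<le> r2\<close> top roots_less by (simp_all add: field_simps)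
      ultimately have "(r1 + r2) / 2 \<in> range X"
        by (rule connectedD_interval[OF _ rangeI rangeI])
      then obtain u where "X u = (r1 + r2) / 2" by auto
      thus False using solution_range[OF sol, of u] roots_less by auto
    qed
    thus False using solution_not_constant[OF sol] by blast
  qed
  ultimately show ?thesis using M[of t] roots_less by auto
qed

lemma solution_attains:
  assumes sol: "solution X X1" and bound: "\<And>t. X t \<le> r2"
  obtains p q where "X p = r3" "X1 p = 0" "X q = r2" "X1 q = 0"
proof -
  obtain T where T: "0 < T" "\<And>t. X (t + T) = X t"
    using solution_periodic[OF sol bound] by blast
  obtain m M where m: "\<And>t. X m \<le> X t" and M: "\<And>t. X t \<le> X M"
    using periodic_attains_extrema[OF solution_continuous(1)[OF sol] T] by metis
  have X1: "X1 m = 0" "X1 M = 0"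
    using extremum_critical[OF sol] m M by blast+
  have vals: "X m \<in> {r2, r3}" "X M \<in> {r2, r3}"
    using solution_critical[OF sol] X1 bound[of m] bound[of M] roots_less by fastforce+
  have "X m \<noteq> X M"
    using solution_not_constant[OF sol, of "X m"] m M by (metis order_antisym)
  hence "X m = r3" "X M = r2"
    using vals m[of M] roots_less by auto
  thus thesis using that X1 by blast
qed

lemma solutions_translates:
  assumes "solution X X1" "\<And>t. X t \<le> r2" "solution Y Y1" "\<And>t. Y t \<le> r2"
  obtains c where "\<And>t. X t = Y (t + c)"
proof -
  obtain p where p: "X p = r3" "X1 p = 0" using solution_attains[OF assms(1,2)] by metis
  obtain q where q: "Y q = r3" "Y1 q = 0" using solution_attains[OF assms(3,4)] by metis
  show thesis
  \<comment> \<open>The shift aligns a minimum of \<open>Y\<close> with a minimum of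
    \<open>X\<close>; both velocities vanish there.\<close>
  proof (rule that[of "q - p"])
    show "X t = Y (t + (q - p))" for t
      by (rule solution_unique[OF assms(1) solution_shift[OF assms(3)] assms(2), where a = p])
         (use assms(4) p q in auto)
  qed
qed

end

section \<open>Prolonging the scale function\<close>

text \<open>The set where the second-order equation holds is open and closed: it contains every moving point,
  and as the zeros of \<open>F\<close> are simple, its points at rest are isolated among the points at rest. In particular a
  smooth solution cannot linger at a turning point.\<close>

lemma first_integral_imp_second_order:
  fixes s s1 s2 F F' :: "real \<Rightarrow> real"
  assumes I: "open I" "connected I"
    and s: "\<And>t. t \<in> I \<Longrightarrow> (s has_real_derivative s1 t) (at t)"
    and s1: "\<And>t. t \<in> I \<Longrightarrow> (s1 has_real_derivative s2 t) (at t)"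
    and s2: "continuous_on I s2"
    and first: "\<And>t. t \<in> I \<Longrightarrow> (s1 t)\<^sup>2 = F (s t)"
    and F: "\<And>t. t \<in> I \<Longrightarrow> (F has_real_derivative F' (s t)) (at (s t))"
    and F': "continuous_on I (\<lambda>t. F' (s t))"
    and simple: "\<And>t. t \<in> I \<Longrightarrow> F (s t) = 0 \<Longrightarrow> F' (s t) \<noteq> 0"
    and nonconst: "\<exists>t\<in>I. s1 t \<noteq> 0"
    and t: "t \<in> I"
  shows "s2 t = F' (s t) / 2"
proof -
  define B where "B = {t \<in> I. s2 t = F' (s t) / 2}"
  \<comment> \<open>The first integral is differentiated in two ways, and the common factor
    \<open>s1 u\<close> cancels.\<close>
  have moving: "u \<in> B" if u: "u \<in> I" "s1 u \<noteq> 0" for u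
  proof -
    have "((\<lambda>t. (s1 t)\<^sup>2) has_real_derivative 2 * s1 u * s2 u) (at u)"
      using s1[OF u(1)] by (auto intro!: derivative_eq_intros)
    hence "((\<lambda>t. F (s t)) has_real_derivative 2 * s1 u * s2 u) (at u)"
      by (rule has_field_derivative_transform_within_open[OF _ I(1) u(1)]) (rule first)
    moreover have "((\<lambda>t. F (s t)) has_real_derivative F' (s u) * s1 u) (at u)"
      by (rule DERIV_chain2[OF F[OF u(1)] s[OF u(1)]])
    ultimately have "2 * s1 u * s2 u = F' (s u) * s1 u"
      by (rule DERIV_unique)
    thus ?thesis using u by (simp add: B_def)
  qed
  have "\<exists>W. open W \<and> u \<in> W \<and> W \<subseteq> B" if "u \<in> B" for u
  proof -
    have u: "u \<in> I" using that by (simp add: B_def)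
    have "\<forall>\<^sub>F v in at u. s1 v \<noteq> 0"
    proof (cases "s1 u = 0")
      case True
      \<comment> \<open>At rest the first integral makes \<open>s u\<close> a zero of
        \<open>F\<close>. It is simple, so the acceleration is nonzero and nearby points are
        moving.\<close>
      hence "s2 u \<noteq> 0"
        using that first[OF u] simple[OF u] by (auto simp: B_def)
      moreover have "((\<lambda>v. (s1 v - s1 u) / (v - u)) \<longlongrightarrow> s2 u) (at u)"
        using s1[OF u] by (simp add: has_field_derivative_iff)
      ultimately have "\<forall>\<^sub>F v in at u. (s1 v - s1 u) / (v - u) \<noteq> 0"
        by (intro tendsto_imp_eventually_ne)
      thus ?thesis by eventually_elim (use True in auto)
    next
      case False
      thus ?thesis
        using DERIV_isCont[OF s1[OF u]] by (intro tendsto_imp_eventually_ne) (simp add: isCont_def)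
    qed
    then obtain W where "open W" "u \<in> W" "\<And>v. v \<in> W \<Longrightarrow> v \<noteq> u \<Longrightarrow> s1 v \<noteq> 0"
      unfolding eventually_at_topological by blast
    hence "open (W \<inter> I)" "u \<in> W \<inter> I" "W \<inter> I \<subseteq> B"
      using I(1) u moving that by auto
    thus ?thesis by blast
  qed
  hence "open B" by (subst open_subopen) blast
  hence "openin (top_of_set I) B"
    by (metis (no_types, lifting) B_def mem_Collect_eq openin_open_eq[OF I(1)] subsetI)
  moreover have "closedin (top_of_set I) B"
  proof -
    have "continuous_on I (\<lambda>t. s2 t - F' (s t) / 2)"
      by (intro continuous_intros s2 F') auto
    from continuous_closedin_preimage_constant[OF this, of 0] show ?thesis
      by (simp add: B_def)
  qed
  moreover have "B \<noteq> {}" using nonconst moving by blast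
  ultimately have "B = I" using I(2) connected_clopen by blast
  thus ?thesis using t by (auto simp: B_def)
qed

text \<open>No differential equation has to be solved to prolong \<open>S\<close> past a finite end \<open>b\<close>: its derivative extends
  continuously to \<open>b\<close>, and an antiderivative of the extension by a constant does the job.\<close>

lemma maximal_domain_not_bdd_above:
  fixes S S1 S2 :: "real \<Rightarrow> real"
  assumes J: "open_interval J" and max: "maximal_domain J S"
    and S: "\<And>y. y \<in> J \<Longrightarrow> (S has_real_derivative S1 y) (at y)"
    and S1: "\<And>y. y \<in> J \<Longrightarrow> (S1 has_real_derivative S2 y) (at y)"
    and S2: "\<And>y. y \<in> J \<Longrightarrow> \<bar>S2 y\<bar> \<le> B"
    and c: "0 < c" "\<And>y. y \<in> J \<Longrightarrow> c \<le> S y"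
  shows "\<not> bdd_above J"
proof
  assume bdd: "bdd_above J"
  have J': "open J" "is_interval J" "J \<noteq> {}" using J by (auto simp: open_interval_def)
  obtain c0 where c0: "c0 \<in> J" using J' by blast
  define b where "b = Sup J"
  have le_b: "y \<le> b" if "y \<in> J" for y using that bdd by (simp add: b_def cSup_upper)
  have b_notin: "b \<notin> J"
  proof
    assume "b \<in> J"
    then obtain e where "0 < e" "ball b e \<subseteq> J" using J'(1) open_contains_ball by blast
    hence "b + e / 2 \<in> J" by (auto simp: dist_real_def subset_iff)
    thus False using le_b \<open>0 < e\<close> by fastforce
  qed
  have c0_b: "c0 < b" using le_b[OF c0] b_notin c0 by (metis less_eq_real_def)
  have in_J: "y \<in> J" if "c0 \<le> y" "y < b" for y
  proof -
    have "\<exists>z\<in>J. y < z" using that less_cSup_iff[OF J'(3) bdd] by (auto simp: b_def)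
    then obtain z where "z \<in> J" "y < z" by blast
    thus ?thesis using mem_is_interval_1_I[OF J'(2) c0, of z y] that by simp
  qed
  \<comment> \<open>The bound on the second derivative enters here: a Lipschitz derivative is
    uniformly continuous and so extends to the closure of \<open>J\<close>, which contains
    \<open>b\<close>.\<close>
  have "B-lipschitz_on J S1"
  proof (rule lipschitz_onI)
    show "0 \<le> B" using S2[OF c0] by linarith
    show "dist (S1 x) (S1 y) \<le> B * dist x y" if "x \<in> J" "y \<in> J" for x y
      using field_differentiable_bound[of J S1 S2 B x y] that S1 S2 J'(2)
      by (auto simp: dist_norm is_interval_convex_1 has_field_derivative_at_within)
  qed
  hence "uniformly_continuous_on J S1" by (rule lipschitz_on_uniformly_continuous)
  then obtain g where g: "uniformly_continuous_on (closure J) g" "\<And>x. x \<in> J \<Longrightarrow> S1 x = g x"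
    using uniformly_continuous_on_extension_on_closure by metis
  have b_closure: "b \<in> closure J" using closure_contains_Sup[OF J'(3) bdd] by (simp add: b_def)
  define h where "h = (\<lambda>y. g (min y b))"
  have h_cont: "continuous_on {c0..b + 1} h"
    unfolding h_def
  proof (rule continuous_on_compose2[OF uniformly_continuous_imp_continuous[OF g(1)]])
    show "(\<lambda>y. min y b) ` {c0..b + 1} \<subseteq> closure J"
    proof (rule image_subsetI)
      fix y assume "y \<in> {c0..b + 1}"
      thus "min y b \<in> closure J"
        using in_J[of y] closure_subset[of J] b_closure by (cases "y < b") (auto simp: min_def)
    qed
  qed (intro continuous_intros)
  have h_J: "h y = S1 y" if "c0 \<le> y" "y < b" for y
    using that in_J g(2) by (simp add: h_def)
  define F where "F = (\<lambda>y. S c0 + integral {c0..y} h)"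
  have F_deriv: "(F has_real_derivative h y) (at y)" if "c0 < y" "y < b + 1" for y
  proof -
    have "((\<lambda>y. integral {c0..y} h) has_real_derivative h y) (at y within {c0..b + 1})"
      using integral_has_real_derivative[OF h_cont] that by auto
    hence "((\<lambda>y. integral {c0..y} h) has_real_derivative h y) (at y)"
      using that by (simp add: at_within_Icc_at)
    thus ?thesis unfolding F_def by (auto intro!: derivative_eq_intros)
  qed
  have F_S: "F y = S y" if "c0 \<le> y" "y < b" for y
  proof -
    have "(h has_integral S y - S c0) {c0..y}"
    proof (rule fundamental_theorem_of_calculus[OF that(1)])
      fix x assume x: "x \<in> {c0..y}"
      hence "(S has_real_derivative h x) (at x)"
        using S[of x] in_J[of x] h_J[of x] that by auto
      thus "(S has_vector_derivative h x) (at x within {c0..y})"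
        by (simp add: has_real_derivative_iff_has_vector_derivative has_vector_derivative_at_within)
    qed
    thus ?thesis unfolding F_def by (simp add: integral_unique)
  qed
  \<comment> \<open>Just left of \<open>b\<close> the function \<open>F\<close> agrees with
    \<open>S\<close>, which is at least \<open>c\<close>; a tolerance of \<open>c / 2\<close>
    therefore keeps \<open>F\<close> positive on both sides of \<open>b\<close>.\<close>
  have "isCont F b" using F_deriv[of b] c0_b by (auto intro: DERIV_isCont)
  then obtain d where d: "0 < d" "\<And>y. \<bar>y - b\<bar> < d \<Longrightarrow> \<bar>F y - F b\<bar> < c / 2"
    using c(1) unfolding continuous_at_eps_delta dist_real_def by (metis half_gt_zero)
  have F_pos: "0 < F y" if "\<bar>y - b\<bar> < d" for y
  proof -
    define z where "z = max c0 (b - d / 2)"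
    have "c0 \<le> z" "z < b" "\<bar>z - b\<bar> < d" using c0_b d(1) by (auto simp: z_def max_def)
    hence "c \<le> F z" "\<bar>F z - F b\<bar> < c / 2"
      using F_S[of z] c(2)[OF in_J, of z] d(2)[of z] by auto
    thus ?thesis using d(2)[OF that] by linarith
  qed
  \<comment> \<open>The cap 1 stays inside the interval on which the derivative of \<open>F\<close>
    is known.\<close>
  define e where "e = min d 1"
  define J1 where "J1 = J \<union> {c0<..<b + e}"
  define S' where "S' = (\<lambda>y. if y < b then S y else F y)"
  have e: "0 < e" "e \<le> d" "e \<le> 1" using d(1) by (auto simp: e_def)
  have J1: "open_interval J1"
    unfolding open_interval_def
  proof (intro conjI)
    show "open J1" using J'(1) by (auto simp: J1_def)
    have "(c0 + b) / 2 \<in> J \<inter> {c0<..<b + e}" using in_J[of "(c0 + b) / 2"] c0_b e by auto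
    hence "connected J1"
      unfolding J1_def using J'(2) by (intro connected_Un) (auto simp: is_interval_connected_1)
    thus "is_interval J1" by (simp add: is_interval_connected_1)
    show "J1 \<noteq> {}" using c0 by (auto simp: J1_def)
  qed
  have "b \<in> J1" using c0_b e by (simp add: J1_def)
  hence sub: "J \<subset> J1" using b_notin by (auto simp: J1_def)
  have "0 \<le> S' y \<and> S' differentiable (at y)" if y: "y \<in> J1" for y
  proof (cases "y < b")
    case True
    hence yJ: "y \<in> J" using y in_J[of y] by (auto simp: J1_def)
    have "(S' has_real_derivative S1 y) (at y)"
      by (rule has_field_derivative_transform_within_open[OF S[OF yJ], of "{..<b}"])
         (use True in \<open>auto simp: S'_def\<close>)
    thus ?thesis
      using c(1) c(2)[OF yJ] True by (auto simp: S'_def real_differentiable_def)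
  next
    case False
    hence "y \<notin> J" using le_b b_notin by (metis less_eq_real_def)
    hence y: "c0 < y" "y < b + e" using y by (auto simp: J1_def)
    hence "0 < F y" using False e by (intro F_pos) auto
    have "y < b + 1" using y e by linarith
    have "(S' has_real_derivative h y) (at y)"
      by (rule has_field_derivative_transform_within_open[OF F_deriv[OF y(1) \<open>y < b + 1\<close>], of "{c0<..<b + 1}"])
         (use y e F_S in \<open>auto simp: S'_def\<close>)
    thus ?thesis
      using \<open>0 < F y\<close> False by (auto simp: S'_def real_differentiable_def)
  qed
  moreover have "S' y = S y" if "y \<in> J" for y
    using le_b[OF that] b_notin that by (auto simp: S'_def)
  ultimately have "open_interval J1 \<and> J \<subset> J1 \<and> (\<forall>y\<in>J1. 0 \<le> S' y \<and> S' differentiable (at y)) \<and> (\<forall>y\<in>J. S' y = S y)"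
    using J1 sub by simp
  thus False
    using max unfolding maximal_domain_def by (elim notE, intro exI[of _ J1] exI[of _ S'])
qed

lemma open_interval_uminus:
  assumes "open_interval J"
  shows "open_interval (uminus ` J)"
  using assms unfolding open_interval_def
  by (auto simp: is_interval_connected_1 open_negations intro!: connected_continuous_image continuous_intros)

text \<open>Reflection in the origin carries the argument for the upper end of the domain over to
  the lower end.\<close>

lemma maximal_domain_uminus:
  assumes "maximal_domain J S"
  shows "maximal_domain (uminus ` J) (\<lambda>y. S (- y))"
  unfolding maximal_domain_def
proof (rule notI, elim exE conjE)
  fix J' S' assume *: "open_interval J'" "uminus ` J \<subset> J'"
    "\<forall>y\<in>J'. 0 \<le> S' y \<and> S' differentiable (at y)" "\<forall>y\<in>uminus ` J. S' y = S (- y)"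
  have "J \<subset> uminus ` J'"
    using *(2) by (force simp: psubset_eq image_iff)
  moreover have "(\<lambda>y. S' (- y)) differentiable (at y)" if "- y \<in> J'" for y
  proof -
    have "S' differentiable (at (- y))" using *(3) that by blast
    then obtain D where "(S' has_real_derivative D) (at (- y))"
      by (auto simp: real_differentiable_def)
    hence "((\<lambda>y. S' (- y)) has_real_derivative - D) (at y)"
      by (simp add: DERIV_mirror)
    thus ?thesis by (auto simp: real_differentiable_def)
  qed
  ultimately have "open_interval (uminus ` J') \<and> J \<subset> uminus ` J' \<and>
      (\<forall>y\<in>uminus ` J'. 0 \<le> S' (- y) \<and> (\<lambda>y. S' (- y)) differentiable (at y)) \<and> (\<forall>y\<in>J. S' (- y) = S y)"
    using * open_interval_uminus by auto
  thus False
    using assms unfolding maximal_domain_def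
    by (elim notE, intro exI[of _ "uminus ` J'"] exI[of _ "\<lambda>y. S' (- y)"])
qed

lemma maximal_domain_eq_UNIV:
  fixes S S1 S2 :: "real \<Rightarrow> real"
  assumes J: "open_interval J" and max: "maximal_domain J S"
    and S: "\<And>y. y \<in> J \<Longrightarrow> (S has_real_derivative S1 y) (at y)"
    and S1: "\<And>y. y \<in> J \<Longrightarrow> (S1 has_real_derivative S2 y) (at y)"
    and S2: "\<And>y. y \<in> J \<Longrightarrow> \<bar>S2 y\<bar> \<le> B"
    and c: "0 < c" "\<And>y. y \<in> J \<Longrightarrow> c \<le> S y"
  shows "J = UNIV"
proof -
  have above: "\<not> bdd_above J" by (rule maximal_domain_not_bdd_above[OF assms])
  have "\<not> bdd_above (uminus ` J)"
  proof (rule maximal_domain_not_bdd_above[OF open_interval_uminus[OF J] maximal_domain_uminus[OF max]])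
    fix y assume "y \<in> uminus ` J"
    hence y: "- y \<in> J" by auto
    show "((\<lambda>y. S (- y)) has_real_derivative - S1 (- y)) (at y)"
      using S[OF y] by (simp add: DERIV_mirror)
    have "((\<lambda>y. S1 (- y)) has_real_derivative - S2 (- y)) (at y)"
      using S1[OF y] by (simp add: DERIV_mirror)
    from DERIV_minus[OF this] show "((\<lambda>y. - S1 (- y)) has_real_derivative S2 (- y)) (at y)" by simp
    show "\<bar>S2 (- y)\<bar> \<le> B" "c \<le> S (- y)" using y S2 c(2) by auto
  qed (rule c(1))
  hence below: "\<not> bdd_below J" by (simp add: bdd_above_uminus)
  show ?thesis
  proof (intro equalityI subsetI UNIV_I)
    fix y :: real
    obtain u v where "u \<in> J" "y \<le> u" "v \<in> J" "v \<le> y"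
      using above below unfolding bdd_above_def bdd_below_def by (meson linear)
    thus "y \<in> J"
      using J mem_is_interval_1_I[of J v u y] by (auto simp: open_interval_def)
  qed
qed

section \<open>The Weierstrass function of a rectangular lattice\<close>

text \<open>Only the derivatives have a summable majorant; the terms themselves are summable at the
  single point \<open>z\<close>. The mean value inequality dominates the increments
  \<open>f a x - f a z\<close>, and a uniform limit of holomorphic sums may be
  differentiated.\<close>

lemma has_field_derivative_infsum:
  fixes f f' :: "'a \<Rightarrow> complex \<Rightarrow> complex"
  assumes r: "0 < r"
    and deriv: "\<And>a x. a \<in> A \<Longrightarrow> x \<in> ball z r \<Longrightarrow> (f a has_field_derivative f' a x) (at x)"
    and bound: "\<And>a x. a \<in> A \<Longrightarrow> x \<in> ball z r \<Longrightarrow> norm (f' a x) \<le> M a"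
    and M: "M summable_on A"
    and f_z: "(\<lambda>a. f a z) summable_on A"
  shows "((\<lambda>x. \<Sum>\<^sub>\<infinity>a\<in>A. f a x) has_field_derivative (\<Sum>\<^sub>\<infinity>a\<in>A. f' a z)) (at z)"
proof -
  define \<rho> where "\<rho> = r / 2"
  have \<rho>: "0 < \<rho>" and sub: "cball z \<rho> \<subseteq> ball z r"
    using r by (auto simp: \<rho>_def)
  have "ball z \<rho> \<subseteq> ball z r" and z: "z \<in> ball z \<rho>"
    using sub ball_subset_cball \<rho> by (blast, simp)
  define d where "d = (\<lambda>a x. f a x - f a z)"
  have d_bound: "norm (d a x) \<le> M a * \<rho>" if "a \<in> A" "x \<in> cball z \<rho>" for a x
  proof -
    have "norm (d a x) \<le> M a * norm (x - z)"
      unfolding d_def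
    proof (rule field_differentiable_bound[of "ball z r"])
      show "(f a has_field_derivative f' a y) (at y within ball z r)" if "y \<in> ball z r" for y
        using deriv \<open>a \<in> A\<close> that by (blast intro: has_field_derivative_at_within)
    qed (use that sub bound r in auto)
    also have "\<dots> \<le> M a * \<rho>"
    proof (rule mult_left_mono)
      show "0 \<le> M a"
        using bound[OF that(1), of z] r by (meson centre_in_ball norm_ge_zero order_trans)
    qed (use that in \<open>auto simp: dist_norm norm_minus_commute\<close>)
    finally show ?thesis .
  qed
  have d_summable: "(\<lambda>a. d a x) summable_on A" if "x \<in> cball z \<rho>" for x
    using Infinite_Sum.abs_summable_on_comparison_test'[where f = "\<lambda>a. d a x", OF summable_on_cmult_left[OF M] d_bound[OF _ that]]
    by (rule abs_summable_summable)
  have ulim: "uniform_limit (cball z \<rho>) (\<lambda>X x. \<Sum>a\<in>X. d a x) (\<lambda>x. \<Sum>\<^sub>\<infinity>a\<in>A. d a x) (finite_subsets_at_top A)"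
    by (rule Weierstrass_m_test_general[where M = "\<lambda>a. M a * \<rho>"])
       (use d_bound M in \<open>auto intro: summable_on_cmult_left\<close>)
  have d_deriv: "(d a has_field_derivative f' a x) (at x)" if "a \<in> A" "x \<in> cball z \<rho>" for a x
    unfolding d_def using deriv[OF that(1), of x] that sub by (auto intro!: derivative_eq_intros)
  have ev: "\<forall>\<^sub>F X in finite_subsets_at_top A. continuous_on (cball z \<rho>) (\<lambda>x. \<Sum>a\<in>X. d a x) \<and>
      (\<forall>x\<in>ball z \<rho>. ((\<lambda>x. \<Sum>a\<in>X. d a x) has_field_derivative (\<Sum>a\<in>X. f' a x)) (at x))"
  proof (rule eventually_finite_subsets_at_top_weakI)
    fix X assume "finite X" "X \<subseteq> A"
    thus "continuous_on (cball z \<rho>) (\<lambda>x. \<Sum>a\<in>X. d a x) \<and>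
      (\<forall>x\<in>ball z \<rho>. ((\<lambda>x. \<Sum>a\<in>X. d a x) has_field_derivative (\<Sum>a\<in>X. f' a x)) (at x))"
      using d_deriv by (intro conjI ballI continuous_on_sum DERIV_sum)
        (fastforce intro: continuous_at_imp_continuous_on DERIV_isCont)+
  qed
  obtain g' where g': "((\<lambda>x. \<Sum>\<^sub>\<infinity>a\<in>A. d a x) has_field_derivative g' z) (at z)"
      "((\<lambda>X. \<Sum>a\<in>X. f' a z) \<longlongrightarrow> g' z) (finite_subsets_at_top A)"
    using has_complex_derivative_uniform_limit[OF ev ulim _ \<rho>] z by (metis finite_subsets_at_top_neq_bot)
  have eq: "g' z = (\<Sum>\<^sub>\<infinity>a\<in>A. f' a z)"
    using g'(2) by (metis has_sum_def infsumI)
  have "((\<lambda>x. (\<Sum>\<^sub>\<infinity>a\<in>A. d a x) + (\<Sum>\<^sub>\<infinity>a\<in>A. f a z)) has_field_derivative g' z) (at z)"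
    using g'(1) by (auto intro!: derivative_eq_intros)
  thus ?thesis
    unfolding eq
  proof (rule has_field_derivative_transform_within_open[OF _ open_ball z])
    fix x assume "x \<in> ball z \<rho>"
    hence "(\<lambda>a. d a x) summable_on A" using d_summable by auto
    from infsum_add[OF this f_z]
    show "(\<Sum>\<^sub>\<infinity>a\<in>A. d a x) + (\<Sum>\<^sub>\<infinity>a\<in>A. f a z) = (\<Sum>\<^sub>\<infinity>a\<in>A. f a x)"
      by (simp add: d_def)
  qed
qed

section \<open>Absolute convergence over the lattice\<close>

lemma summable_on_int_powr:
  fixes s :: real
  assumes "1 < s"
  shows "(\<lambda>m::int. (1 + \<bar>m\<bar>) powr - s) summable_on UNIV"
proof -
  have "summable (\<lambda>n. real (n + 1) powr - s)"
    using assms summable_real_powr_iff[of "- s"] by (subst summable_iff_shift) auto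
  hence nat: "(\<lambda>n::nat. (1 + real n) powr - s) summable_on UNIV"
    by (intro norm_summable_imp_summable_on) (simp add: add_ac)
  have "(\<lambda>m::int. (1 + \<bar>m\<bar>) powr - s) summable_on (int ` UNIV)"
    using nat by (subst summable_on_reindex) (auto simp: o_def)
  moreover have "(\<lambda>m::int. (1 + \<bar>m\<bar>) powr - s) summable_on ((\<lambda>n. - int n) ` UNIV)"
    using nat by (subst summable_on_reindex) (auto simp: o_def inj_on_def)
  moreover have "int ` UNIV \<union> (\<lambda>n. - int n) ` UNIV = UNIV"
  proof -
    have "m \<in> int ` UNIV \<union> (\<lambda>n. - int n) ` UNIV" for m
      by (cases "0 \<le> m") (auto simp: image_iff intro: exI[of _ "nat \<bar>m\<bar>"])
    thus ?thesis by auto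
  qed
  ultimately show ?thesis
    using summable_on_union by metis
qed

lemma summable_on_int_times_int_powr:
  fixes s :: real
  assumes "1 < s"
  shows "(\<lambda>(m::int, n::int). ((1 + \<bar>m\<bar>) * (1 + \<bar>n\<bar>)) powr - s) summable_on UNIV"
proof -
  let ?f = "\<lambda>m::int. (1 + \<bar>m\<bar>) powr - s"
  have "(\<lambda>(m::int, n::int). ?f m * ?f n) summable_on (UNIV \<times> UNIV)"
  proof (rule summable_on_SigmaI)
    show "((\<lambda>n. case (m, n) of (m, n) \<Rightarrow> ?f m * ?f n) has_sum ?f m * infsum ?f UNIV) UNIV" for m
      using summable_on_int_powr[OF assms] by (auto intro: has_sum_cmult_right)
    show "(\<lambda>m. ?f m * infsum ?f UNIV) summable_on UNIV"
      using summable_on_int_powr[OF assms] by (rule summable_on_cmult_left)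
  qed auto
  thus ?thesis
    by (simp add: powr_mult)
qed

lemma one_plus_norm_pos: "0 < 1 + norm x"
  using norm_ge_zero[of x] by linarith

locale rectangular_lattice =
  fixes w :: real and w' :: complex
  assumes w: "0 < w" and w': "Re w' = 0" "0 < Im w'"
begin

definition L :: "complex set" where
  "L = period_lattice (of_real w) w'"

lemma lattice_point: "of_int m * (2 * of_real w) + of_int n * (2 * w') = Complex (2 * w * m) (2 * Im w' * n)"
  by (simp add: complex_eq_iff w'(1))

lemma L_eq: "L = range (\<lambda>(m::int, n::int). Complex (2 * w * m) (2 * Im w' * n))"
  unfolding L_def period_lattice_def lattice_point by auto

lemma mem_L_iff: "l \<in> L \<longleftrightarrow> (\<exists>(m::int) (n::int). Re l = 2 * w * m \<and> Im l = 2 * Im w' * n)"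
  by (auto simp: L_eq complex_eq_iff image_iff)

lemma mem_L_I: "Re l = 2 * w * of_int m \<Longrightarrow> Im l = 2 * Im w' * of_int n \<Longrightarrow> l \<in> L"
  unfolding mem_L_iff by blast

lemma mem_L_E:
  assumes "l \<in> L"
  obtains m n where "Re l = 2 * w * of_int m" "Im l = 2 * Im w' * of_int n"
  using assms unfolding mem_L_iff by blast

lemma zero_in_L [simp]: "0 \<in> L"
  by (rule mem_L_I[of _ 0 0]) simp_all

lemma L_add:
  assumes "l \<in> L" "k \<in> L"
  shows "l + k \<in> L"
proof -
  obtain m n m' n' where "Re l = 2 * w * of_int m" "Im l = 2 * Im w' * of_int n"
    "Re k = 2 * w * of_int m'" "Im k = 2 * Im w' * of_int n'"
    using mem_L_E[OF assms(1)] mem_L_E[OF assms(2)] by metis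
  thus ?thesis
    by (intro mem_L_I[of _ "m + m'" "n + n'"]) (simp_all add: distrib_left)
qed

lemma L_uminus: "- l \<in> L" if "l \<in> L"
  using that
proof (rule mem_L_E)
  fix m n assume "Re l = 2 * w * of_int m" "Im l = 2 * Im w' * of_int n"
  thus ?thesis by (intro mem_L_I[of _ "- m" "- n"]) simp_all
qed

lemma L_cnj: "cnj l \<in> L" if "l \<in> L"
  using that
proof (rule mem_L_E)
  fix m n assume "Re l = 2 * w * of_int m" "Im l = 2 * Im w' * of_int n"
  thus ?thesis by (intro mem_L_I[of _ "m" "- n"]) simp_all
qed

lemma L_uminus_iff [simp]: "- l \<in> L \<longleftrightarrow> l \<in> L"
  using L_uminus[of l] L_uminus[of "- l"] by auto

lemma L_cnj_iff [simp]: "cnj l \<in> L \<longleftrightarrow> l \<in> L"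
  using L_cnj[of l] L_cnj[of "cnj l"] by auto

lemma L_add_iff:
  assumes "k \<in> L"
  shows "l + k \<in> L \<longleftrightarrow> l \<in> L"
  using L_add[of "l + k" "- k"] L_add[of l k] assms by (auto simp del: uminus_add_conv_diff)

lemma periods_in_L: "of_int m * (2 * of_real w) + of_int n * (2 * w') \<in> L"
  by (auto simp: L_def period_lattice_def)

lemma countable_L: "countable L"
  unfolding L_eq by simp

text \<open>The square of \<open>1 + norm l\<close> is at least a constant times
  \<open>(1 + \<bar>m\<bar>) * (1 + \<bar>n\<bar>)\<close>, so the inverse cube is dominated by a
  product of two one-dimensional series with exponent \<open>3 / 2\<close>.\<close>

lemma summable_L:
  assumes "A \<subseteq> L" "3 \<le> k"
  shows "(\<lambda>l. 1 / (1 + norm l) ^ k) summable_on A"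
proof -
  \<comment> \<open>The entry 1 lets \<open>c\<close> be absorbed by the summand 1 of
    \<open>1 + norm l\<close>; the other two entries compare with the side lengths of the
    lattice.\<close>
  define c where "c = min 1 (min (2 * w) (2 * Im w'))"
  have c: "0 < c" "c \<le> 1" "c \<le> 2 * w" "c \<le> 2 * Im w'"
    using w w' by (auto simp: c_def)
  let ?l = "\<lambda>(m::int, n::int). Complex (2 * w * m) (2 * Im w' * n)"
  have inj: "inj ?l"
    using w w' by (auto simp: inj_on_def)
  have bound: "1 / (1 + norm (?l mn)) ^ 3 \<le>
      (case mn of (m::int, n::int) \<Rightarrow> ((1 + \<bar>m\<bar>) * (1 + \<bar>n\<bar>)) powr - (3 / 2)) * (1 / c ^ 3)" for mn
  proof -
    obtain m n where mn: "mn = (m, n)" by force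
    define N where "N = 1 + norm (?l mn)"
    have "c + c * \<bar>m\<bar> \<le> 1 + 2 * w * \<bar>real_of_int m\<bar>"
      using c mult_right_mono[OF c(3) abs_ge_zero[of "real_of_int m"]] by linarith
    also have "\<dots> \<le> N"
      using abs_Re_le_cmod[of "?l mn"] w by (simp add: N_def mn abs_mult)
    finally have m: "c * (1 + \<bar>m\<bar>) \<le> N" by (simp add: distrib_left)
    have "c + c * \<bar>n\<bar> \<le> 1 + 2 * Im w' * \<bar>real_of_int n\<bar>"
      using c mult_right_mono[OF c(4) abs_ge_zero[of "real_of_int n"]] by linarith
    also have "\<dots> \<le> N"
      using abs_Im_le_cmod[of "?l mn"] w' by (simp add: N_def mn abs_mult)
    finally have n: "c * (1 + \<bar>n\<bar>) \<le> N" by (simp add: distrib_left)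
    have N: "0 < N" by (simp add: N_def add_pos_nonneg)
    define q where "q = (1 + \<bar>real_of_int m\<bar>) * (1 + \<bar>real_of_int n\<bar>)"
    have q: "0 < q" by (simp add: q_def add_pos_nonneg)
    have "(c * (1 + \<bar>m\<bar>)) * (c * (1 + \<bar>n\<bar>)) \<le> N * N"
      using m n c N by (intro mult_mono) auto
    hence "c\<^sup>2 * q \<le> N\<^sup>2"
      by (simp add: q_def power2_eq_square algebra_simps)
    hence "(c\<^sup>2 * q) powr (3 / 2) \<le> (N\<^sup>2) powr (3 / 2)"
      using c q by (intro powr_mono2) auto
    moreover have "(x\<^sup>2) powr (3 / 2) = x ^ 3" if "0 < x" for x :: real
    proof -
      have "(x powr 2) powr (3 / 2) = x powr 3" by (simp add: powr_powr)
      thus ?thesis using that by simp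
    qed
    ultimately have "c ^ 3 * q powr (3 / 2) \<le> N ^ 3"
      using c(1) N q by (simp add: powr_mult)
    hence "1 / N ^ 3 \<le> 1 / (c ^ 3 * q powr (3 / 2))"
      using c N q by (intro divide_left_mono) auto
    thus ?thesis
      by (simp add: mn N_def q_def powr_minus field_simps)
  qed
  have "(\<lambda>mn. 1 / (1 + norm (?l mn)) ^ 3) summable_on UNIV"
    by (rule summable_on_comparison_test[OF summable_on_cmult_left[where c = "1 / c ^ 3", OF
          summable_on_int_times_int_powr[of "3 / 2"]]])
       (use bound in simp_all)
  hence "(\<lambda>l. 1 / (1 + norm l) ^ 3) summable_on L"
    unfolding L_eq using inj by (subst summable_on_reindex) (auto simp: o_def)
  hence "(\<lambda>l. 1 / (1 + norm l) ^ 3) summable_on A"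
    using assms(1) summable_on_subset_banach by blast
  thus ?thesis
    by (rule summable_on_comparison_test)
       (use assms in \<open>auto intro!: divide_left_mono power_increasing mult_pos_pos zero_less_power add_pos_nonneg\<close>)
qed

lemma finite_L_bounded: "finite {l \<in> L. norm l \<le> R}"
proof -
  let ?K = "{- \<lceil>R / (2 * w)\<rceil>..\<lceil>R / (2 * w)\<rceil>} \<times> {- \<lceil>R / (2 * Im w')\<rceil>..\<lceil>R / (2 * Im w')\<rceil>}"
  have box: "- \<lceil>R / c\<rceil> \<le> m \<and> m \<le> \<lceil>R / c\<rceil>" if "\<bar>c * real_of_int m\<bar> \<le> R" "0 < c" for c m
  proof -
    have "\<bar>real_of_int m\<bar> \<le> R / c"
      using that by (simp add: abs_mult field_simps)
    also have "R / c \<le> real_of_int \<lceil>R / c\<rceil>" by simp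
    finally have "\<bar>m\<bar> \<le> \<lceil>R / c\<rceil>" by linarith
    thus ?thesis by auto
  qed
  have "{l \<in> L. norm l \<le> R} \<subseteq> (\<lambda>(m::int, n::int). Complex (2 * w * m) (2 * Im w' * n)) ` ?K"
  proof
    fix l assume l: "l \<in> {l \<in> L. norm l \<le> R}"
    then obtain m n :: int where mn: "Re l = 2 * w * m" "Im l = 2 * Im w' * n"
      by (auto simp: mem_L_iff)
    have "\<bar>2 * w * m\<bar> \<le> R" "\<bar>2 * Im w' * n\<bar> \<le> R"
      using l abs_Re_le_cmod[of l] abs_Im_le_cmod[of l] mn by auto
    hence "(m, n) \<in> ?K"
      using box[of "2 * w" m] box[of "2 * Im w'" n] w w' by auto
    thus "l \<in> (\<lambda>(m::int, n::int). Complex (2 * w * m) (2 * Im w' * n)) ` ?K"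
      using mn by (force simp: complex_eq_iff)
  qed
  thus ?thesis
    by (rule finite_subset) auto
qed

text \<open>Near a point outside \<open>A\<close> the distance to \<open>l\<close> grows at least
  linearly in \<open>norm l\<close>, uniformly in \<open>x\<close>. The majorants below rest on this
  estimate, with \<open>A\<close> the whole lattice or the lattice without the origin.\<close>

lemma separation:
  assumes "A \<subseteq> L" "z \<notin> A"
  obtains r \<epsilon> where "0 < r" "0 < \<epsilon>" "\<And>x l. x \<in> ball z r \<Longrightarrow> l \<in> A \<Longrightarrow> \<epsilon> * (1 + norm l) \<le> norm (x - l)"
proof -
  let ?F = "{l \<in> A. norm l \<le> norm z + 2}"
  have fin: "finite ?F"
    by (rule finite_subset[OF _ finite_L_bounded[of "norm z + 2"]]) (use assms in auto)
  \<comment> \<open>The entry 2 accounts for the points of \<open>A\<close> outside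
    \<open>?F\<close>, which are at distance at least 2 from \<open>z\<close>; halving leaves every
    \<open>x\<close> in the ball at distance at least \<open>r\<close> from
    \<open>A\<close>.\<close>
  define r where "r = Min (insert 2 ((\<lambda>l. norm (z - l)) ` ?F)) / 2"
  have r: "0 < r" "r \<le> 1"
    using fin assms unfolding r_def by (auto simp: min_def)
  have far: "2 * r \<le> norm (z - l)" if "l \<in> A" for l
  proof (cases "norm l \<le> norm z + 2")
    case True
    thus ?thesis using fin that by (auto simp: r_def)
  next
    case False
    hence "2 \<le> norm (z - l)"
      using norm_triangle_ineq3[of z l] by linarith
    thus ?thesis using r by linarith
  qed
  define C where "C = (2 + norm z) / r + 1"
  have C: "1 \<le> C" using r by (simp add: C_def)
  have "1 / C * (1 + norm l) \<le> norm (x - l)" if "x \<in> ball z r" "l \<in> A" for x l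
  proof -
    have "norm (z - x) \<le> r" using that by (simp add: dist_norm)
    hence *: "r \<le> norm (x - l)"
      using far[OF that(2)] norm_triangle_ineq[of "z - x" "x - l"] by simp
    have "norm l \<le> norm (z - x) + norm (x - l) + norm z"
      using norm_triangle_ineq4[of z "z - l"] norm_triangle_ineq[of "z - x" "x - l"] by simp
    hence "1 + norm l \<le> (2 + norm z) * 1 + norm (x - l)"
      using \<open>norm (z - x) \<le> r\<close> r by simp
    also have "\<dots> \<le> (2 + norm z) * (norm (x - l) / r) + norm (x - l)"
      using * r by (intro add_mono mult_left_mono) auto
    also have "\<dots> = C * norm (x - l)"
      by (simp add: C_def field_simps)
    finally show ?thesis
      using C by (simp add: field_simps)
  qed
  thus ?thesis
    using that[of r "1 / C"] r C by auto
qed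

lemma open_compl:
  assumes "A \<subseteq> L"
  shows "open (- A)"
proof (subst open_contains_ball, intro ballI)
  fix z assume "z \<in> - A"
  then obtain r \<epsilon> where *: "0 < r" "0 < \<epsilon>"
    "\<And>x l. x \<in> ball z r \<Longrightarrow> l \<in> A \<Longrightarrow> \<epsilon> * (1 + norm l) \<le> norm (x - l)"
    using separation[OF assms, of z] by auto
  have "l \<notin> A" if "l \<in> ball z r" for l
    using *(3)[OF that, of l] *(2) one_plus_norm_pos[of l] by (auto simp: mult_le_0_iff)
  thus "\<exists>e>0. ball z e \<subseteq> - A"
    using *(1) by auto
qed

text \<open>For \<open>k \<ge> 3\<close>, multiplied by \<open>(-1) ^ k * fact (k - 1)\<close>, this
  is the derivative of order \<open>k - 2\<close> of the Weierstrass function if \<open>A\<close> is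
  the lattice, and of its regular part at 0 if the origin is left out.\<close>

definition pole_sum :: "nat \<Rightarrow> complex set \<Rightarrow> complex \<Rightarrow> complex" where
  "pole_sum k A z = (\<Sum>\<^sub>\<infinity>l\<in>A. 1 / (z - l) ^ k)"

lemma pole_summable_aux:
  assumes "A \<subseteq> L" "3 \<le> k" "0 < \<epsilon>" "\<And>l. l \<in> A \<Longrightarrow> \<epsilon> * (1 + norm l) \<le> norm (z - l)"
  shows "l \<in> A \<Longrightarrow> norm (1 / (z - l) ^ k) \<le> 1 / (1 + norm l) ^ k * (1 / \<epsilon> ^ k)"
    and "(\<lambda>l. 1 / (z - l) ^ k) summable_on A"
proof -
  show *: "norm (1 / (z - l) ^ k) \<le> 1 / (1 + norm l) ^ k * (1 / \<epsilon> ^ k)" if "l \<in> A" for l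
  proof -
    have "0 < \<epsilon> * (1 + norm l)"
      using assms one_plus_norm_pos[of l] by simp
    moreover have "(\<epsilon> * (1 + norm l)) ^ k \<le> norm (z - l) ^ k"
      using assms that calculation by (intro power_mono) auto
    ultimately have "1 / norm (z - l) ^ k \<le> 1 / (\<epsilon> * (1 + norm l)) ^ k"
      using assms(3) one_plus_norm_pos[of l] assms(4)[OF that]
      by (intro divide_left_mono mult_pos_pos zero_less_power[of _ k]) linarith+
    thus ?thesis
      by (simp add: norm_divide norm_power power_mult_distrib mult.commute)
  qed
  show "(\<lambda>l. 1 / (z - l) ^ k) summable_on A"
    using Infinite_Sum.abs_summable_on_comparison_test'[OF summable_on_cmult_left[OF summable_L[OF assms(1,2)]] *]
    by (rule abs_summable_summable)
qed

lemma pole_summable: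
  assumes "A \<subseteq> L" "3 \<le> k" "z \<notin> A"
  shows "(\<lambda>l. 1 / (z - l) ^ k) summable_on A"
proof -
  obtain r \<epsilon> where "0 < r" "0 < \<epsilon>"
    "\<And>x l. x \<in> ball z r \<Longrightarrow> l \<in> A \<Longrightarrow> \<epsilon> * (1 + norm l) \<le> norm (x - l)"
    using separation[OF assms(1,3)] by metis
  thus ?thesis
    using pole_summable_aux(2)[OF assms(1,2)] by (metis centre_in_ball)
qed

lemma pole_sum_deriv:
  assumes "A \<subseteq> L" "3 \<le> k" "z \<notin> A"
  shows "(pole_sum k A has_field_derivative - of_nat k * pole_sum (Suc k) A z) (at z)"
proof -
  obtain r \<epsilon> where *: "0 < r" "0 < \<epsilon>"
    "\<And>x l. x \<in> ball z r \<Longrightarrow> l \<in> A \<Longrightarrow> \<epsilon> * (1 + norm l) \<le> norm (x - l)"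
    using separation[OF assms(1,3)] by metis
  have ne: "x \<noteq> l" if "x \<in> ball z r" "l \<in> A" for x l
    using *(3)[OF that] *(2) one_plus_norm_pos[of l] by (auto simp: mult_le_0_iff)
  have "((\<lambda>x. \<Sum>\<^sub>\<infinity>l\<in>A. 1 / (x - l) ^ k) has_field_derivative
      (\<Sum>\<^sub>\<infinity>l\<in>A. - of_nat k * (1 / (z - l) ^ Suc k))) (at z)"
  proof (rule has_field_derivative_infsum[OF *(1)])
    show "((\<lambda>x. 1 / (x - l) ^ k) has_field_derivative - of_nat k * (1 / (x - l) ^ Suc k)) (at x)"
      if "l \<in> A" "x \<in> ball z r" for l x
    proof -
      obtain j where k: "k = Suc j" using assms(2) by (cases k) auto
      define u where "u = x - l"
      have u: "u \<noteq> 0" using ne[OF that(2,1)] by (simp add: u_def)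
      have "((\<lambda>x. (x - l) ^ k) has_field_derivative of_nat k * u ^ j) (at x)"
        unfolding k u_def by (rule derivative_eq_intros refl | simp)+
      from DERIV_inverse'[OF this] u
      have "((\<lambda>x. inverse ((x - l) ^ k)) has_field_derivative
          - (inverse (u ^ k) * (of_nat k * u ^ j) * inverse (u ^ k))) (at x)"
        by (simp add: u_def)
      moreover have "- (inverse (u ^ k) * (of_nat k * u ^ j) * inverse (u ^ k)) = - of_nat k * (1 / u ^ Suc k)"
        using u by (simp add: k divide_simps)
      ultimately show ?thesis
        by (simp add: u_def inverse_eq_divide)
    qed
    show "norm (- of_nat k * (1 / (x - l) ^ Suc k)) \<le> 1 / (1 + norm l) ^ Suc k * (1 / \<epsilon> ^ Suc k) * real k"
      if "l \<in> A" "x \<in> ball z r" for l x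
      using mult_right_mono[OF pole_summable_aux(1)[OF assms(1) _ *(2) *(3)[OF that(2)] that(1), of "Suc k"], of "real k"] assms(2)
      by (simp add: norm_mult norm_divide norm_power mult.commute)
    show "(\<lambda>l. 1 / (1 + norm l) ^ Suc k * (1 / \<epsilon> ^ Suc k) * real k) summable_on A"
      using assms by (intro summable_on_cmult_left summable_L) auto
  qed (use pole_summable[OF assms] in simp)
  thus ?thesis
    unfolding infsum_cmult_right' pole_sum_def[abs_def] .
qed

text \<open>Liouville's theorem for elliptic functions. The value \<open>c\<close> removes the
  singularity at the origin, the periods carry this to all lattice points, and a compact period
  rectangle bounds the resulting entire function.\<close>

lemma elliptic_const:
  assumes hol: "g holomorphic_on - L"
    and per: "\<And>z. z \<notin> L \<Longrightarrow> g (z + 2 * of_real w) = g z" "\<And>z. z \<notin> L \<Longrightarrow> g (z + 2 * w') = g z"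
    and lim: "(g \<longlongrightarrow> c) (at 0)"
    and z: "z \<notin> L"
  shows "g z = c"
proof -
  define G where "G = (\<lambda>z. if z \<in> L then c else g z)"
  have in_L: "2 * of_real w \<in> L" "2 * w' \<in> L"
    using periods_in_L[of 1 0] periods_in_L[of 0 1] by auto
  have G_nat: "G (z + of_nat n * p) = G z" if "p \<in> L" "\<And>z. z \<notin> L \<Longrightarrow> g (z + p) = g z" for z p n
  proof (induction n)
    case (Suc n)
    have "G (z + of_nat n * p + p) = G (z + of_nat n * p)"
      using that by (simp add: G_def L_add_iff)
    thus ?case using Suc by (simp add: algebra_simps)
  qed simp
  have G_int: "G (z + of_int n * p) = G z" if "p \<in> L" "\<And>z. z \<notin> L \<Longrightarrow> g (z + p) = g z" for z p n
  proof (cases "0 \<le> n")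
    case True
    have "G (z + of_nat (nat n) * p) = G z"
      by (rule G_nat[OF that])
    thus ?thesis using True by (simp add: of_nat_nat)
  next
    case False
    have "G (z + of_int n * p + of_nat (nat (- n)) * p) = G (z + of_int n * p)"
      by (rule G_nat[OF that])
    thus ?thesis using False by (simp add: of_nat_nat)
  qed
  have G_shift: "G (z + (of_int m * (2 * of_real w) + of_int n * (2 * w'))) = G z" for z m n
  proof -
    have "G (z + of_int m * (2 * of_real w) + of_int n * (2 * w')) = G (z + of_int m * (2 * of_real w))"
      by (rule G_int[OF in_L(2) per(2)])
    also have "\<dots> = G z"
      by (rule G_int[OF in_L(1) per(1)])
    finally show ?thesis by (simp only: add.assoc)
  qed
  have diff_out: "G field_differentiable at z" if zL: "z \<notin> L" for z
  proof -
    obtain g' where "(g has_field_derivative g') (at z)"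
      using hol zL by (auto simp: holomorphic_on_open[OF open_compl[OF order_refl]])
    hence "(G has_field_derivative g') (at z)"
      by (rule has_field_derivative_transform_within_open[OF _ open_compl[OF order_refl]])
         (use zL in \<open>auto simp: G_def\<close>)
    thus ?thesis by (auto simp: field_differentiable_def)
  qed
  have diff_0: "G field_differentiable at 0"
  proof -
    have "open (- (L - {0}))" by (rule open_compl) auto
    then obtain r where r: "0 < r" "ball 0 r \<subseteq> - (L - {0})"
      by (auto simp: open_contains_ball)
    have "G holomorphic_on ball 0 r"
    proof (rule no_isolated_singularity'[where K = "{0}"])
      have "(G \<longlongrightarrow> c) (at 0)"
        using lim
      proof (rule Lim_transform_within_open[OF _ open_ball[of 0 r]])
        show "g x = G x" if "x \<in> ball 0 r" "x \<noteq> 0" for x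
          using that r(2) by (auto simp: G_def)
      qed (use r in auto)
      hence "(G \<longlongrightarrow> G 0) (at 0)" by (simp add: G_def)
      thus "(G \<longlongrightarrow> G z) (at z within ball 0 r)" if "z \<in> {0}" for z
        using that by (auto intro: tendsto_within_subset)
      show "G holomorphic_on ball 0 r - {0}"
        unfolding holomorphic_on_def
      proof
        fix x :: complex assume "x \<in> ball 0 r - {0}"
        thus "G field_differentiable at x within ball 0 r - {0}"
          using r(2) by (intro field_differentiable_at_within[OF diff_out]) auto
      qed
    qed auto
    thus ?thesis
      using r(1) by (auto simp: holomorphic_on_open field_differentiable_def)
  qed
  have "G field_differentiable at z" for z
  proof (cases "z \<in> L")
    case True
    then obtain m n where z: "z = of_int m * (2 * of_real w) + of_int n * (2 * w')"
      by (auto simp: L_def period_lattice_def)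
    have "G = G \<circ> (\<lambda>x. x - z)"
      using G_shift[of "_ - z" m n] by (auto simp: z fun_eq_iff)
    moreover have "(G \<circ> (\<lambda>x. x - z)) field_differentiable at z"
      using diff_0 by (intro field_differentiable_compose) (auto intro!: derivative_intros)
    ultimately show ?thesis by simp
  qed (rule diff_out)
  hence hol_G: "G holomorphic_on UNIV"
    by (simp add: holomorphic_on_def)
  let ?C = "cbox 0 (Complex (2 * w) (2 * Im w'))"
  have "range G \<subseteq> G ` ?C"
  proof
    fix y assume "y \<in> range G"
    then obtain z where y: "y = G z" by blast
    define m n where "m = \<lfloor>Re z / (2 * w)\<rfloor>" "n = \<lfloor>Im z / (2 * Im w')\<rfloor>"
    have "0 \<le> x - c * \<lfloor>x / c\<rfloor> \<and> x - c * \<lfloor>x / c\<rfloor> \<le> c" if "0 < c" for x c :: real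
      using floor_divide_lower[OF that, of x] floor_divide_upper[OF that, of x] by (simp add: algebra_simps)
    from this[of "2 * w" "Re z"] this[of "2 * Im w'" "Im z"]
    have "z + (of_int (- m) * (2 * of_real w) + of_int (- n) * (2 * w')) \<in> ?C"
      using w w' by (simp add: in_cbox_complex_iff m_n_def algebra_simps)
    moreover have "y = G (z + (of_int (- m) * (2 * of_real w) + of_int (- n) * (2 * w')))"
      by (simp only: G_shift y)
    ultimately show "y \<in> G ` ?C" by blast
  qed
  moreover have "compact (G ` ?C)"
    using hol_G by (intro compact_continuous_image compact_cbox)
      (meson UNIV_I continuous_on_subset holomorphic_on_imp_continuous_on subsetI)
  ultimately have "bounded (range G)"
    using bounded_subset compact_imp_bounded by blast
  hence "G constant_on UNIV"
    using Liouville_theorem hol_G by blast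
  hence "G z = G 0" by (metis UNIV_I constant_on_def)
  thus ?thesis using z by (simp add: G_def)
qed

abbreviation (input) L0 :: "complex set" where
  "L0 \<equiv> L - {0}"

lemma L0_subset: "L0 \<subseteq> L" by auto

definition reg :: "complex \<Rightarrow> complex" where
  "reg z = (\<Sum>\<^sub>\<infinity>l\<in>L0. 1 / (z - l)\<^sup>2 - 1 / l\<^sup>2)"

text \<open>Over the common denominator the numerator is \<open>z * (2 * l - z)\<close>, of first
  order in \<open>l\<close> against fourth order below, so the terms decay like the inverse cube of
  \<open>norm l\<close>.\<close>

lemma reg_summable:
  assumes z: "z \<notin> L0"
  shows "(\<lambda>l. 1 / (z - l)\<^sup>2 - 1 / l\<^sup>2) summable_on L0"
proof -
  obtain r \<epsilon> where *: "0 < r" "0 < \<epsilon>"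
    "\<And>x l. x \<in> ball z r \<Longrightarrow> l \<in> L0 \<Longrightarrow> \<epsilon> * (1 + norm l) \<le> norm (x - l)"
    using separation[OF L0_subset z] by metis
  \<comment> \<open>Separation at the origin bounds the factor \<open>l\<^sup>2\<close> of the
    common denominator from below.\<close>
  obtain r' \<delta> where **: "0 < r'" "0 < \<delta>"
    "\<And>x l. x \<in> ball 0 r' \<Longrightarrow> l \<in> L0 \<Longrightarrow> \<delta> * (1 + norm l) \<le> norm (x - l)"
    using separation[OF L0_subset, of 0] by auto
  have bound: "norm (1 / (z - l)\<^sup>2 - 1 / l\<^sup>2) \<le> 1 / (1 + norm l) ^ 3 * (norm z * (2 + norm z) / (\<epsilon>\<^sup>2 * \<delta>\<^sup>2))"
    if "l \<in> L0" for l
  proof -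
    define N where "N = 1 + norm l"
    have N: "0 < N" "1 \<le> N" using one_plus_norm_pos[of l] by (auto simp: N_def)
    have le: "\<epsilon> * N \<le> norm (z - l)" "\<delta> * N \<le> norm l"
      using *(3)[of z l] **(3)[of 0 l] that *(1) **(1) by (auto simp: N_def)
    have pos: "0 < \<epsilon> * N" "0 < \<delta> * N" using N * ** by auto
    hence ne: "z - l \<noteq> 0" "l \<noteq> 0" using le by auto
    hence "1 / (z - l)\<^sup>2 - 1 / l\<^sup>2 = z * (2 * l - z) / ((z - l)\<^sup>2 * l\<^sup>2)"
      by (simp add: divide_simps) (simp add: power2_eq_square algebra_simps)
    hence "norm (1 / (z - l)\<^sup>2 - 1 / l\<^sup>2) = norm z * norm (2 * l - z) / ((norm (z - l))\<^sup>2 * (norm l)\<^sup>2)"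
      by (simp add: norm_mult norm_divide norm_power)
    also have "\<dots> \<le> norm z * ((2 + norm z) * N) / ((\<epsilon> * N)\<^sup>2 * (\<delta> * N)\<^sup>2)"
    proof (rule frac_le)
      have "norm (2 * l - z) \<le> 2 * norm l + norm z"
        using norm_triangle_ineq4[of "2 * l" z] by (simp add: norm_mult)
      also have "\<dots> \<le> (2 + norm z) * N"
        using mult_left_mono[OF N(2) norm_ge_zero[of z]] by (simp add: N_def algebra_simps)
      finally show "norm z * norm (2 * l - z) \<le> norm z * ((2 + norm z) * N)"
        by (intro mult_left_mono) auto
      show "(\<epsilon> * N)\<^sup>2 * (\<delta> * N)\<^sup>2 \<le> (norm (z - l))\<^sup>2 * (norm l)\<^sup>2"
        using le pos by (intro mult_mono power_mono) auto
      show "0 < (\<epsilon> * N)\<^sup>2 * (\<delta> * N)\<^sup>2"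
        using pos by (intro mult_pos_pos[OF zero_less_power zero_less_power])
    qed (use N in auto)
    also have "\<dots> = N / N ^ 4 * (norm z * (2 + norm z) / (\<epsilon>\<^sup>2 * \<delta>\<^sup>2))"
      by (simp add: power_mult_distrib power2_eq_square power4_eq_xxxx mult_ac)
    also have "N / N ^ 4 = 1 / N ^ 3"
      using N(1) by (simp add: divide_simps power3_eq_cube power4_eq_xxxx)
    finally show ?thesis by (simp add: N_def)
  qed
  show ?thesis
    by (rule abs_summable_summable, rule Infinite_Sum.abs_summable_on_comparison_test'[OF _ bound],
        rule summable_on_cmult_left, rule summable_L) auto
qed

lemma reg_deriv:
  assumes z: "z \<notin> L0"
  shows "(reg has_field_derivative - 2 * pole_sum 3 L0 z) (at z)"
proof -
  obtain r \<epsilon> where *: "0 < r" "0 < \<epsilon>"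
    "\<And>x l. x \<in> ball z r \<Longrightarrow> l \<in> L0 \<Longrightarrow> \<epsilon> * (1 + norm l) \<le> norm (x - l)"
    using separation[OF L0_subset z] by metis
  have ne: "x - l \<noteq> 0" if "x \<in> ball z r" "l \<in> L0" for x l
    using *(3)[OF that] *(2) one_plus_norm_pos[of l] by (auto simp: mult_le_0_iff)
  have "((\<lambda>x. \<Sum>\<^sub>\<infinity>l\<in>L0. 1 / (x - l)\<^sup>2 - 1 / l\<^sup>2) has_field_derivative
      (\<Sum>\<^sub>\<infinity>l\<in>L0. - 2 * (1 / (z - l) ^ 3))) (at z)"
  proof (rule has_field_derivative_infsum[OF *(1)])
    show "((\<lambda>x. 1 / (x - l)\<^sup>2 - 1 / l\<^sup>2) has_field_derivative - 2 * (1 / (x - l) ^ 3)) (at x)"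
      if "l \<in> L0" "x \<in> ball z r" for l x
    proof -
      define u where "u = x - l"
      have u: "u \<noteq> 0" using ne[OF that(2,1)] by (simp add: u_def)
      have "((\<lambda>x. 1 / (x - l)\<^sup>2 - 1 / l\<^sup>2) has_field_derivative - (2 * u) / (u\<^sup>2 * u\<^sup>2)) (at x)"
        using u by (auto intro!: derivative_eq_intros simp: u_def power2_eq_square)
      moreover have "- (2 * u) / (u\<^sup>2 * u\<^sup>2) = - 2 * (1 / u ^ 3)"
        using u by (simp add: field_simps power2_eq_square power3_eq_cube)
      ultimately show ?thesis by (simp add: u_def)
    qed
    show "norm (- 2 * (1 / (x - l) ^ 3)) \<le> 1 / (1 + norm l) ^ 3 * (1 / \<epsilon> ^ 3) * 2"
      if "l \<in> L0" "x \<in> ball z r" for l x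
      using mult_right_mono[OF pole_summable_aux(1)[OF L0_subset _ *(2) *(3)[OF that(2)] that(1), of 3], of 2]
      by (simp add: norm_mult norm_divide mult.commute)
    show "(\<lambda>l. 1 / (1 + norm l) ^ 3 * (1 / \<epsilon> ^ 3) * 2) summable_on L0"
      by (intro summable_on_cmult_left summable_L) auto
  qed (rule reg_summable[OF z])
  thus ?thesis
    unfolding infsum_cmult_right' pole_sum_def reg_def[abs_def] .
qed

text \<open>The successive derivatives of \<open>reg\<close>. Order 0 is set apart because the sum
  of inverse squares without the correction \<open>1 / l\<^sup>2\<close> does not converge
  absolutely.\<close>

definition reg_deriv_seq :: "nat \<Rightarrow> complex \<Rightarrow> complex" where
  "reg_deriv_seq i z = (if i = 0 then reg z else (-1) ^ i * fact (Suc i) * pole_sum (i + 2) L0 z)"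

lemma reg_deriv_seq_deriv:
  assumes "z \<notin> L0"
  shows "(reg_deriv_seq i has_field_derivative reg_deriv_seq (Suc i) z) (at z)"
proof (cases "i = 0")
  case True
  thus ?thesis
    using reg_deriv[OF assms] by (simp add: reg_deriv_seq_def[abs_def] numeral_3_eq_3)
next
  case False
  hence "((\<lambda>z. (-1) ^ i * fact (Suc i) * pole_sum (i + 2) L0 z) has_field_derivative
      (-1) ^ i * fact (Suc i) * (- of_nat (i + 2) * pole_sum (Suc (i + 2)) L0 z)) (at z)"
    by (intro DERIV_cmult pole_sum_deriv L0_subset assms) auto
  thus ?thesis
    using False by (simp add: reg_deriv_seq_def[abs_def] algebra_simps)
qed

text \<open>The Eisenstein series of the lattice; \<open>60 * G 4\<close> and
  \<open>140 * G 6\<close> are its invariants.\<close>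

definition G :: "nat \<Rightarrow> complex" where
  "G k = (\<Sum>\<^sub>\<infinity>l\<in>L0. 1 / l ^ k)"

lemma bij_uminus: "bij_betw uminus L0 L0" "bij_betw uminus L L"
  by (rule bij_betwI[where g = uminus]; auto)+

lemma G_odd: "odd k \<Longrightarrow> G k = 0"
proof -
  assume "odd k"
  have "G k = (\<Sum>\<^sub>\<infinity>l\<in>L0. 1 / (- l) ^ k)"
    unfolding G_def by (rule infsum_reindex_bij_betw[OF bij_uminus(1), symmetric])
  also have "\<dots> = (\<Sum>\<^sub>\<infinity>l\<in>L0. - 1 * (1 / l ^ k))"
    using \<open>odd k\<close> by simp
  also have "\<dots> = - 1 * G k"
    unfolding G_def infsum_cmult_right' ..
  finally show "G k = 0" by simp
qed

lemma reg_deriv_seq_0: "reg_deriv_seq i 0 = (if i = 0 then 0 else fact (Suc i) * G (i + 2))"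
proof (cases "i = 0")
  case True
  thus ?thesis by (simp add: reg_deriv_seq_def reg_def)
next
  case False
  have "pole_sum (i + 2) L0 0 = (\<Sum>\<^sub>\<infinity>l\<in>L0. (-1) ^ (i + 2) * (1 / l ^ (i + 2)))"
    unfolding pole_sum_def
  proof (rule infsum_cong)
    show "1 / (0 - l) ^ k = (-1) ^ k * (1 / l ^ k)" for l :: complex and k
      by (cases "even k") auto
  qed
  also have "\<dots> = (-1) ^ (i + 2) * G (i + 2)"
    unfolding G_def infsum_cmult_right' ..
  finally show ?thesis
    using False by (simp add: reg_deriv_seq_def)
qed

text \<open>Taylor's formula is phrased as a limit so that the cancellation of poles becomes limit
  arithmetic at the origin.\<close>

lemma reg_Taylor:
  "((\<lambda>z. (reg_deriv_seq m z - (\<Sum>i\<le>n. reg_deriv_seq (m + i) 0 * z ^ i / fact i)) / z ^ n) \<longlongrightarrow> 0) (at 0)"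
proof -
  have "open (- L0)" by (rule open_compl) auto
  then obtain r where r: "0 < r" "cball 0 r \<subseteq> - L0"
    by (auto simp: open_contains_cball)
  have deriv: "(reg_deriv_seq i has_field_derivative reg_deriv_seq (Suc i) x) (at x within cball 0 r)"
    if "x \<in> cball 0 r" for i x
    by (rule has_field_derivative_at_within, rule reg_deriv_seq_deriv) (use that r in auto)
  have "continuous_on (cball 0 r) (reg_deriv_seq (m + Suc n))"
    by (rule DERIV_continuous_on) (rule deriv)
  hence "bounded (reg_deriv_seq (m + Suc n) ` cball 0 r)"
    by (intro compact_imp_bounded compact_continuous_image compact_cball)
  then obtain B where B: "\<And>x. x \<in> cball 0 r \<Longrightarrow> norm (reg_deriv_seq (m + Suc n) x) \<le> B"
    unfolding bounded_iff by (metis imageI)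
  have bound: "norm ((reg_deriv_seq m z - (\<Sum>i\<le>n. reg_deriv_seq (m + i) 0 * z ^ i / fact i)) / z ^ n)
      \<le> B * norm z / fact n" if "z \<in> cball 0 r" "z \<noteq> 0" for z
  proof -
    have "norm (reg_deriv_seq (m + 0) z - (\<Sum>i\<le>n. reg_deriv_seq (m + i) 0 * (z - 0) ^ i / fact i))
        \<le> B * norm (z - 0) ^ Suc n / fact n"
      by (rule complex_Taylor[of "cball 0 r" n "\<lambda>i. reg_deriv_seq (m + i)"])
         (use deriv B that r in auto)
    thus ?thesis
      using that by (simp add: norm_divide norm_power divide_simps mult.assoc)
  qed
  show ?thesis
  proof (rule Lim_null_comparison)
    have "eventually (\<lambda>z. z \<in> ball 0 r - {0}) (at (0::complex))"
      using r(1) by (intro eventually_at_in_open) auto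
    thus "\<forall>\<^sub>F z in at 0. norm ((reg_deriv_seq m z - (\<Sum>i\<le>n. reg_deriv_seq (m + i) 0 * z ^ i / fact i)) / z ^ n)
        \<le> B * norm z / fact n"
      by eventually_elim (use bound in auto)
    show "((\<lambda>z::complex. B * norm z / fact n) \<longlongrightarrow> 0) (at 0)"
      by (auto intro!: tendsto_eq_intros)
  qed
qed

section \<open>The Weierstrass function, its derivatives and its periods\<close>

abbreviation wp :: "complex \<Rightarrow> complex" where
  "wp \<equiv> weierstrass_p L"

definition wp1 :: "complex \<Rightarrow> complex" where
  "wp1 z = - 2 * pole_sum 3 L z"

definition wp2 :: "complex \<Rightarrow> complex" where
  "wp2 z = 6 * pole_sum 4 L z"

lemma wp_eq_reg: "wp z = 1 / z\<^sup>2 + reg z"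
  by (simp add: weierstrass_p_def reg_def)

lemma pole_sum_L:
  assumes "z \<notin> L" "3 \<le> k"
  shows "pole_sum k L z = 1 / z ^ k + pole_sum k L0 z"
proof -
  have "insert 0 L0 = L" by auto
  moreover have "(\<Sum>\<^sub>\<infinity>l\<in>insert 0 L0. 1 / (z - l) ^ k) = 1 / (z - 0) ^ k + (\<Sum>\<^sub>\<infinity>l\<in>L0. 1 / (z - l) ^ k)"
    using assms by (intro infsum_insert pole_summable) auto
  ultimately show ?thesis by (simp add: pole_sum_def)
qed

lemma wp1_eq_reg: "z \<notin> L \<Longrightarrow> wp1 z = - 2 / z ^ 3 + reg_deriv_seq 1 z"
  by (simp add: wp1_def pole_sum_L reg_deriv_seq_def numeral_3_eq_3 distrib_left)

lemma wp2_eq_reg: "z \<notin> L \<Longrightarrow> wp2 z = 6 / z ^ 4 + reg_deriv_seq 2 z"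
  by (simp add: wp2_def pole_sum_L reg_deriv_seq_def distrib_left fact_numeral)

lemma wp_deriv:
  assumes "z \<notin> L"
  shows "(wp has_field_derivative wp1 z) (at z)"
proof -
  have z: "z \<noteq> 0" "z \<notin> L0" using assms zero_in_L by blast+
  have "((\<lambda>z. 1 / z\<^sup>2) has_field_derivative - (2 * z) / (z\<^sup>2 * z\<^sup>2)) (at z)"
    using z by (auto intro!: derivative_eq_intros simp: power2_eq_square)
  also have "- (2 * z) / (z\<^sup>2 * z\<^sup>2) = - 2 / z ^ 3"
    using z by (simp add: field_simps power2_eq_square power3_eq_cube)
  finally have "((\<lambda>z. 1 / z\<^sup>2 + reg z) has_field_derivative - 2 / z ^ 3 + - 2 * pole_sum 3 L0 z) (at z)"
    by (intro DERIV_add reg_deriv z)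
  thus ?thesis
    using assms by (simp add: wp_eq_reg[abs_def] wp1_def pole_sum_L distrib_left)
qed

lemma wp1_deriv:
  assumes "z \<notin> L"
  shows "(wp1 has_field_derivative wp2 z) (at z)"
proof -
  have "((\<lambda>z. - 2 * pole_sum 3 L z) has_field_derivative - 2 * (- of_nat 3 * pole_sum (Suc 3) L z)) (at z)"
    by (intro DERIV_cmult pole_sum_deriv assms) auto
  thus ?thesis by (simp add: wp1_def[abs_def] wp2_def)
qed

lemma holomorphic_L: "wp holomorphic_on - L" "wp1 holomorphic_on - L" "wp2 holomorphic_on - L"
proof -
  note op = holomorphic_on_open[OF open_compl[OF order_refl]]
  show "wp holomorphic_on - L" "wp1 holomorphic_on - L"
    unfolding op using wp_deriv wp1_deriv by blast+
  have "\<exists>d. (pole_sum 4 L has_field_derivative d) (at z)" if "z \<notin> L" for z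
    using pole_sum_deriv[of L 4 z] that by auto
  hence "pole_sum 4 L holomorphic_on - L"
    unfolding op by blast
  thus "wp2 holomorphic_on - L"
    unfolding wp2_def[abs_def] by (intro holomorphic_intros)
qed

lemma pole_sum_periodic:
  assumes "p \<in> L"
  shows "pole_sum k L (z + p) = pole_sum k L z"
proof -
  have "bij_betw (\<lambda>l. l + p) L L"
    by (rule bij_betwI[where g = "\<lambda>l. l - p"])
       (use L_add_iff[OF assms] L_add_iff[OF L_uminus[OF assms]] in auto)
  from infsum_reindex_bij_betw[OF this, of "\<lambda>l. 1 / (z + p - l) ^ k"]
  show ?thesis by (simp add: pole_sum_def)
qed

lemma wp1_periodic: "p \<in> L \<Longrightarrow> wp1 (z + p) = wp1 z"
  and wp2_periodic: "p \<in> L \<Longrightarrow> wp2 (z + p) = wp2 z"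
  by (simp_all add: wp1_def wp2_def pole_sum_periodic)

lemma wp_even: "wp (- z) = wp z"
proof -
  have "reg (- z) = (\<Sum>\<^sub>\<infinity>l\<in>L0. 1 / (- z - - l)\<^sup>2 - 1 / (- l)\<^sup>2)"
    unfolding reg_def by (rule infsum_reindex_bij_betw[OF bij_uminus(1), symmetric])
  also have "\<dots> = reg z"
    unfolding reg_def by (intro infsum_cong) (simp add: power2_commute)
  finally show ?thesis by (simp add: wp_eq_reg)
qed

text \<open>The derivative is periodic, so \<open>wp (z + p) - wp z\<close> is constant on the
  complement of the lattice, which is connected because the lattice is countable. At
  \<open>- (p / 2)\<close> the difference vanishes, as \<open>wp\<close> is even.\<close>

lemma wp_periodic:
  assumes p: "p \<in> L" "p / 2 \<notin> L" and z: "z \<notin> L"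
  shows "wp (z + p) = wp z"
proof -
  let ?d = "\<lambda>z. wp (z + p) - wp z"
  have deriv: "(?d has_field_derivative 0) (at x)" if "x \<in> - L" for x
  proof -
    have "((\<lambda>z. wp (z + p)) has_field_derivative wp1 (x + p)) (at x)"
      using wp_deriv[of "x + p"] that p by (simp add: DERIV_shift L_add_iff)
    hence "(?d has_field_derivative wp1 (x + p) - wp1 x) (at x)"
      using that by (intro DERIV_diff wp_deriv) auto
    thus ?thesis by (simp add: wp1_periodic[OF p(1)])
  qed
  have conn: "connected (- L)"
    using connected_open_diff_countable[of "UNIV :: complex set" L] countable_L
    by (simp add: Compl_eq_Diff_UNIV connected_UNIV)
  have const: "?d constant_on - L"
    using deriv conn open_compl[of L] by (intro has_field_derivative_0_imp_constant_on) auto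
  have "- (p / 2) \<in> - L" using p by simp
  hence "?d z = ?d (- (p / 2))"
    using const z unfolding constant_on_def by (metis ComplI)
  also have "- (p / 2) + p = p / 2" by simp
  hence "?d (- (p / 2)) = 0" by (simp add: wp_even)
  finally show ?thesis by simp
qed

lemma half_periods_notin: "of_real w \<notin> L" "of_real \<tau> + w' \<notin> L"
proof -
  have half: "c \<noteq> 2 * c * of_int m" if "0 < c" for c :: real and m
  proof
    assume "c = 2 * c * of_int m"
    hence "real_of_int (2 * m) = 1" using that by simp
    hence "2 * m = 1" by linarith
    thus False by presburger
  qed
  show "of_real w \<notin> L" "of_real \<tau> + w' \<notin> L"
    using half[OF w] half[OF w'(2)] unfolding mem_L_iff by auto
qed

lemma full_periods: "2 * of_real w \<in> L" "2 * w' \<in> L"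
  using periods_in_L[of 1 0] periods_in_L[of 0 1] by auto

lemma wp_period1: "z \<notin> L \<Longrightarrow> wp (z + 2 * of_real w) = wp z"
  using half_periods_notin(1) by (intro wp_periodic) (auto simp: full_periods)

lemma wp_period2: "z \<notin> L \<Longrightarrow> wp (z + 2 * w') = wp z"
  using half_periods_notin(2)[of 0] by (intro wp_periodic) (auto simp: full_periods)

section \<open>The differential equations\<close>

lemma eventually_notin_L: "\<forall>\<^sub>F z in at 0. z \<notin> L \<and> z \<noteq> 0"
proof -
  have "open (- L0)" by (rule open_compl) auto
  hence "eventually (\<lambda>z. z \<in> - L0 - {0}) (at 0)"
    by (intro eventually_at_in_open) auto
  thus ?thesis by eventually_elim auto
qed

text \<open>The numbers are those of the expansion
  \<open>3 * G 4 * z\<^sup>2 + 5 * G 6 * z ^ 4\<close> of \<open>reg\<close> and of its derivatives;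
  the odd powers drop out by the symmetry of the lattice.\<close>

lemma reg_limits:
  "(reg \<longlongrightarrow> 0) (at 0)"
  "(reg_deriv_seq 1 \<longlongrightarrow> 0) (at 0)"
  "((\<lambda>z. reg_deriv_seq 2 z - 6 * G 4) \<longlongrightarrow> 0) (at 0)"
  "((\<lambda>z. (reg z - 3 * G 4 * z\<^sup>2) / z\<^sup>2) \<longlongrightarrow> 0) (at 0)"
  "((\<lambda>z. (reg z - 3 * G 4 * z\<^sup>2 - 5 * G 6 * z ^ 4) / z ^ 4) \<longlongrightarrow> 0) (at 0)"
  "((\<lambda>z. (reg_deriv_seq 1 z - 6 * G 4 * z - 20 * G 6 * z ^ 3) / z ^ 3) \<longlongrightarrow> 0) (at 0)"
proof -
  have reg: "reg = reg_deriv_seq 0" by (simp add: reg_deriv_seq_def fun_eq_iff)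
  have vals: "reg_deriv_seq 0 0 = 0" "reg_deriv_seq 1 0 = 0" "reg_deriv_seq (Suc 0) 0 = 0"
    "reg_deriv_seq 2 0 = 6 * G 4" "reg_deriv_seq 3 0 = 0" "reg_deriv_seq 4 0 = 120 * G 6"
    by (simp_all add: reg_deriv_seq_0 G_odd fact_numeral)
  have vals2: "reg_deriv_seq (Suc (Suc 0)) 0 = 6 * G 4"
    using vals(4) by (simp only: numeral_2_eq_2[symmetric])
  show "(reg \<longlongrightarrow> 0) (at 0)" "(reg_deriv_seq 1 \<longlongrightarrow> 0) (at 0)"
    "((\<lambda>z. reg_deriv_seq 2 z - 6 * G 4) \<longlongrightarrow> 0) (at 0)"
    using reg_Taylor[of 0 0] reg_Taylor[of 1 0] reg_Taylor[of 2 0] by (simp_all add: reg vals)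
  show "((\<lambda>z. (reg z - 3 * G 4 * z\<^sup>2) / z\<^sup>2) \<longlongrightarrow> 0) (at 0)"
    using reg_Taylor[of 0 2] by (simp add: reg vals atMost_nat_numeral mult_ac)
  show "((\<lambda>z. (reg z - 3 * G 4 * z\<^sup>2 - 5 * G 6 * z ^ 4) / z ^ 4) \<longlongrightarrow> 0) (at 0)"
    using reg_Taylor[of 0 4]
    by (simp add: reg vals vals2 atMost_nat_numeral fact_numeral add_ac mult_ac diff_diff_eq)
  show "((\<lambda>z. (reg_deriv_seq 1 z - 6 * G 4 * z - 20 * G 6 * z ^ 3) / z ^ 3) \<longlongrightarrow> 0) (at 0)"
    using reg_Taylor[of 1 3]
    by (simp add: reg vals vals2 atMost_nat_numeral fact_numeral add_ac mult_ac diff_diff_eq)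
qed

text \<open>The difference of the two sides is elliptic, and at the origin its poles cancel and its
  limit is 0.\<close>

theorem wp_second_order:
  assumes "z \<notin> L"
  shows "wp2 z = 6 * (wp z)\<^sup>2 - 30 * G 4"
proof -
  \<comment> \<open>The poles of order four cancel. The cross term
    \<open>12 * reg z / z\<^sup>2\<close> tends to \<open>36 * G 4\<close>, and the multiples of
    \<open>G 4\<close> balance: \<open>6 - 36 + 30 = 0\<close>.\<close>
  have lim: "((\<lambda>z. (reg_deriv_seq 2 z - 6 * G 4) - 12 * ((reg z - 3 * G 4 * z\<^sup>2) / z\<^sup>2) - 6 * (reg z)\<^sup>2) \<longlongrightarrow> 0) (at 0)"
    by (rule tendsto_eq_intros reg_limits refl | simp)+
  have lim0: "((\<lambda>z. wp2 z - 6 * (wp z)\<^sup>2 + 30 * G 4) \<longlongrightarrow> 0) (at 0)"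
  proof (rule Lim_transform_eventually[OF lim])
    show "\<forall>\<^sub>F z in at 0. (reg_deriv_seq 2 z - 6 * G 4) - 12 * ((reg z - 3 * G 4 * z\<^sup>2) / z\<^sup>2) - 6 * (reg z)\<^sup>2
        = wp2 z - 6 * (wp z)\<^sup>2 + 30 * G 4"
      using eventually_notin_L
    proof eventually_elim
      case (elim z)
      define x where "x = 1 / z"
      have x: "1 / z\<^sup>2 = x\<^sup>2" "6 / z ^ 4 = 6 * x ^ 4" "(reg z - 3 * G 4 * z\<^sup>2) / z\<^sup>2 = x\<^sup>2 * reg z - 3 * G 4"
        using elim by (simp_all add: x_def field_simps)
      show ?case
        using elim unfolding wp2_eq_reg[OF conjunct1[OF elim]] wp_eq_reg x
        by (simp add: power2_eq_square power4_eq_xxxx algebra_simps)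
    qed
  qed
  have "wp2 z - 6 * (wp z)\<^sup>2 + 30 * G 4 = 0"
    by (rule elliptic_const[OF _ _ _ lim0 assms])
       (auto intro!: holomorphic_intros holomorphic_L simp: wp_period1 wp_period2 wp2_periodic full_periods)
  thus ?thesis by (simp add: algebra_simps)
qed

theorem wp_first_order:
  assumes "z \<notin> L"
  shows "(wp1 z)\<^sup>2 = 4 * wp z ^ 3 - 60 * G 4 * wp z - 140 * G 6"
proof -
  let ?s1 = "\<lambda>z. (reg z - 3 * G 4 * z\<^sup>2 - 5 * G 6 * z ^ 4) / z ^ 4"
  let ?s2 = "\<lambda>z. (reg_deriv_seq 1 z - 6 * G 4 * z - 20 * G 6 * z ^ 3) / z ^ 3"
  \<comment> \<open>\<open>?h\<close> is what remains after three cancellations: the poles of order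
    six, the poles of order two by \<open>- 24 - 36 + 60 = 0\<close> (multiples of
    \<open>G 4\<close>), and the constants by \<open>- 80 - 60 + 140 = 0\<close> (multiples of
    \<open>G 6\<close>).\<close>
  let ?h = "\<lambda>z. - 4 * ?s2 z - 12 * ?s1 z + (reg_deriv_seq 1 z)\<^sup>2
      - 12 * (z\<^sup>2 * (3 * G 4 + 5 * G 6 * z\<^sup>2 + z\<^sup>2 * ?s1 z)\<^sup>2) - 4 * reg z ^ 3 + 60 * G 4 * reg z"
  have lim: "(?h \<longlongrightarrow> 0) (at 0)"
    by (rule tendsto_eq_intros reg_limits refl | simp)+
  have lim0: "((\<lambda>z. (wp1 z)\<^sup>2 - 4 * wp z ^ 3 + 60 * G 4 * wp z + 140 * G 6) \<longlongrightarrow> 0) (at 0)"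
  proof (rule Lim_transform_eventually[OF lim])
    show "\<forall>\<^sub>F z in at 0. ?h z = (wp1 z)\<^sup>2 - 4 * wp z ^ 3 + 60 * G 4 * wp z + 140 * G 6"
      using eventually_notin_L
    proof eventually_elim
      case (elim z)
      define x s1 s2 r d where "x = 1 / z" "s1 = ?s1 z" "s2 = ?s2 z" "r = reg z" "d = reg_deriv_seq 1 z"
      note defs = this
      have "z * x = 1" using elim by (simp add: defs)
      have r: "r = z\<^sup>2 * (3 * G 4 + 5 * G 6 * z\<^sup>2 + z\<^sup>2 * s1)"
        using elim by (simp add: defs field_simps flip: power_add)
      have d: "d = 6 * G 4 * z + 20 * G 6 * z ^ 3 + z ^ 3 * s2"
        using elim by (simp add: defs field_simps)
      have xd: "x ^ 3 * d = 6 * G 4 * x\<^sup>2 + 20 * G 6 + s2"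
        and xr: "x ^ 4 * r = 3 * G 4 * x\<^sup>2 + 5 * G 6 + s1"
        and xr2: "x\<^sup>2 * r\<^sup>2 = z\<^sup>2 * (3 * G 4 + 5 * G 6 * z\<^sup>2 + z\<^sup>2 * s1)\<^sup>2"
        unfolding r d using \<open>z * x = 1\<close> by algebra+
      have wp: "wp z = x\<^sup>2 + r" "wp1 z = - 2 * x ^ 3 + d"
        using elim by (simp_all add: wp_eq_reg wp1_eq_reg defs power_divide)
      have "(wp1 z)\<^sup>2 - 4 * wp z ^ 3 + 60 * G 4 * wp z + 140 * G 6
          = - 4 * (x ^ 3 * d) + d\<^sup>2 - 12 * (x ^ 4 * r) - 12 * (x\<^sup>2 * r\<^sup>2) - 4 * r ^ 3
            + 60 * G 4 * x\<^sup>2 + 60 * G 4 * r + 140 * G 6"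
        unfolding wp by (simp add: power2_eq_square power3_eq_cube power4_eq_xxxx algebra_simps)
      also have "\<dots> = - 4 * s2 - 12 * s1 + d\<^sup>2
          - 12 * (z\<^sup>2 * (3 * G 4 + 5 * G 6 * z\<^sup>2 + z\<^sup>2 * s1)\<^sup>2) - 4 * r ^ 3 + 60 * G 4 * r"
        unfolding xd xr xr2 by (simp add: algebra_simps)
      also have "\<dots> = ?h z"
        by (simp only: defs)
      finally show ?case ..
    qed
  qed
  have "(wp1 z)\<^sup>2 - 4 * wp z ^ 3 + 60 * G 4 * wp z + 140 * G 6 = 0"
    by (rule elliptic_const[OF _ _ _ lim0 assms])
       (auto intro!: holomorphic_intros holomorphic_L simp: wp_period1 wp_period2 wp1_periodic full_periods)
  thus ?thesis by (simp add: algebra_simps)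
qed

section \<open>Reality on the line through the imaginary half-period\<close>

lemma wp_cnj: "cnj (wp z) = wp (cnj z)"
proof -
  have bij: "bij_betw cnj L0 L0"
    by (rule bij_betwI[where g = cnj]; auto)+
  have "cnj (reg z) = (\<Sum>\<^sub>\<infinity>l\<in>L0. 1 / (cnj z - cnj l)\<^sup>2 - 1 / (cnj l)\<^sup>2)"
    unfolding reg_def infsum_cnj[symmetric] by simp
  also have "\<dots> = reg (cnj z)"
    unfolding reg_def by (rule infsum_reindex_bij_betw[OF bij])
  finally show ?thesis by (simp add: wp_eq_reg)
qed

text \<open>Conjugation sends \<open>\<tau> + w'\<close> to \<open>\<tau> - w'\<close>, and these
  two points differ by the period \<open>2 * w'\<close>.\<close>

lemma Im_wp_line: "Im (wp (of_real \<tau> + w')) = 0"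
proof -
  have "cnj w' = - w'" using w' by (simp add: complex_eq_iff)
  have eq: "of_real \<tau> + w' = of_real \<tau> - w' + 2 * w'" by simp
  have "of_real \<tau> - w' \<notin> L"
    using half_periods_notin(2)[of \<tau>] L_add_iff[OF full_periods(2), of "of_real \<tau> - w'"] unfolding eq by blast
  hence "wp (of_real \<tau> + w') = wp (of_real \<tau> - w')"
    unfolding eq by (rule wp_period2)
  also have "\<dots> = cnj (wp (of_real \<tau> + w'))"
    unfolding wp_cnj by (simp add: \<open>cnj w' = - w'\<close>)
  finally have "wp (of_real \<tau> + w') = cnj (wp (of_real \<tau> + w'))" .
  from arg_cong[OF this, of Im] show ?thesis by simp
qed

lemma wp_line_deriv:
  "((\<lambda>\<tau>. wp (of_real \<tau> + w')) has_vector_derivative wp1 (of_real \<tau> + w')) (at \<tau>)"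
  "((\<lambda>\<tau>. wp1 (of_real \<tau> + w')) has_vector_derivative wp2 (of_real \<tau> + w')) (at \<tau>)"
proof -
  show "((\<lambda>\<tau>. wp (of_real \<tau> + w')) has_vector_derivative wp1 (of_real \<tau> + w')) (at \<tau>)"
    by (rule has_vector_derivative_real_field)
       (use wp_deriv[OF half_periods_notin(2)[of \<tau>]] in \<open>simp add: DERIV_shift\<close>)
  show "((\<lambda>\<tau>. wp1 (of_real \<tau> + w')) has_vector_derivative wp2 (of_real \<tau> + w')) (at \<tau>)"
    by (rule has_vector_derivative_real_field)
       (use wp1_deriv[OF half_periods_notin(2)[of \<tau>]] in \<open>simp add: DERIV_shift\<close>)
qed

lemma has_real_derivative_Re_Im:
  assumes "(f has_vector_derivative d) (at t)"
  shows "((\<lambda>t. Re (f t)) has_real_derivative Re d) (at t)" "((\<lambda>t. Im (f t)) has_real_derivative Im d) (at t)"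
  using bounded_linear.has_vector_derivative[OF bounded_linear_Re assms]
    bounded_linear.has_vector_derivative[OF bounded_linear_Im assms]
  by (simp_all add: has_real_derivative_iff_has_vector_derivative)

lemma Im_wp1_line: "Im (wp1 (of_real \<tau> + w')) = 0"
proof -
  have "((\<lambda>\<tau>. 0) has_real_derivative Im (wp1 (of_real \<tau> + w'))) (at \<tau>)"
    using has_real_derivative_Re_Im(2)[OF wp_line_deriv(1), of \<tau>] by (simp add: Im_wp_line)
  thus ?thesis
    using DERIV_unique DERIV_const by blast
qed

end

theorem wp_shifted_ode:
  assumes "half_periods \<theta> w w'"
  obtains V' where
    "\<And>\<tau>. (wp_shifted w w' has_real_derivative V' \<tau>) (at \<tau>)"
    "\<And>\<tau>. (V' has_real_derivative 6 * (wp_shifted w w' \<tau>)\<^sup>2 - 1 / 24) (at \<tau>)"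
    "\<And>\<tau>. (V' \<tau>)\<^sup>2 = 4 * wp_shifted w w' \<tau> ^ 3 - wp_shifted w w' \<tau> / 12 + cos (3 * \<theta>) / 216"
    "0 < w" "\<And>\<tau>. wp_shifted w w' (\<tau> + 2 * w) = wp_shifted w w' \<tau>"
proof -
  interpret rectangular_lattice w w'
    using assms by unfold_locales (auto simp: half_periods_def)
  have G4: "60 * G 4 = of_real (1 / 12)" and G6: "140 * G 6 = of_real (- cos (3 * \<theta>) / 216)"
    using assms by (simp_all add: half_periods_def lattice_g2_def lattice_g3_def G_def L_def)
  have V: "wp_shifted w w' \<tau> = Re (wp (of_real \<tau> + w'))" for \<tau>
    by (simp add: wp_shifted_def L_def)
  define V' where "V' = (\<lambda>\<tau>::real. Re (wp1 (of_real \<tau> + w')))"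
  have wp: "wp (of_real \<tau> + w') = of_real (wp_shifted w w' \<tau>)" "wp1 (of_real \<tau> + w') = of_real (V' \<tau>)" for \<tau>
    using Im_wp_line[of \<tau>] Im_wp1_line[of \<tau>] by (simp_all add: complex_eq_iff V V'_def)
  have "wp2 (of_real \<tau> + w') = of_real (6 * (wp_shifted w w' \<tau>)\<^sup>2 - 1 / 24)" for \<tau>
  proof -
    have "30 * G 4 = of_real (1 / 24)" using G4 by (simp add: field_simps)
    thus ?thesis
      using wp_second_order[OF half_periods_notin(2)[of \<tau>]] by (simp add: wp)
  qed
  hence 2: "(V' has_real_derivative 6 * (wp_shifted w w' \<tau>)\<^sup>2 - 1 / 24) (at \<tau>)" for \<tau>
    using has_real_derivative_Re_Im(1)[OF wp_line_deriv(2), of \<tau>] by (simp add: V'_def[symmetric])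
  have 1: "(wp_shifted w w' has_real_derivative V' \<tau>) (at \<tau>)" for \<tau>
    using has_real_derivative_Re_Im(1)[OF wp_line_deriv(1), of \<tau>] by (simp add: V'_def V[symmetric])
  have 3: "(V' \<tau>)\<^sup>2 = 4 * wp_shifted w w' \<tau> ^ 3 - wp_shifted w w' \<tau> / 12 + cos (3 * \<theta>) / 216" for \<tau>
  proof -
    have "of_real ((V' \<tau>)\<^sup>2) = (of_real (4 * wp_shifted w w' \<tau> ^ 3 - wp_shifted w w' \<tau> / 12 + cos (3 * \<theta>) / 216) :: complex)"
      using wp_first_order[OF half_periods_notin(2)[of \<tau>]] unfolding G4 G6 wp by simp
    thus ?thesis by (simp only: of_real_eq_iff)
  qed
  have 4: "wp_shifted w w' (\<tau> + 2 * w) = wp_shifted w w' \<tau>" for \<tau>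
    using wp_period1[OF half_periods_notin(2)[of \<tau>]] by (simp add: V add_ac)
  show thesis
    by (rule that[OF 1 2 3 w 4])
qed

section \<open>Critical spacetimes\<close>

lemma conformal_time_deriv:
  assumes I: "open_interval I" and t: "t0 \<in> I" "t \<in> I"
    and s: "continuous_on I s" "\<And>u. u \<in> I \<Longrightarrow> s u \<noteq> 0"
  shows "(conformal_time s t0 has_real_derivative 1 / s t) (at t)"
proof -
  have I': "open I" "is_interval I" using I by (auto simp: open_interval_def)
  obtain d where d: "0 < d" "ball (min t0 t) d \<subseteq> I" "ball (max t0 t) d \<subseteq> I"
  proof -
    obtain d1 d2 where "0 < d1" "ball (min t0 t) d1 \<subseteq> I" "0 < d2" "ball (max t0 t) d2 \<subseteq> I"
      using I'(1) t open_contains_ball[of I] by (metis max_def min_def)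
    thus thesis by (intro that[of "min d1 d2"]) (auto simp: subset_iff)
  qed
  \<comment> \<open>Widening both ends by \<open>d / 2\<close> makes \<open>t\<close> an interior
    point of an interval that also contains \<open>t0\<close>, whichever of the two comes
    first.\<close>
  define l r where "l = min t0 t - d / 2" "r = max t0 t + d / 2"
  have "l \<in> ball (min t0 t) d" "r \<in> ball (max t0 t) d"
    using d(1) by (auto simp: l_r_def dist_real_def)
  hence "l \<in> I" "r \<in> I" using d by auto
  have sub: "{l..r} \<subseteq> I"
  proof
    fix x assume "x \<in> {l..r}"
    thus "x \<in> I" using mem_is_interval_1_I[OF I'(2) \<open>l \<in> I\<close> \<open>r \<in> I\<close>, of x] by simp
  qed
  have lr: "l < t0" "t0 < r" "l < t" "t < r" using d(1) by (auto simp: l_r_def)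
  have "continuous_on {l..r} (\<lambda>u. 1 / s u)"
    using sub s by (intro continuous_intros continuous_on_subset[OF s(1)]) auto
  hence "((\<lambda>u. LBINT y=t0..u. 1 / s y) has_vector_derivative 1 / s t) (at t within {l..r})"
    by (intro interval_integral_FTC2) (use lr in auto)
  hence "(conformal_time s t0 has_vector_derivative 1 / s t) (at t within {l..r})"
    by (simp add: conformal_time_def[abs_def])
  thus ?thesis
    using lr by (simp add: at_within_Icc_at has_real_derivative_iff_has_vector_derivative)
qed

text \<open>Functions of the form \<open>poly p (S y) + poly q (S y) * S1 y\<close> are closed under
  differentiation, since the square and the derivative of \<open>S1\<close> are polynomials in
  \<open>S\<close>. Iterating \<open>?D\<close> on the pair of coefficients gives every
  derivative.\<close>

lemma smooth_poly_ode:
  fixes S S1 :: "real \<Rightarrow> real"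
  assumes S: "\<And>y. (S has_real_derivative S1 y) (at y)"
    and S1: "\<And>y. (S1 has_real_derivative poly R (S y)) (at y)"
    and first: "\<And>y. (S1 y)\<^sup>2 = poly Q (S y)"
  shows "smooth_real_on A (\<lambda>y. poly p (S y))"
proof -
  let ?f = "\<lambda>(p, q) y. poly p (S y) + poly q (S y) * S1 y"
  let ?D = "\<lambda>(p, q). (pderiv q * Q + q * R, pderiv p)"
  have deriv: "(?f pq has_real_derivative ?f (?D pq) y) (at y)" for pq y
  proof -
    obtain p q where pq: "pq = (p, q)" by force
    have chain: "((\<lambda>y. poly p (S y)) has_real_derivative poly (pderiv p) (S y) * S1 y) (at y)" for p
      by (rule DERIV_chain2[OF poly_DERIV S])
    have "((\<lambda>y. poly p (S y) + poly q (S y) * S1 y) has_real_derivative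
        poly (pderiv p) (S y) * S1 y + (poly (pderiv q) (S y) * S1 y * S1 y + poly R (S y) * poly q (S y))) (at y)"
      by (intro DERIV_add DERIV_mult chain S1)
    also have "poly (pderiv p) (S y) * S1 y + (poly (pderiv q) (S y) * S1 y * S1 y + poly R (S y) * poly q (S y))
        = ?f (?D pq) y"
      using first[of y] by (simp add: pq power2_eq_square algebra_simps)
    finally show ?thesis by (simp add: pq)
  qed
  have iter: "(deriv ^^ n) (?f pq) = ?f ((?D ^^ n) pq)" for n pq
  proof (induction n)
    case (Suc n)
    have "deriv (?f ((?D ^^ n) pq)) = ?f (?D ((?D ^^ n) pq))"
      by (rule ext) (rule DERIV_imp_deriv[OF deriv])
    thus ?case by (simp add: Suc)
  qed simp
  have base: "(\<lambda>y. poly p (S y)) = ?f (p, 0)" by simp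
  show ?thesis
    unfolding smooth_real_on_def base
  proof (intro allI ballI)
    fix n y
    show "(deriv ^^ n) (?f (p, 0)) differentiable (at y)"
      unfolding iter real_differentiable_def by (rule exI, rule deriv)
  qed
qed

lemma lorentz_form_conformal_metric:
  assumes "S (fst p) \<noteq> 0"
  shows "lorentz_form (tangent_space p) (conformal_metric S p)"
  unfolding lorentz_form_def
proof (intro conjI ballI allI impI)
  fix u v assume "u \<in> tangent_space p" "v \<in> tangent_space p"
  show "conformal_metric S p u v = conformal_metric S p v u"
    by (simp add: conformal_metric_def product_metric_def inner_commute mult.commute)
next
  fix u v w :: "real \<times> (real ^ 4)" and x y :: real
  show "conformal_metric S p (x *\<^sub>R u + y *\<^sub>R v) w = x * conformal_metric S p u w + y * conformal_metric S p v w"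
    by (simp add: conformal_metric_def product_metric_def inner_add_left algebra_simps)
next
  fix v assume v: "v \<in> tangent_space p" "\<forall>w\<in>tangent_space p. conformal_metric S p v w = 0"
  \<comment> \<open>Reversing the time component in the second argument turns the product metric
    into the squared Euclidean norm of \<open>v\<close>.\<close>
  have "(- fst v, snd v) \<in> tangent_space p"
    using v(1) by (auto simp: tangent_space_def)
  hence "product_metric v (- fst v, snd v) = 0"
    using v(2) assms by (fastforce simp: conformal_metric_def)
  hence "(fst v)\<^sup>2 + (norm (snd v))\<^sup>2 = 0"
    by (simp add: product_metric_def power2_eq_square flip: power2_norm_eq_inner)
  thus "v = 0" by (simp add: sum_power2_eq_zero_iff prod_eq_iff)
next
  let ?e = "(1, 0) :: real \<times> (real ^ 4)"
  have "?e \<in> tangent_space p" by (simp add: tangent_space_def)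
  moreover have "conformal_metric S p ?e ?e < 0"
    using assms by (simp add: conformal_metric_def product_metric_def)
  moreover have "0 < conformal_metric S p w w" if w: "conformal_metric S p ?e w = 0 \<and> w \<noteq> 0" for w
  proof -
    have "fst w = 0" using w assms by (simp add: conformal_metric_def product_metric_def)
    thus ?thesis using w assms by (auto simp: conformal_metric_def product_metric_def prod_eq_iff)
  qed
  ultimately show "\<exists>v\<in>tangent_space p. conformal_metric S p v v < 0 \<and>
      (\<forall>w\<in>tangent_space p. conformal_metric S p v w = 0 \<and> w \<noteq> 0 \<longrightarrow> 0 < conformal_metric S p w w)"
    by blast
qed

text \<open>The discriminant is \<open>x * (4 - 9 * x) / 48\<close> with
  \<open>x = a * H\<^sup>2\<close>.\<close>

lemma class_I_bounds:
  assumes "class_I a H"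
  shows "0 < a * H\<^sup>2" "a * H\<^sup>2 < 4 / 9"
proof -
  define x where "x = a * H\<^sup>2"
  have "0 < x * (4 / 9 - x)"
    using assms by (simp add: class_I_def g2_inv_def g3_inv_def flip: x_def) (simp add: power2_eq_square power3_eq_cube field_simps)
  thus "0 < a * H\<^sup>2" "a * H\<^sup>2 < 4 / 9"
    unfolding x_def[symmetric] by (auto simp: zero_less_mult_iff)
qed

lemma angular_parameter_invariant:
  assumes "angular_parameter a H \<theta>"
  shows "g3_inv a H = - cos (3 * \<theta>) / 216"
proof -
  have "4 * e1 \<theta> ^ 3 - g2_inv * e1 \<theta> - g3_inv a H = 0"
    using assms by (auto simp: angular_parameter_def)
  thus ?thesis using cubic_e1[of \<theta>] by (simp add: g2_inv_def)
qed

text \<open>The hypothesis supplies only the set of roots. As \<open>e1\<close>, \<open>e2\<close>,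
  \<open>e3\<close> sum to zero, the cubic and the product differ by an affine function; it vanishes
  at two distinct points and hence everywhere.\<close>

lemma angular_parameter_cubic_ode:
  assumes "angular_parameter a H \<theta>"
  shows "cubic_ode (e1 \<theta>) (e2 \<theta>) (e3 \<theta>) (1 / 12) (g3_inv a H)"
proof
  show "e3 \<theta> < e2 \<theta>" "e2 \<theta> < e1 \<theta>" using assms by (auto simp: angular_parameter_def)
  define \<alpha> \<beta> where "\<alpha> = - (1 / 12) - 4 * (e1 \<theta> * e2 \<theta> + e1 \<theta> * e3 \<theta> + e2 \<theta> * e3 \<theta>)"
    "\<beta> = - g3_inv a H + 4 * e1 \<theta> * e2 \<theta> * e3 \<theta>"
  have expand: "4 * v ^ 3 - 1 / 12 * v - g3_inv a H - 4 * (v - e1 \<theta>) * (v - e2 \<theta>) * (v - e3 \<theta>) = \<alpha> * v + \<beta>" for v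
    unfolding \<alpha>_\<beta>_def e3_def by (simp add: power3_eq_cube algebra_simps)
  have "\<alpha> * e1 \<theta> + \<beta> = 0" "\<alpha> * e2 \<theta> + \<beta> = 0"
    using assms by (auto simp: angular_parameter_def g2_inv_def simp flip: expand)
  hence "\<alpha> * (e1 \<theta> - e2 \<theta>) = 0" unfolding right_diff_distrib by linarith
  hence "\<alpha> = 0" using \<open>e2 \<theta> < e1 \<theta>\<close> by simp
  moreover from this have "\<beta> = 0" using \<open>\<alpha> * e1 \<theta> + \<beta> = 0\<close> by simp
  ultimately show "4 * v ^ 3 - 1 / 12 * v - g3_inv a H = 4 * (v - e1 \<theta>) * (v - e2 \<theta>) * (v - e3 \<theta>)" for v
    using expand[of v] by simp
qed

locale critical_RW =
  fixes I :: "real set" and s :: "real \<Rightarrow> real" and \<Lambda> a H \<theta> t0 :: real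
  assumes RW: "closed_RW_spacetime I s \<Lambda>"
    and nonconst: "nonconstant_on I s"
    and internal: "internal_parameters I s a H"
    and H: "H < 0"
    and class_I: "class_I a H"
    and angular: "angular_parameter a H \<theta>"
    and t0: "t0 \<in> I"
begin

sublocale cubic_ode "e1 \<theta>" "e2 \<theta>" "e3 \<theta>" "1 / 12" "g3_inv a H"
  by (rule angular_parameter_cubic_ode[OF angular])

lemma \<theta>: "- pi / 3 < \<theta>" "\<theta> < 0"
  using angular by (auto simp: angular_parameter_def)

lemma a_pos: "0 < a"
  using class_I_bounds(1)[OF class_I] H by (simp add: zero_less_mult_iff)

lemma I: "open_interval I" "open I" "connected I"
  using RW by (auto simp: closed_RW_spacetime_def open_interval_def is_interval_connected_1)

abbreviation \<tau> :: "real \<Rightarrow> real" where "\<tau> \<equiv> conformal_time s t0"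
abbreviation J :: "real set" where "J \<equiv> conformal_domain I s t0"
abbreviation T :: "real \<Rightarrow> real" where "T \<equiv> the_inv_into I \<tau>"
abbreviation S :: "real \<Rightarrow> real" where "S \<equiv> conformal_scale I s t0"

lemma \<tau>_cont: "continuous_on I \<tau>" and \<tau>_inj: "inj_on \<tau> I"
  and T_diff: "y \<in> J \<Longrightarrow> T differentiable (at y)" and S_diff: "y \<in> J \<Longrightarrow> S differentiable (at y)"
  and max: "maximal_domain J S" and s_nonneg: "t \<in> I \<Longrightarrow> 0 \<le> s t"
  and density_nonneg: "t \<in> I \<Longrightarrow> 0 < s t \<Longrightarrow> 0 \<le> energy_density \<Lambda> s t"
  and s_smooth: "smooth_real_on {t\<in>I. 0 < s t} s"
  using RW t0 unfolding closed_RW_spacetime_def by (auto intro: strict_mono_on_imp_inj_on)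

lemma T_\<tau> [simp]: "t \<in> I \<Longrightarrow> T (\<tau> t) = t"
  by (rule the_inv_into_f_f[OF \<tau>_inj])

lemma T_in_I: "y \<in> J \<Longrightarrow> T y \<in> I"
  by (auto simp: conformal_domain_def)

lemma \<tau>_T [simp]: "y \<in> J \<Longrightarrow> \<tau> (T y) = y"
  by (auto simp: conformal_domain_def)

lemma S_eq: "S y = s (T y)"
  by (simp add: conformal_scale_def)

text \<open>Smoothness of \<open>s\<close> is granted only where it is positive, so continuity at a
  possible zero has to come from \<open>S\<close>: it is differentiable, and \<open>s\<close> is
  \<open>S\<close> composed with conformal time.\<close>

lemma s_cont: "continuous_on I s"
proof -
  have "continuous_on J S"
    using S_diff by (meson continuous_at_imp_continuous_on differentiable_imp_continuous_within)
  hence "continuous_on I (\<lambda>t. S (\<tau> t))"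
    by (rule continuous_on_compose2[OF _ \<tau>_cont]) (auto simp: conformal_domain_def)
  thus ?thesis by (rule continuous_on_eq) (simp add: S_eq)
qed

lemma internal_eq: "t \<in> I \<Longrightarrow> 0 < s t \<Longrightarrow> s t * ((deriv s t)\<^sup>2 + a / 3 * (s t)\<^sup>2 - 1) = H"
  using internal by (auto simp: internal_parameters_def)

lemma s_ge_if_pos:
  assumes "t \<in> I" "0 < s t"
  shows "- H \<le> s t"
proof -
  have "0 \<le> s t * ((deriv s t)\<^sup>2 + a / 3 * (s t)\<^sup>2)"
    using assms a_pos by (intro mult_nonneg_nonneg add_nonneg_nonneg) auto
  thus ?thesis using internal_eq[OF assms] by (simp add: algebra_simps)
qed

text \<open>Zeros of \<open>s\<close> are excluded by connectedness: \<open>s\<close> takes no value strictly between \<open>0\<close> and \<open>- H\<close>.\<close>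

lemma s_ge: "t \<in> I \<Longrightarrow> - H \<le> s t"
proof (rule ccontr)
  assume t: "t \<in> I" "\<not> - H \<le> s t"
  hence "s t = 0" using s_ge_if_pos[OF t(1)] s_nonneg[OF t(1)] by fastforce
  have "\<not> (\<forall>u\<in>I. s u = 0)" using nonconst unfolding nonconstant_on_def by blast
  then obtain u where u: "u \<in> I" "s u \<noteq> 0" by blast
  hence "- H \<le> s u" using s_ge_if_pos[OF u(1)] s_nonneg[OF u(1)] by linarith
  have "connected (s ` I)" by (rule connected_continuous_image[OF s_cont I(3)])
  hence "- H / 2 \<in> s ` I"
    using connectedD_interval[of "s ` I" "s t" "s u" "- H / 2"] t u H \<open>s t = 0\<close> \<open>- H \<le> s u\<close> by auto
  then obtain v where "v \<in> I" "s v = - H / 2" by auto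
  thus False using s_ge_if_pos[of v] H by auto
qed

lemma s_pos: "t \<in> I \<Longrightarrow> 0 < s t"
  using s_ge[of t] H by linarith

section \<open>Derivatives of the scale function in proper time\<close>

definition s1 :: "real \<Rightarrow> real" where "s1 = deriv s"

definition s2 :: "real \<Rightarrow> real" where "s2 = deriv s1"

lemma smooth: "t \<in> I \<Longrightarrow> (deriv ^^ n) s differentiable (at t)"
  using s_smooth s_pos by (auto simp: smooth_real_on_def)

lemma s_deriv: "t \<in> I \<Longrightarrow> (s has_real_derivative s1 t) (at t)"
  and s1_deriv: "t \<in> I \<Longrightarrow> (s1 has_real_derivative s2 t) (at t)"
  and s2_cont: "continuous_on I s2"
proof -
  show "t \<in> I \<Longrightarrow> (s has_real_derivative s1 t) (at t)"
    using smooth[of t 0] by (simp add: s1_def DERIV_deriv_iff_real_differentiable)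
  show "t \<in> I \<Longrightarrow> (s1 has_real_derivative s2 t) (at t)"
    using smooth[of t 1] by (simp add: s1_def s2_def DERIV_deriv_iff_real_differentiable)
  have "t \<in> I \<Longrightarrow> s2 differentiable (at t)" for t
    using smooth[of t 2] by (simp add: s1_def s2_def numeral_2_eq_2)
  thus "continuous_on I s2"
    by (meson continuous_at_imp_continuous_on differentiable_imp_continuous_within)
qed

lemma first_order: "t \<in> I \<Longrightarrow> (s1 t)\<^sup>2 = 1 - a / 3 * (s t)\<^sup>2 + H / s t"
  using internal_eq[of t] s_pos[of t] by (simp add: s1_def field_simps)

lemma second_order:
  assumes t: "t \<in> I"
  shows "s2 t = - a / 3 * s t - H / (2 * (s t)\<^sup>2)"
proof -
  have "s2 t = (- (2 * a / 3) * s t - H / (s t)\<^sup>2) / 2"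
  proof (rule first_integral_imp_second_order[OF I(2,3) s_deriv s1_deriv s2_cont, where F = "\<lambda>v. 1 - a / 3 * v\<^sup>2 + H / v"
        and F' = "\<lambda>v. - (2 * a / 3) * v - H / v\<^sup>2", OF _ _ first_order _ _ _ _ t])
    fix u assume u: "u \<in> I"
    have "s u \<noteq> 0" using s_pos[OF u] by simp
    thus "((\<lambda>v. 1 - a / 3 * v\<^sup>2 + H / v) has_real_derivative - (2 * a / 3) * s u - H / (s u)\<^sup>2) (at (s u))"
      by (auto intro!: derivative_eq_intros simp: power2_eq_square field_simps)
    \<comment> \<open>A common zero of \<open>F\<close> and \<open>F'\<close> would be
      \<open>s u = - (3 / 2) * H\<close>, which gives \<open>a * H\<^sup>2 = 4 / 9\<close>, the
      excluded boundary of Class I.\<close>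
    show "- (2 * a / 3) * s u - H / (s u)\<^sup>2 \<noteq> 0" if zero: "1 - a / 3 * (s u)\<^sup>2 + H / s u = 0"
    proof
      assume "- (2 * a / 3) * s u - H / (s u)\<^sup>2 = 0"
      hence 1: "2 * a / 3 * (s u) ^ 3 = - H"
        using \<open>s u \<noteq> 0\<close> by (simp add: field_simps power2_eq_square power3_eq_cube)
      have 2: "s u - a / 3 * (s u) ^ 3 + H = 0"
        using zero \<open>s u \<noteq> 0\<close> by (simp add: field_simps power2_eq_square power3_eq_cube)
      have su: "s u = - (3 / 2) * H" using 1 2 by simp
      have "H * (a * H\<^sup>2) = H * (4 / 9)"
        using 1 unfolding su by (simp add: power2_eq_square power3_eq_cube algebra_simps)
      hence "a * H\<^sup>2 = 4 / 9" using H by (simp only: mult_cancel_left) auto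
      thus False using class_I_bounds(2)[OF class_I] by simp
    qed
  next
    show "continuous_on I (\<lambda>t. - (2 * a / 3) * s t - H / (s t)\<^sup>2)"
      using s_pos by (intro continuous_intros s_cont) force
    show "\<exists>t\<in>I. s1 t \<noteq> 0"
    proof (rule ccontr)
      assume "\<not> ?thesis"
      hence "\<And>t. t \<in> I \<Longrightarrow> (s has_real_derivative 0) (at t)" using s_deriv by metis
      hence "s constant_on I"
        using I(2,3) has_field_derivative_0_imp_constant_on by blast
      thus False using nonconst by (auto simp: constant_on_def nonconstant_on_def)
    qed
  qed
  thus ?thesis by (simp add: diff_divide_distrib mult.commute)
qed

section \<open>Equations in conformal time\<close>

lemma \<tau>_deriv: "t \<in> I \<Longrightarrow> (\<tau> has_real_derivative 1 / s t) (at t)"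
  using conformal_time_deriv[OF I(1) t0 _ s_cont] s_pos by fastforce

lemma J_open_interval: "open_interval J"
  unfolding open_interval_def conformal_domain_def
  using invariance_of_domain[OF \<tau>_cont I(2) \<tau>_inj] connected_continuous_image[OF \<tau>_cont I(3)] t0
  by (auto simp: is_interval_connected_1)

lemma T_deriv:
  assumes y: "y \<in> J"
  shows "(T has_real_derivative s (T y)) (at y)"
proof -
  obtain D where D: "(T has_real_derivative D) (at y)"
    using T_diff[OF y] by (auto simp: real_differentiable_def)
  have "((\<lambda>y. \<tau> (T y)) has_real_derivative 1 / s (T y) * D) (at y)"
    by (rule DERIV_chain2[OF \<tau>_deriv[OF T_in_I[OF y]] D])
  hence "((\<lambda>y. y) has_real_derivative 1 / s (T y) * D) (at y)"
    by (rule has_field_derivative_transform_within_open[where S = J])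
       (use y J_open_interval in \<open>auto simp: open_interval_def\<close>)
  hence "1 / s (T y) * D = 1"
    using DERIV_ident DERIV_unique by blast
  hence "D = s (T y)" using s_pos[OF T_in_I[OF y]] by (simp add: field_simps)
  thus ?thesis using D by simp
qed

definition S1 :: "real \<Rightarrow> real" where "S1 y = s1 (T y) * s (T y)"

lemma S_deriv:
  assumes y: "y \<in> J"
  shows "(S has_real_derivative S1 y) (at y)"
  unfolding S_eq[abs_def] S1_def by (rule DERIV_chain2[OF s_deriv[OF T_in_I[OF y]] T_deriv[OF y]])

lemma S1_sq:
  assumes y: "y \<in> J"
  shows "(S1 y)\<^sup>2 = (S y)\<^sup>2 - a / 3 * S y ^ 4 + H * S y"
  unfolding S1_def S_eq power_mult_distrib first_order[OF T_in_I[OF y]]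
  using s_pos[OF T_in_I[OF y]] by (simp add: field_simps power2_eq_square power4_eq_xxxx)

lemma S1_deriv:
  assumes y: "y \<in> J"
  shows "(S1 has_real_derivative S y - 2 * a / 3 * S y ^ 3 + H / 2) (at y)"
proof -
  note t = T_in_I[OF y]
  have "((\<lambda>y. s1 (T y) * s (T y)) has_real_derivative
      s2 (T y) * s (T y) * s (T y) + s1 (T y) * s (T y) * s1 (T y)) (at y)"
    by (intro DERIV_mult DERIV_chain2[OF s1_deriv[OF t] T_deriv[OF y]]
        DERIV_chain2[OF s_deriv[OF t] T_deriv[OF y]])
  also have "s2 (T y) * s (T y) * s (T y) + s1 (T y) * s (T y) * s1 (T y)
      = s2 (T y) * (s (T y))\<^sup>2 + (s1 (T y))\<^sup>2 * s (T y)"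
    by (simp add: power2_eq_square)
  also have "\<dots> = S y - 2 * a / 3 * S y ^ 3 + H / 2"
    unfolding second_order[OF t] first_order[OF t] S_eq
    using s_pos[OF t] by (simp add: field_simps power2_eq_square power3_eq_cube)
  finally show ?thesis by (simp add: S1_def[abs_def])
qed

lemma S_ge: "y \<in> J \<Longrightarrow> - H \<le> S y"
  unfolding S_eq by (rule s_ge[OF T_in_I])

lemma S_le:
  assumes y: "y \<in> J"
  shows "a * (S y)\<^sup>2 \<le> 3"
proof -
  have "0 \<le> 1 - a / 3 * (s (T y))\<^sup>2 + H / s (T y)"
    using zero_le_power2[of "s1 (T y)"] unfolding first_order[OF T_in_I[OF y]] .
  moreover have "H / s (T y) < 0" using H s_pos[OF T_in_I[OF y]] by (simp add: divide_neg_pos)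
  ultimately show ?thesis by (simp add: S_eq)
qed

lemma J_eq_UNIV: "J = UNIV"
proof (rule maximal_domain_eq_UNIV[OF J_open_interval max S_deriv S1_deriv])
  \<comment> \<open>The crude estimate \<open>S y \<le> 1 + (S y)\<^sup>2\<close> gives the upper
    bound \<open>1 + 3 / a\<close> without square roots.\<close>
  define M where "M = 1 + 3 / a"
  fix y assume y: "y \<in> J"
  have S: "0 < S y" using S_ge[OF y] H by linarith
  have "(S y)\<^sup>2 \<le> 3 / a" using S_le[OF y] a_pos by (simp add: field_simps)
  moreover have "S y \<le> 1 + (S y)\<^sup>2"
  proof -
    have "2 * S y \<le> (S y)\<^sup>2 + 1" using sum_squares_bound[of "S y" 1] by simp
    thus ?thesis using zero_le_power2[of "S y"] by linarith
  qed
  ultimately have "S y \<le> M" by (simp add: M_def)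
  define q where "q = a * (S y)\<^sup>2 * S y"
  have "q \<le> 3 * S y" unfolding q_def using S_le[OF y] S by (intro mult_right_mono) auto
  moreover have "0 \<le> q" using S a_pos by (simp add: q_def)
  ultimately have "\<bar>S y - 2 / 3 * q + H / 2\<bar> \<le> 2 * M - H"
    using \<open>S y \<le> M\<close> S H by (intro abs_leI) linarith+
  thus "\<bar>S y - 2 * a / 3 * S y ^ 3 + H / 2\<bar> \<le> 2 * (1 + 3 / a) - H"
    by (simp add: q_def M_def power2_eq_square power3_eq_cube mult.assoc)
  show "- H \<le> S y" by (rule S_ge[OF y])
qed (use H in auto)

lemmas on_UNIV = S_deriv[unfolded J_eq_UNIV, OF UNIV_I] S1_sq[unfolded J_eq_UNIV, OF UNIV_I]
  S1_deriv[unfolded J_eq_UNIV, OF UNIV_I] S_ge[unfolded J_eq_UNIV, OF UNIV_I]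

lemma S_pos: "0 < S y"
  using on_UNIV(4)[of y] H by linarith

text \<open>The classical substitution for a quartic \<open>Q\<close> with a known root, here
  \<open>Q(S) = S^2 - a/3 S^4 + H S\<close> and the root 0: it reads
  \<open>Q'(0) / (4 S) + Q''(0) / 24\<close>, sends that root to infinity and leaves a cubic without
  quadratic term.\<close>

definition U :: "real \<Rightarrow> real" where "U y = 1 / 12 + H / (4 * S y)"

lemma U_solution: "solution U (\<lambda>y. - H * S1 y / (4 * (S y)\<^sup>2))"
  unfolding solution_def
proof (intro allI conjI)
  fix y
  define u x where "u = S y" "x = S1 y"
  have u: "u \<noteq> 0" using S_pos[of y] by (simp add: u_x_def)
  have sq: "x\<^sup>2 = u\<^sup>2 - a / 3 * u ^ 4 + H * u" unfolding u_x_def by (rule on_UNIV(2))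
  show "(U has_real_derivative - H * S1 y / (4 * (S y)\<^sup>2)) (at y)"
    unfolding U_def[abs_def] using u
    by (auto intro!: derivative_eq_intros on_UNIV(1) simp: u_x_def power2_eq_square field_simps)
  have "((\<lambda>y. - H * S1 y / (4 * (S y)\<^sup>2)) has_real_derivative
      (- H * (u - 2 * a / 3 * u ^ 3 + H / 2) * (4 * u\<^sup>2) - - H * x * (4 * (2 * u * x))) / ((4 * u\<^sup>2) * (4 * u\<^sup>2))) (at y)"
  proof -
    have num: "((\<lambda>y. - H * S1 y) has_real_derivative - H * (u - 2 * a / 3 * u ^ 3 + H / 2)) (at y)"
      unfolding u_x_def by (rule DERIV_cmult[OF on_UNIV(3)])
    have den: "((\<lambda>y. 4 * (S y)\<^sup>2) has_real_derivative 4 * (2 * u * x)) (at y)"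
      unfolding u_x_def by (auto intro!: derivative_eq_intros on_UNIV(1))
    from DERIV_divide[OF num den] u show ?thesis by (simp add: u_x_def)
  qed
  also have "(- H * (u - 2 * a / 3 * u ^ 3 + H / 2) * (4 * u\<^sup>2) - - H * x * (4 * (2 * u * x))) / ((4 * u\<^sup>2) * (4 * u\<^sup>2))
      = (- H * (u - 2 * a / 3 * u ^ 3 + H / 2) * (4 * u\<^sup>2) + 8 * H * u * x\<^sup>2) / (16 * u ^ 4)"
    by (simp add: power2_eq_square power4_eq_xxxx mult_ac)
  also have "\<dots> = 6 * (U y)\<^sup>2 - 1 / 12 / 2"
    unfolding sq U_def u_x_def(1)[symmetric] using u
    by (simp add: field_simps power2_eq_square power3_eq_cube power4_eq_xxxx)
  finally show "((\<lambda>y. - H * S1 y / (4 * (S y)\<^sup>2)) has_real_derivative 6 * (U y)\<^sup>2 - 1 / 12 / 2) (at y)" .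
  have "(- H * S1 y / (4 * (S y)\<^sup>2))\<^sup>2 = H\<^sup>2 * x\<^sup>2 / (16 * u ^ 4)"
    by (simp add: u_x_def power2_eq_square power4_eq_xxxx mult_ac)
  also have "\<dots> = 4 * U y ^ 3 - 1 / 12 * U y - g3_inv a H"
    unfolding sq U_def u_x_def(1)[symmetric] g3_inv_def using u
    by (simp add: field_simps power2_eq_square power3_eq_cube power4_eq_xxxx)
  finally show "(- H * S1 y / (4 * (S y)\<^sup>2))\<^sup>2 = 4 * U y ^ 3 - 1 / 12 * U y - g3_inv a H" .
qed

lemma U_le: "U y \<le> e2 \<theta>"
proof -
  have "U y < 1 / 12" using S_pos[of y] H by (simp add: U_def divide_neg_pos)
  thus ?thesis using solution_range[OF U_solution, of y] e1_gt[OF \<theta>] by linarith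
qed

lemma U_ge: "e3 \<theta> \<le> U y"
  using solution_range[OF U_solution, of y] roots_less by auto

lemma S_U: "S y = 3 * H / (12 * U y - 1)"
  using S_pos[of y] H by (simp add: U_def field_simps)

lemma S_periodic: "\<exists>T>0. \<forall>y. S (y + T) = S y"
proof -
  obtain T where T: "0 < T" "\<And>y. U (y + T) = U y"
    using solution_periodic[OF U_solution U_le] by metis
  have "S (y + T) = S y" for y
    unfolding S_U[of "y + T"] S_U[of y] T(2) ..
  thus ?thesis using T(1) by blast
qed

section \<open>Density, pressure and the energy conditions\<close>

definition curv :: "real \<Rightarrow> real" where "curv t = - 3 * H / s t"

lemma curv_U: "t \<in> I \<Longrightarrow> curv t = 1 - 12 * U (\<tau> t)"
  by (simp add: curv_def U_def S_eq)

lemma curv_range: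
  assumes "t \<in> I"
  shows "y_lo \<theta> \<le> curv t" "curv t \<le> y_hi \<theta>"
  using U_le[of "\<tau> t"] U_ge[of "\<tau> t"] unfolding e2_y_lo e3_y_hi by (simp_all add: curv_U[OF assms])

text \<open>Every real number occurs as a conformal time, so both turning values are reached at
  times in \<open>I\<close>; this makes the bounds on \<open>\<Lambda>\<close> sharp.\<close>

lemma curv_attains:
  obtains p q where "p \<in> I" "curv p = y_hi \<theta>" "q \<in> I" "curv q = y_lo \<theta>"
proof -
  obtain p q where "U p = e3 \<theta>" "U q = e2 \<theta>"
    using solution_attains[OF U_solution U_le] by metis
  moreover have "T y \<in> I" "U (\<tau> (T y)) = U y" for y
    using T_in_I[of y] by (simp_all add: J_eq_UNIV)
  ultimately show thesis
    by (intro that[of "T p" "T q"]) (simp_all add: curv_U e2_y_lo e3_y_hi)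
qed

lemma a_eq: "9 * a * H\<^sup>2 = 2 * (1 - cos (3 * \<theta>))"
  using angular_parameter_invariant[OF angular] by (simp add: g3_inv_def)

lemma density_curv:
  assumes "t \<in> I"
  shows "72 * pi * H\<^sup>2 * energy_density \<Lambda> s t = 6 * (curv t)\<^sup>2 - curv t ^ 3 - 9 * a * H\<^sup>2 - 9 * H\<^sup>2 * \<Lambda>"
proof -
  have "72 * pi * H\<^sup>2 * energy_density \<Lambda> s t
      = 27 * H\<^sup>2 * ((s1 t)\<^sup>2 / (s t)\<^sup>2 + 1 / (s t)\<^sup>2 - \<Lambda> / 3)"
    by (simp add: energy_density_def s1_def)
  also have "\<dots> = 6 * (curv t)\<^sup>2 - curv t ^ 3 - 9 * a * H\<^sup>2 - 9 * H\<^sup>2 * \<Lambda>"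
    unfolding first_order[OF assms] curv_def using s_pos[OF assms]
    by (simp add: field_simps power2_eq_square power3_eq_cube)
  finally show ?thesis .
qed

lemma pressure_curv:
  assumes "t \<in> I"
  shows "72 * pi * H\<^sup>2 * pressure \<Lambda> s t = 9 * a * H\<^sup>2 - 2 * (curv t)\<^sup>2 + 9 * H\<^sup>2 * \<Lambda>"
proof -
  have "72 * pi * H\<^sup>2 * pressure \<Lambda> s t
      = - 18 * H\<^sup>2 / s t * (s2 t + 1 / (2 * s t) * ((s1 t)\<^sup>2 + 1) - \<Lambda> / 2 * s t)"
    by (simp add: pressure_def s1_def s2_def)
  also have "\<dots> = 9 * a * H\<^sup>2 - 2 * (curv t)\<^sup>2 + 9 * H\<^sup>2 * \<Lambda>"
    unfolding first_order[OF assms] second_order[OF assms] curv_def using s_pos[OF assms]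
    by (simp add: field_simps power2_eq_square power3_eq_cube)
  finally show ?thesis .
qed

lemma scaled_le:
  "x \<le> y \<longleftrightarrow> 72 * pi * H\<^sup>2 * x \<le> 72 * pi * H\<^sup>2 * y"
proof -
  have "0 < 72 * pi * H\<^sup>2" using H by simp
  thus ?thesis by (simp only: mult_le_cancel_left_pos)
qed

text \<open>Both extremes solve the same cubic, so \<open>a\<close> can be eliminated at whichever
  end decides a condition.\<close>

lemma a_curv: "9 * a * H\<^sup>2 = 3 * (y_lo \<theta>)\<^sup>2 - y_lo \<theta> ^ 3" "9 * a * H\<^sup>2 = 3 * (y_hi \<theta>)\<^sup>2 - y_hi \<theta> ^ 3"
  using a_eq cubic_y_lo[of \<theta>] cubic_y_hi[of \<theta>] by simp_all

lemma nine_H_le: "x \<le> y / (9 * H\<^sup>2) \<longleftrightarrow> 9 * H\<^sup>2 * x \<le> y" "y / (9 * H\<^sup>2) \<le> x \<longleftrightarrow> y \<le> 9 * H\<^sup>2 * x"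
proof -
  have "0 < 9 * H\<^sup>2" using H by simp
  thus "x \<le> y / (9 * H\<^sup>2) \<longleftrightarrow> 9 * H\<^sup>2 * x \<le> y" "y / (9 * H\<^sup>2) \<le> x \<longleftrightarrow> y \<le> 9 * H\<^sup>2 * x"
    by (simp_all only: pos_le_divide_eq pos_divide_le_eq mult.commute)
qed

text \<open>Nonnegativity of the density is used where \<open>curv\<close> equals
  \<open>y_lo\<close>: eliminating \<open>a\<close> cancels the cubic terms there and leaves
  \<open>3 * (y_lo \<theta>)\<^sup>2\<close>.\<close>

lemma \<Lambda>_le_f1: "\<Lambda> \<le> f1 \<theta> H"
proof -
  obtain q where q: "q \<in> I" "curv q = y_lo \<theta>" using curv_attains by metis
  have "0 \<le> 72 * pi * H\<^sup>2 * energy_density \<Lambda> s q"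
    using density_nonneg[OF q(1) s_pos[OF q(1)]] by simp
  hence "9 * H\<^sup>2 * \<Lambda> \<le> 3 * (y_lo \<theta>)\<^sup>2"
    unfolding density_curv[OF q(1)] q(2) a_curv(1) by linarith
  moreover have "f1 \<theta> H = 3 * (y_lo \<theta>)\<^sup>2 / (9 * H\<^sup>2)" by (simp add: f1_y_lo)
  ultimately show ?thesis by (simp only: nine_H_le)
qed

text \<open>Both \<open>a\<close> and \<open>\<Lambda>\<close> cancel in the sum of density and
  pressure. What remains is \<open>(curv t)\<^sup>2 * (4 - curv t)\<close>, and \<open>curv\<close>
  stays below 3.\<close>

lemma weak: "t \<in> I \<Longrightarrow> - energy_density \<Lambda> s t \<le> pressure \<Lambda> s t"
proof -
  assume t: "t \<in> I"
  have "0 \<le> (curv t)\<^sup>2 * (4 - curv t)"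
    using curv_range(2)[OF t] y_hi_range(2)[OF \<theta>] by (intro mult_nonneg_nonneg) auto
  hence "0 \<le> 4 * (curv t)\<^sup>2 - curv t ^ 3"
    by (simp add: power2_eq_square power3_eq_cube algebra_simps)
  thus ?thesis
    unfolding scaled_le[of "- energy_density \<Lambda> s t"] mult_minus_right density_curv[OF t] pressure_curv[OF t]
    by linarith
qed

lemma cubic_mono:
  fixes u v :: real
  assumes "0 \<le> u" "u \<le> v" "v \<le> 3"
  shows "8 * u\<^sup>2 - u ^ 3 \<le> 8 * v\<^sup>2 - v ^ 3"
proof -
  have "u\<^sup>2 + u * v + v\<^sup>2 \<le> 3 * u + 3 * u + 3 * v"
    unfolding power2_eq_square
    using mult_right_mono[of u 3 u] mult_right_mono[of v 3 u] mult_right_mono[of v 3 v] assms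
    by (auto simp: mult.commute)
  hence "0 \<le> (v - u) * (8 * (u + v) - (u\<^sup>2 + u * v + v\<^sup>2))"
    using assms by (intro mult_nonneg_nonneg) auto
  also have "\<dots> = (8 * v\<^sup>2 - v ^ 3) - (8 * u\<^sup>2 - u ^ 3)"
    by (simp add: power2_eq_square power3_eq_cube algebra_simps)
  finally show ?thesis by simp
qed

text \<open>Density minus pressure depends on time through
  \<open>8 * (curv t)\<^sup>2 - curv t ^ 3\<close>, which increases with \<open>curv\<close> on
  \<open>{0..3}\<close>, so the smallest value of \<open>curv\<close> decides.\<close>

lemma pressure_le_density_iff:
  "(\<forall>t\<in>I. pressure \<Lambda> s t \<le> energy_density \<Lambda> s t) \<longleftrightarrow> \<Lambda> \<le> f2 \<theta> H"
proof -
  have at: "pressure \<Lambda> s t \<le> energy_density \<Lambda> s t \<longleftrightarrow>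
      18 * H\<^sup>2 * \<Lambda> \<le> 8 * (curv t)\<^sup>2 - curv t ^ 3 - 2 * (9 * a * H\<^sup>2)" if "t \<in> I" for t
    unfolding scaled_le[of "pressure \<Lambda> s t"] density_curv[OF that] pressure_curv[OF that]
    by (auto simp: algebra_simps)
  have low: "8 * (y_lo \<theta>)\<^sup>2 - y_lo \<theta> ^ 3 \<le> 8 * (curv t)\<^sup>2 - curv t ^ 3" if "t \<in> I" for t
    using curv_range[OF that] y_lo_range(1)[OF \<theta>] y_hi_range(2)[OF \<theta>] by (intro cubic_mono) auto
  obtain q where q: "q \<in> I" "curv q = y_lo \<theta>" using curv_attains by metis
  have "(\<forall>t\<in>I. pressure \<Lambda> s t \<le> energy_density \<Lambda> s t) \<longleftrightarrow>
      18 * H\<^sup>2 * \<Lambda> \<le> 8 * (y_lo \<theta>)\<^sup>2 - y_lo \<theta> ^ 3 - 2 * (9 * a * H\<^sup>2)"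
  proof
    assume "\<forall>t\<in>I. pressure \<Lambda> s t \<le> energy_density \<Lambda> s t"
    thus "18 * H\<^sup>2 * \<Lambda> \<le> 8 * (y_lo \<theta>)\<^sup>2 - y_lo \<theta> ^ 3 - 2 * (9 * a * H\<^sup>2)"
      using at[OF q(1)] q by simp
  next
    assume *: "18 * H\<^sup>2 * \<Lambda> \<le> 8 * (y_lo \<theta>)\<^sup>2 - y_lo \<theta> ^ 3 - 2 * (9 * a * H\<^sup>2)"
    show "\<forall>t\<in>I. pressure \<Lambda> s t \<le> energy_density \<Lambda> s t"
    proof
      fix t assume t: "t \<in> I"
      show "pressure \<Lambda> s t \<le> energy_density \<Lambda> s t"
        unfolding at[OF t] using * low[OF t] by linarith
    qed
  qed
  also have "\<dots> \<longleftrightarrow> 9 * H\<^sup>2 * \<Lambda> \<le> (y_lo \<theta>)\<^sup>2 + y_lo \<theta> ^ 3 / 2"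
    unfolding a_curv(1) by (auto simp: field_simps)
  also have "\<dots> \<longleftrightarrow> \<Lambda> \<le> f2 \<theta> H"
    unfolding f2_y_lo nine_H_le ..
  finally show ?thesis .
qed

text \<open>In the density plus three times the pressure the quadratic terms cancel and
  \<open>- curv t ^ 3\<close> remains, so the largest value of \<open>curv\<close> decides.\<close>

lemma strong_lower_iff:
  "(\<forall>t\<in>I. - energy_density \<Lambda> s t / 3 \<le> pressure \<Lambda> s t) \<longleftrightarrow> f3 \<theta> H \<le> \<Lambda>"
proof -
  have at: "- energy_density \<Lambda> s t / 3 \<le> pressure \<Lambda> s t \<longleftrightarrow>
      curv t ^ 3 - 2 * (9 * a * H\<^sup>2) \<le> 18 * H\<^sup>2 * \<Lambda>" if "t \<in> I" for t
  proof -
    have "- energy_density \<Lambda> s t / 3 \<le> pressure \<Lambda> s t \<longleftrightarrow>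
        - energy_density \<Lambda> s t \<le> 3 * pressure \<Lambda> s t" by auto
    also have "\<dots> \<longleftrightarrow> - (72 * pi * H\<^sup>2 * energy_density \<Lambda> s t) \<le> 3 * (72 * pi * H\<^sup>2 * pressure \<Lambda> s t)"
      unfolding scaled_le[of "- energy_density \<Lambda> s t"] by (simp add: mult_ac)
    finally show ?thesis
      unfolding density_curv[OF that] pressure_curv[OF that] by (simp add: algebra_simps)
  qed
  have pos: "0 \<le> curv t" if "t \<in> I" for t
    using curv_range(1)[OF that] y_lo_range(1)[OF \<theta>] by linarith
  obtain p where p: "p \<in> I" "curv p = y_hi \<theta>" using curv_attains by metis
  have "(\<forall>t\<in>I. - energy_density \<Lambda> s t / 3 \<le> pressure \<Lambda> s t) \<longleftrightarrow>
      y_hi \<theta> ^ 3 - 2 * (9 * a * H\<^sup>2) \<le> 18 * H\<^sup>2 * \<Lambda>"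
  proof
    assume "\<forall>t\<in>I. - energy_density \<Lambda> s t / 3 \<le> pressure \<Lambda> s t"
    thus "y_hi \<theta> ^ 3 - 2 * (9 * a * H\<^sup>2) \<le> 18 * H\<^sup>2 * \<Lambda>"
      using at[OF p(1)] p by simp
  next
    assume *: "y_hi \<theta> ^ 3 - 2 * (9 * a * H\<^sup>2) \<le> 18 * H\<^sup>2 * \<Lambda>"
    show "\<forall>t\<in>I. - energy_density \<Lambda> s t / 3 \<le> pressure \<Lambda> s t"
    proof
      fix t assume t: "t \<in> I"
      have "curv t ^ 3 \<le> y_hi \<theta> ^ 3" using curv_range(2)[OF t] pos[OF t] by (rule power_mono)
      thus "- energy_density \<Lambda> s t / 3 \<le> pressure \<Lambda> s t"
        unfolding at[OF t] using * by linarith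
    qed
  qed
  also have "\<dots> \<longleftrightarrow> 3 / 2 * (y_hi \<theta>) ^ 3 - 3 * (y_hi \<theta>)\<^sup>2 \<le> 9 * H\<^sup>2 * \<Lambda>"
    unfolding a_curv(2) by (auto simp: field_simps)
  also have "\<dots> \<longleftrightarrow> f3 \<theta> H \<le> \<Lambda>"
    unfolding f3_y_hi nine_H_le ..
  finally show ?thesis .
qed

lemma weak_energy: "weak_energy_condition I s \<Lambda>"
  using weak by (simp add: weak_energy_condition_def)

lemma dominant_iff: "dominant_energy_condition I s \<Lambda> \<longleftrightarrow> \<Lambda> \<le> f2 \<theta> H"
  unfolding dominant_energy_condition_def pressure_le_density_iff[symmetric]
  using weak s_pos by auto

lemma strong_iff:
  "strong_energy_condition I s \<Lambda> \<longleftrightarrow> \<theta> \<in> {- pi / 3<..theta_I} \<and> f3 \<theta> H \<le> \<Lambda> \<and> \<Lambda> \<le> f2 \<theta> H"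
proof -
  have "strong_energy_condition I s \<Lambda> \<longleftrightarrow> f3 \<theta> H \<le> \<Lambda> \<and> \<Lambda> \<le> f2 \<theta> H"
    unfolding strong_energy_condition_def pressure_le_density_iff[symmetric] strong_lower_iff[symmetric]
    using s_pos by auto
  moreover have "f3 \<theta> H \<le> f2 \<theta> H \<longleftrightarrow> \<theta> \<le> theta_I"
    using f3_le_f2_iff[of H \<theta>] theta_I_gap[OF \<theta>] H by simp
  ultimately show ?thesis using \<theta>(1) by auto
qed

lemma nondegenerate: "nondegenerate_lorentz_metric UNIV S"
  unfolding nondegenerate_lorentz_metric_def
proof (intro conjI ballI)
  have "smooth_real_on UNIV (\<lambda>y. poly [:0, 0, 1:] (S y))"
  proof (rule smooth_poly_ode)
    show "(S has_real_derivative S1 y) (at y)" for y by (rule on_UNIV)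
    show "(S1 has_real_derivative poly [:H / 2, 1, 0, - (2 * a / 3):] (S y)) (at y)" for y
      using on_UNIV(3)[of y] by (simp add: power3_eq_cube algebra_simps)
    show "(S1 y)\<^sup>2 = poly [:0, H, 1, 0, - (a / 3):] (S y)" for y
      using on_UNIV(2)[of y] by (simp add: power2_eq_square power4_eq_xxxx algebra_simps)
  qed
  thus "smooth_real_on UNIV (\<lambda>y. (S y)\<^sup>2)" by (simp add: power2_eq_square)
  show "lorentz_form (tangent_space p) (conformal_metric S p)" for p
    using S_pos[of "fst p"] by (intro lorentz_form_conformal_metric) simp
qed

lemma metric_formula:
  assumes "half_periods \<theta> w w'"
  shows "\<exists>c. \<forall>y. (S y)\<^sup>2 = 9 * H\<^sup>2 / (12 * wp_shifted w w' (y + c) - 1)\<^sup>2"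
proof -
  let ?V = "wp_shifted w w'"
  obtain V' where V: "\<And>y. (?V has_real_derivative V' y) (at y)"
    "\<And>y. (V' has_real_derivative 6 * (?V y)\<^sup>2 - 1 / 24) (at y)"
    "\<And>y. (V' y)\<^sup>2 = 4 * ?V y ^ 3 - ?V y / 12 + cos (3 * \<theta>) / 216"
    and per: "0 < w" "\<And>y. ?V (y + 2 * w) = ?V y"
    using wp_shifted_ode[OF assms] by metis
  have sol: "solution ?V V'"
    unfolding solution_def using V by (simp add: angular_parameter_invariant[OF angular])
  \<comment> \<open>The real period \<open>2 * w\<close> excludes the branch beyond
    \<open>e1\<close>.\<close>
  have "?V y \<le> e2 \<theta>" for y
    by (rule periodic_solution_bounded[OF sol _ per(2)]) (use per(1) in simp)
  \<comment> \<open>The translation \<open>c\<close> reflects the arbitrary origin of conformal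
    time, fixed here by \<open>t0\<close>.\<close>
  then obtain c where "\<And>y. U y = ?V (y + c)"
    using solutions_translates[OF U_solution U_le sol] by metis
  hence "(S y)\<^sup>2 = 9 * H\<^sup>2 / (12 * ?V (y + c) - 1)\<^sup>2" for y
    by (simp add: S_U[of y] power_divide power_mult_distrib)
  thus ?thesis by blast
qed

end

theorem theorem3:
  fixes I :: "real set" and s :: "real \<Rightarrow> real" and \<Lambda> a H \<theta> t0 :: real
  assumes "closed_RW_spacetime I s \<Lambda>"
    and "m_critical I s \<Lambda>"
    and "nonconstant_on I s"
    and "internal_parameters I s a H"
    and "H < 0"
    and "class_I a H"
    and "angular_parameter a H \<theta>"
    and "t0 \<in> I"
  shows
    "(\<exists>!x. x \<in> {- pi / 3<..<0} \<and> theta_I_equation x) \<and>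
     \<bar>theta_I - (- 0.7706314502)\<bar> < 1 / 10 ^ 10 \<and>
     \<Lambda> \<le> f1 \<theta> H \<and>
     conformal_manifold (conformal_domain I s t0) = UNIV \<times> sphere 0 1 \<and>
     cyclic (conformal_domain I s t0) (conformal_scale I s t0) \<and>
     nondegenerate_lorentz_metric (conformal_domain I s t0) (conformal_scale I s t0) \<and>
     (\<forall>w w'. half_periods \<theta> w w' \<longrightarrow>
        (\<exists>c. \<forall>p\<in>conformal_manifold (conformal_domain I s t0).
           \<forall>X\<in>tangent_space p. \<forall>Y\<in>tangent_space p.
             conformal_metric (conformal_scale I s t0) p X Y =
             9 * H\<^sup>2 / (12 * wp_shifted w w' (fst p + c) - 1)\<^sup>2 * product_metric X Y)) \<and>
     weak_energy_condition I s \<Lambda> \<and>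
     (dominant_energy_condition I s \<Lambda> \<longleftrightarrow> \<Lambda> \<le> f2 \<theta> H) \<and>
     (strong_energy_condition I s \<Lambda> \<longleftrightarrow>
        \<theta> \<in> {- pi / 3<..theta_I} \<and> f3 \<theta> H \<le> \<Lambda> \<and> \<Lambda> \<le> f2 \<theta> H)"
proof -
  interpret critical_RW I s \<Lambda> a H \<theta> t0
    by unfold_locales fact+
  have "\<exists>c. \<forall>p\<in>conformal_manifold J. \<forall>X\<in>tangent_space p. \<forall>Y\<in>tangent_space p.
      conformal_metric S p X Y = 9 * H\<^sup>2 / (12 * wp_shifted w w' (fst p + c) - 1)\<^sup>2 * product_metric X Y"
    if hp: "half_periods \<theta> w w'" for w w'
    using metric_formula[OF hp] unfolding conformal_metric_def by metis
  moreover have "conformal_manifold J = UNIV \<times> sphere 0 1"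
    by (simp add: conformal_manifold_def J_eq_UNIV)
  moreover have "cyclic J S"
    using S_periodic by (simp add: cyclic_def J_eq_UNIV)
  moreover have "nondegenerate_lorentz_metric J S"
    using nondegenerate by (simp add: J_eq_UNIV)
  ultimately show ?thesis
    using theta_I_ex1 theta_I_approx \<Lambda>_le_f1 weak_energy dominant_iff strong_iff by blast
qed

end
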